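(* Let $\mu$ be an infinitely divisible distribution on $\mathbb{R}$ with characteristic triplet $(\sigma^2,\gamma,\nu)$ and symmetrized jump measure $\nu_s$. Assume that for some $\delta\in(0,1)$ the measure $x\,\nu_s(\mathrm{d}x)$ admits on $(0,\delta]$ a Lebesgue density $k_s$ with $k_s\in BV([\varepsilon,\delta])$ for all $\varepsilon\in(0,\delta)$, that $\|(Dk_s)^+\|_{TV([0,\delta])}=\lim_{\varepsilon\downarrow0}\|(Dk_s)^+\|_{TV([\varepsilon,\delta])}<\infty$, and that $k_s\in BV([0,\delta])$. Suppose further that $x\nu$ (the measure $x\,\nu(\mathrm{d}x)$) is absolutely continuous on $\mathbb{R}$. Let $\alpha:=k_s(0+)\notin\mathbb{N}$ be positive. Then the Lebesgue density $f$ of $\mu$ satisfies $f\in C^n(\mathbb{R})$ for $n\in\mathbb{N}$ if and only if $0\le n<\alpha-1$.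
   Context: An infinitely divisible distribution $\mu$ on $\mathbb{R}$ with characteristic triplet $(\sigma^2,\gamma,\nu)$ (diffusion coefficient $\sigma^2\ge0$, drift parameter $\gamma\in\mathbb{R}$, Lévy measure $\nu$) has characteristic function $$\varphi(u)=\int e^{iux}\mu(\mathrm{d}x)=\exp\Big(-\tfrac{\sigma^2}{2}u^2+i\gamma u+\int\big(e^{iux}-1-iux\mathbf{1}_{[-1,1]}(x)\big)\nu(\mathrm{d}x)\Big),\quad u\in\mathbb{R}.$$ The symmetrized jump measure is $\nu_s(A):=\nu(A)+\nu(-A)$ for Borel sets $A\subseteq\mathbb{R}_+$. Absolute continuity is with respect to Lebesgue measure. If the distributional derivative of a locally integrable function $g$ is a finite signed measure, this measure is denoted $Dg$, and $g$ is said to be of bounded variation; $BV([a,b])$ is the space of such functions on $[a,b]$. For a finite signed measure $\rho$ with Jordan decomposition $\rho=\rho^+-\rho^-$ into positive finite measures, $\|\rho\|_{TV}$ is the total mass of $\rho^++\rho^-$, and $\|\rho\|_{TV([a,b])}$ is the same quantity on the interval $[a,b]$; $(Dk_s)^+$ is the positive part of $Dk_s$. $g(x+)$ denotes the right limit of $g$ at $x$. $C^n(\mathbb{R})$ denotes the $n$ times continuously differentiable functions on $\mathbb{R}$.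
   Formalization: The "only if" direction (f ∈ C^n implies n < α−1) is stated only for σ² = 0, since for σ² > 0 the density is always C^∞ and it fails (e.g. standard normal convolved with Gamma(1/2)); existence of f and the "if" direction are stated for all σ² ≥ 0. *)

theory Defs
  imports "HOL-Probability.Probability"
begin

section \<open>Infinitely divisible distributions\<close>

primrec conv_power :: "nat \<Rightarrow> real measure \<Rightarrow> real measure" where
  "conv_power 0 M = return borel 0"
| "conv_power (Suc n) M = convolution M (conv_power n M)"

definition infinitely_divisible :: "real measure \<Rightarrow> bool" where
  "infinitely_divisible \<mu> \<longleftrightarrow> real_distribution \<mu> \<and>
     (\<forall>n\<ge>1. \<exists>M. real_distribution M \<and> \<mu> = conv_power n M)"

definition levy_measure :: "real measure \<Rightarrow> bool" where
  "levy_measure \<nu> \<longleftrightarrow> sets \<nu> = sets borel \<and> emeasure \<nu> {0} = 0 \<and>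
     (\<integral>\<^sup>+ x. ennreal (min 1 (x\<^sup>2)) \<partial>\<nu>) < \<infinity>"

text \<open>The first parameter is the variance \<open>\<sigma>\<^sup>2\<close> itself, not its square root.\<close>

definition has_triplet :: "real measure \<Rightarrow> real \<Rightarrow> real \<Rightarrow> real measure \<Rightarrow> bool" where
  "has_triplet \<mu> \<sigma>2 \<gamma> \<nu> \<longleftrightarrow> \<sigma>2 \<ge> 0 \<and> levy_measure \<nu> \<and>
     (\<forall>u. char \<mu> u = exp (- complex_of_real (\<sigma>2 / 2 * u\<^sup>2) + \<i> * complex_of_real (\<gamma> * u)
        + (CLINT x|\<nu>. iexp (u * x) - 1 - \<i> * complex_of_real (u * x * indicator {-1..1} x))))"

definition sym_jump_measure :: "real measure \<Rightarrow> real measure" where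
  "sym_jump_measure \<nu> = measure_of {0..} (sets (restrict_space borel {0..}))
     (\<lambda>A. emeasure \<nu> A + emeasure \<nu> (uminus ` A))"

lemma emeasure_sym_jump_measure:
  assumes "sets \<nu> = sets borel" "A \<in> sets borel" "A \<subseteq> {0..}"
  shows "emeasure (sym_jump_measure \<nu>) A = emeasure \<nu> A + emeasure \<nu> (uminus ` A)"
proof -
  let ?M = "restrict_space borel {0::real..}"
  let ?f = "\<lambda>A. emeasure \<nu> A + emeasure \<nu> (uminus ` A)"
  have sp: "sets ?M = {A. A \<in> sets borel \<and> A \<subseteq> {0..}}"
    by (auto simp: sets_restrict_space_iff)
  have neg: "uminus ` B \<in> sets borel" if "B \<in> sets borel" for B :: "real set"
  proof -
    have "uminus ` B = uminus -` B"
      by (auto simp: image_iff) (metis add.inverse_inverse)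
    then show ?thesis
      using measurable_sets[of "uminus :: real \<Rightarrow> real" borel borel B] that by simp
  qed
  have alg: "sigma_algebra {0..} (sets ?M)"
    using sets.sigma_algebra_axioms[of ?M] by (simp add: space_restrict_space)
  have ca: "countably_additive (sets ?M) ?f"
  proof (rule countably_additiveI)
    fix B :: "nat \<Rightarrow> real set"
    assume r: "range B \<subseteq> sets ?M" and d: "disjoint_family B"
    have B: "B i \<in> sets borel" for i using r sp by blast
    have d': "disjoint_family (\<lambda>i. uminus ` B i)"
      using d by (fastforce simp: disjoint_family_on_def)
    have 1: "(\<Sum>i. emeasure \<nu> (B i)) = emeasure \<nu> (\<Union>i. B i)"
      using B d assms(1) by (intro suminf_emeasure) auto
    have 2: "(\<Sum>i. emeasure \<nu> (uminus ` B i)) = emeasure \<nu> (\<Union>i. uminus ` B i)"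
      using B neg d' assms(1) by (intro suminf_emeasure) auto
    show "(\<Sum>i. ?f (B i)) = ?f (\<Union>i. B i)"
      by (simp add: suminf_add[symmetric] 1 2 image_UN)
  qed
  have po: "positive (sets ?M) ?f"
    by (simp add: positive_def)
  show ?thesis
    unfolding sym_jump_measure_def
    by (rule emeasure_measure_of_sigma[OF alg po ca]) (use assms sp in auto)
qed

text \<open>\<open>k\<close> is a Lebesgue density of the measure \<open>x \<rho>(dx)\<close> on the Borel set \<open>B\<close>.
  Nonnegativity is required explicitly because \<open>ennreal\<close> truncates negative values.\<close>

definition x_density_on :: "real set \<Rightarrow> real measure \<Rightarrow> (real \<Rightarrow> real) \<Rightarrow> bool" where
  "x_density_on B \<rho> k \<longleftrightarrow> k \<in> borel_measurable borel \<and>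
     (AE x in lborel. x \<in> B \<longrightarrow> 0 \<le> k x) \<and>
     (\<forall>A\<in>sets borel. A \<subseteq> B \<longrightarrow>
        (\<integral>\<^sup>+ x\<in>A. ennreal x \<partial>\<rho>) = (\<integral>\<^sup>+ x\<in>A. ennreal (k x) \<partial>lborel))"

text \<open>The possibly infinite signed measure \<open>x \<nu>(dx)\<close> has total variation \<open>\<bar>x\<bar> \<nu>(dx)\<close>, and a
  signed measure is absolutely continuous iff its total variation is.\<close>

definition x_measure_ac :: "real measure \<Rightarrow> bool" where
  "x_measure_ac \<nu> \<longleftrightarrow> absolutely_continuous lborel (density \<nu> (\<lambda>x. ennreal \<bar>x\<bar>))"


section \<open>Functions of class \<open>C\<^sup>n\<close> and bounded variation\<close>

definition C_class :: "nat \<Rightarrow> (real \<Rightarrow> real) \<Rightarrow> bool" where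
  "C_class n f \<longleftrightarrow> (\<forall>i<n. \<forall>x. (deriv ^^ i) f differentiable (at x)) \<and>
     continuous_on UNIV ((deriv ^^ n) f)"

definition test_function :: "real \<Rightarrow> real \<Rightarrow> (real \<Rightarrow> real) \<Rightarrow> bool" where
  "test_function a b \<psi> \<longleftrightarrow> (\<forall>n. C_class n \<psi>) \<and>
     compact (closure {x. \<psi> x \<noteq> 0}) \<and> closure {x. \<psi> x \<noteq> 0} \<subseteq> {a<..<b}"

text \<open>A finite signed measure on the open interval \<open>(a, b)\<close> is encoded by its Jordan
  decomposition: a pair of mutually singular finite positive measures, extended by 0 to the line.\<close>

definition jordan_pair :: "real \<Rightarrow> real \<Rightarrow> real measure \<times> real measure \<Rightarrow> bool" where
  "jordan_pair a b = (\<lambda>(P, N).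
     finite_measure P \<and> finite_measure N \<and> sets P = sets borel \<and> sets N = sets borel \<and>
     emeasure P (- {a<..<b}) = 0 \<and> emeasure N (- {a<..<b}) = 0 \<and>
     (\<exists>S\<in>sets borel. emeasure P (- S) = 0 \<and> emeasure N S = 0))"

text \<open>The function \<open>g\<close> is regarded on \<open>[a, b]\<close> only, so its distributional derivative is a
  distribution on the open interval: no jumps at the end points arise from extending \<open>g\<close> by 0.\<close>

definition has_distr_deriv ::
    "(real \<Rightarrow> real) \<Rightarrow> real \<Rightarrow> real \<Rightarrow> real measure \<times> real measure \<Rightarrow> bool" where
  "has_distr_deriv g a b = (\<lambda>(P, N). jordan_pair a b (P, N) \<and>
     (\<forall>\<psi>. test_function a b \<psi> \<longrightarrow>
        (LINT x:{a<..<b}|lborel. g x * deriv \<psi> x) =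
          - ((\<integral>x. \<psi> x \<partial>P) - (\<integral>x. \<psi> x \<partial>N))))"

definition BV :: "real \<Rightarrow> real \<Rightarrow> (real \<Rightarrow> real) set" where
  "BV a b = {g. set_integrable lborel {a..b} g \<and> (\<exists>\<rho>. has_distr_deriv g a b \<rho>)}"

text \<open>The unique Jordan pair of \<open>Dg\<close>; meaningful for \<open>g \<in> BV a b\<close>.\<close>

definition distr_deriv :: "(real \<Rightarrow> real) \<Rightarrow> real \<Rightarrow> real \<Rightarrow> real measure \<times> real measure" where
  "distr_deriv g a b = (THE \<rho>. has_distr_deriv g a b \<rho>)"

text \<open>The total variation norm of the positive part \<open>(Dg)\<^sup>+\<close> on \<open>[a, b]\<close>.\<close>

definition TV_pos :: "(real \<Rightarrow> real) \<Rightarrow> real \<Rightarrow> real \<Rightarrow> real" where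
  "TV_pos g a b = measure (fst (distr_deriv g a b)) UNIV"


section \<open>Lebesgue densities and their regularity\<close>

definition lebesgue_density :: "real measure \<Rightarrow> (real \<Rightarrow> real) \<Rightarrow> bool" where
  "lebesgue_density \<mu> f \<longleftrightarrow> f \<in> borel_measurable borel \<and> (AE x in lborel. 0 \<le> f x) \<and>
     \<mu> = density lborel (\<lambda>x. ennreal (f x))"

text \<open>A density is only determined almost everywhere, so it belongs to \<open>C\<^sup>n\<close> iff it has a
  version that does.\<close>

definition ae_C_class :: "nat \<Rightarrow> (real \<Rightarrow> real) \<Rightarrow> bool" where
  "ae_C_class n f \<longleftrightarrow> (\<exists>g. C_class n g \<and> (AE x in lborel. f x = g x))"

end

theory Submission
  imports Defs
begin

text \<open>Let \<open>\<phi>\<close> be the characteristic function of \<open>\<mu>\<close>. Since \<open>x\<nu>\<close> is absolutely continuous, \<open>\<nu>\<close> has a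
Lebesgue density \<open>b\<close>, and \<open>x (b(x) + b(-x)) = k x\<close> tends to \<open>\<alpha>\<close> as \<open>x\<close> decreases to 0. So
\<open>\<integral> min 1 \<bar>x\<bar> \<nu>(dx)\<close> is finite and, up to a drift and a Gaussian factor, \<open>\<phi>\<close> is the exponential of
\<open>\<integral> (exp(iux) - 1) b(x) dx\<close>. This reduces everything to the locale \<open>jump_density\<close>.

The modulus of \<open>\<phi>\<close> sees the jumps only through \<open>b(x) + b(-x)\<close>, and \<open>\<integral>\<^sub>0\<^sup>r (1 - cos(ux)) / x dx\<close> is
\<open>ln(ur)\<close> up to a bounded error if \<open>ur \<ge> 1\<close>. Hence, for every \<open>\<epsilon> > 0\<close>, \<open>\<bar>\<phi>(u)\<bar>\<close> is at most of
order \<open>\<bar>u\<bar>\<close> to the power \<open>-\<alpha> + \<epsilon>\<close>. For \<open>n < \<alpha> - 1\<close> the function \<open>u\<^sup>n \<phi>(u)\<close> is integrable, and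
Fourier inversion gives a density of class \<open>C\<^sup>n\<close>. If \<open>\<alpha>\<close> is small, \<open>\<phi>\<close> need not be integrable, and the
density comes from another source: \<open>\<mu>\<close> has the compound Poisson law of the jumps larger than \<open>r\<close> as a
convolution factor. That law is absolutely continuous except for an atom of mass \<open>exp(-\<nu>{\<bar>x\<bar> > r})\<close> at 0,
and this mass vanishes as \<open>r\<close> decreases to 0 because \<open>\<alpha> > 0\<close>.

Conversely, let \<open>\<sigma>2 = 0\<close> and let the density be of class \<open>C\<^sup>n\<close> with \<open>\<alpha> < n + 1\<close>. The size of
\<open>\<phi>\<close> alone gives no contradiction, and its phase is governed by \<open>b(x) - b(-x)\<close>, which may oscillate
arbitrarily. The phase is removed by the choice of the test. Fix a small \<open>\<kappa> > 0\<close> and let \<open>\<rho>\<close> be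
\<open>h\<close> to the power \<open>1 - \<kappa>\<close>. Let \<open>X\<close> have law \<open>\<mu>\<close>, shifted by the drift, and let \<open>Z\<close> be independent of \<open>X\<close>,
with the law of the part of \<open>X\<close> formed by the jumps of size at most \<open>\<rho>\<close>. Let \<open>J\<close> be the expectation of
\<open>\<zeta>((X - Z) / h)\<close>, where \<open>\<zeta>\<close> is an \<open>(n + 1)\<close>-fold second difference of a Gaussian.

On the one hand, the differences can be moved from \<open>\<zeta>\<close> to the density of \<open>X\<close>, where they gain \<open>h\<^sup>n\<close>, and the
Gaussian at scale \<open>h\<close> gains another \<open>h\<close>. As \<open>Z\<close> leaves \<open>[-1/2, 1/2]\<close> with probability smaller than every
power of \<open>h\<close>, this gives \<open>\<bar>J\<bar> \<le> C h\<^sup>n\<^sup>+\<^sup>1\<close> (lemma \<open>versine_char_upper_bound\<close>).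

On the other hand, \<open>J\<close> is, up to normalisation, the integral over all \<open>v\<close> of
\<open>(2 - 2 cos v)\<^sup>n\<^sup>+\<^sup>1 exp(-v\<^sup>2/2) \<bar>\<phi>\<^sub>\<rho>(v/h)\<bar>\<^sup>2 exp(z(v/h) - \<lambda>)\<close>. Here \<open>\<phi>\<^sub>\<rho>\<close> is the characteristic
function of \<open>Z\<close>, and \<open>\<lambda>\<close> and \<open>z\<close> are the mass and the Fourier transform of the jumps larger than \<open>\<rho>\<close>.
The density of these jumps is at most of order \<open>1/\<rho>\<close> (a piece of small mass apart), so the mean square of
\<open>z(v/h)\<close> is of order \<open>h/\<rho>\<close> up to a logarithm, and \<open>exp z\<close> may be replaced by 1. What remains is positive, and is
at least \<open>h\<close> to the power \<open>(1 + \<kappa>)(\<alpha> + \<epsilon>)\<close> up to a constant (lemma \<open>versine_lower_bound\<close>). Since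
\<open>\<alpha> < n + 1\<close>, the two bounds contradict each other for small \<open>\<kappa>\<close>, \<open>\<epsilon>\<close> and \<open>h\<close> (lemma
\<open>C_class_density_order_le\<close>).\<close>

section \<open>Convolution powers and compound Poisson laws\<close>

lemma real_distribution_facts:
  assumes "real_distribution M"
  shows "prob_space M" "finite_measure M" "sets M = sets borel" "space M = UNIV"
    "subprob_space M"
  using assms
  by (auto simp: real_distribution_def real_distribution_axioms_def prob_space_imp_subprob_space
      prob_space.finite_measure real_distribution.space_eq_univ)

lemma real_distribution_convolution:
  assumes M: "real_distribution M" and N: "real_distribution N"
  shows "real_distribution (M \<star> N)"
proof -
  interpret M: real_distribution M by fact
  interpret N: real_distribution N by fact
  interpret P: pair_prob_space M N ..
  have "prob_space (M \<star> N)"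
    unfolding convolution_def by (rule P.prob_space_distr) simp
  then show ?thesis
    by (simp add: real_distribution_def real_distribution_axioms_def)
qed

lemma integral_convolution:
  fixes f :: "real \<Rightarrow> 'b::{banach, second_countable_topology}"
  assumes M: "real_distribution M" and N: "real_distribution N"
    and f: "f \<in> borel_measurable borel" and bdd: "\<And>x. norm (f x) \<le> B"
  shows "(\<integral>x. f x \<partial>(M \<star> N)) = (\<integral>x. (\<integral>y. f (x + y) \<partial>N) \<partial>M)"
proof -
  interpret M: real_distribution M by fact
  interpret N: real_distribution N by fact
  interpret P: pair_prob_space M N ..
  note f[measurable]
  have "integrable (M \<Otimes>\<^sub>M N) (\<lambda>p. f (fst p + snd p))"
    by (rule P.integrable_const_bound[where B=B]) (use bdd in auto)
  then have "(\<integral>x. (\<integral>y. f (x + y) \<partial>N) \<partial>M) = (\<integral>p. f (fst p + snd p) \<partial>(M \<Otimes>\<^sub>M N))"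
    using P.integral_fst'[of "\<lambda>p. f (fst p + snd p)"] by simp
  also have "\<dots> = (\<integral>x. f x \<partial>(M \<star> N))"
    unfolding convolution_def by (subst integral_distr) (auto simp: case_prod_unfold)
  finally show ?thesis by simp
qed

lemma char_convolution:
  assumes M: "real_distribution M" and N: "real_distribution N"
  shows "char (M \<star> N) t = char M t * char N t"
proof -
  have "char (M \<star> N) t = (\<integral>x. (\<integral>y. iexp (t * (x + y)) \<partial>N) \<partial>M)"
    unfolding char_def by (rule integral_convolution[OF M N, of _ 1]) auto
  also have "\<dots> = (\<integral>x. (\<integral>y. iexp (t * x) * iexp (t * y) \<partial>N) \<partial>M)"
    by (simp add: distrib_left exp_add)
  finally show ?thesis
    by (simp add: char_def)
qed

lemma real_distribution_conv_power:
  assumes M: "real_distribution M"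
  shows "real_distribution (conv_power n M)"
proof (induction n)
  case 0
  show ?case
    by (simp add: real_distribution_def real_distribution_axioms_def prob_space_return)
next
  case (Suc n)
  then show ?case using real_distribution_convolution[OF M] by simp
qed

lemma char_conv_power:
  assumes M: "real_distribution M"
  shows "char (conv_power n M) t = char M t ^ n"
proof (induction n)
  case 0
  show ?case by (simp add: char_def integral_return)
next
  case (Suc n)
  then show ?case by (simp add: char_convolution[OF M real_distribution_conv_power[OF M]])
qed

lemma nn_integral_exp_conv_power_le:
  assumes M: "real_distribution M" and s: "0 \<le> s"
  shows "(\<integral>\<^sup>+x. ennreal (exp (s * \<bar>x\<bar>)) \<partial>conv_power n M)
    \<le> (\<integral>\<^sup>+x. ennreal (exp (s * \<bar>x\<bar>)) \<partial>M) ^ n"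
proof (induction n)
  case 0
  show ?case by (simp add: nn_integral_return)
next
  case (Suc n)
  note D = real_distribution_facts[OF M] real_distribution_facts[OF real_distribution_conv_power[OF M, of n]]
  note [measurable_cong] = D(3) D(8)
  have "(\<integral>\<^sup>+x. ennreal (exp (s * \<bar>x\<bar>)) \<partial>conv_power (Suc n) M)
    = (\<integral>\<^sup>+x. \<integral>\<^sup>+y. ennreal (exp (s * \<bar>x + y\<bar>)) \<partial>conv_power n M \<partial>M)"
    by (simp, rule nn_integral_convolution) (use D in auto)
  also have "\<dots> \<le> (\<integral>\<^sup>+x. \<integral>\<^sup>+y. ennreal (exp (s * \<bar>x\<bar>)) * ennreal (exp (s * \<bar>y\<bar>)) \<partial>conv_power n M \<partial>M)"
  proof (intro nn_integral_mono)
    fix x y :: real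
    have "s * \<bar>x + y\<bar> \<le> s * \<bar>x\<bar> + s * \<bar>y\<bar>"
      using s mult_left_mono[OF abs_triangle_ineq[of x y] s] by (simp add: distrib_left)
    then show "ennreal (exp (s * \<bar>x + y\<bar>)) \<le> ennreal (exp (s * \<bar>x\<bar>)) * ennreal (exp (s * \<bar>y\<bar>))"
      by (simp add: ennreal_mult[symmetric] exp_add[symmetric])
  qed
  also have "\<dots> = (\<integral>\<^sup>+x. ennreal (exp (s * \<bar>x\<bar>)) \<partial>M) * (\<integral>\<^sup>+y. ennreal (exp (s * \<bar>y\<bar>)) \<partial>conv_power n M)"
    by (simp add: nn_integral_cmult nn_integral_multc)
  also have "\<dots> \<le> (\<integral>\<^sup>+x. ennreal (exp (s * \<bar>x\<bar>)) \<partial>M) ^ Suc n"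
    using Suc by (simp add: mult_left_mono)
  finally show ?case .
qed

lemma null_sets_lborel_translate:
  fixes A :: "real set"
  assumes "A \<in> null_sets lborel"
  shows "{a. a + x \<in> A} \<in> null_sets lborel"
proof -
  have A: "A \<in> sets borel" using assms by auto
  have "emeasure lborel A = emeasure (distr lborel borel (\<lambda>a. x + a)) A"
    by (simp add: lborel_distr_plus)
  also have "\<dots> = emeasure lborel {a. a + x \<in> A}"
    using A by (subst emeasure_distr) (auto intro!: arg_cong2[where f=emeasure] simp: add.commute)
  finally show ?thesis
    using assms A by (auto intro!: null_setsI)
qed

text \<open>By commutativity the last factor can be integrated first, and a translate of a null set is null.\<close>

lemma emeasure_conv_power_null:
  assumes M: "real_distribution M" and ac: "absolutely_continuous lborel M"
    and A: "A \<in> null_sets lborel"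
  shows "emeasure (conv_power (Suc n) M) A = 0"
proof -
  note D = real_distribution_facts[OF M] real_distribution_facts[OF real_distribution_conv_power[OF M, of n]]
  have "emeasure (conv_power (Suc n) M) A = emeasure (conv_power n M \<star> M) A"
    using D by (simp add: convolution_commutative)
  also have "\<dots> = (\<integral>\<^sup>+x. emeasure M {a. a + x \<in> A} \<partial>conv_power n M)"
    by (rule convolution_emeasure) (use A D in auto)
  also have "\<dots> = (\<integral>\<^sup>+x. 0 \<partial>conv_power n M)"
    using ac null_sets_lborel_translate[OF A]
    by (intro nn_integral_cong) (auto simp: absolutely_continuous_def null_sets_def)
  finally show ?thesis by simp
qed

lemma integral_poisson_power:
  fixes z :: complex
  assumes l: "0 < l"
  shows "(\<integral>n. z ^ n \<partial>measure_pmf (poisson_pmf l)) = exp (of_real l * (z - 1))"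
proof -
  let ?f = "\<lambda>n. pmf (poisson_pmf l) n *\<^sub>R z ^ n"
  have f: "?f n = of_real (exp (-l)) * ((of_real l * z) ^ n /\<^sub>R fact n)" for n
    using l by (simp add: scaleR_conv_of_real field_simps power_mult_distrib)
  have s: "?f sums (of_real (exp (-l)) * exp (of_real l * z))"
    unfolding f by (intro sums_mult exp_converges)
  have n: "summable (\<lambda>n. norm (?f n))"
  proof -
    have "norm (?f n) = exp (-l) * ((l * norm z) ^ n /\<^sub>R fact n)" for n
      using l by (simp add: norm_mult norm_power field_simps power_mult_distrib)
    then show ?thesis using summable_exp_generic[of "l * norm z"] by (simp add: summable_mult)
  qed
  have i: "integrable (count_space UNIV) ?f"
    using n by (simp add: integrable_count_space_nat_iff)
  have "(\<integral>n. z ^ n \<partial>measure_pmf (poisson_pmf l)) = (\<integral>n. ?f n \<partial>count_space UNIV)"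
    unfolding measure_pmf_eq_density by (subst integral_density) auto
  also have "\<dots> = of_real (exp (-l)) * exp (of_real l * z)"
    using sums_integral_count_space_nat[OF i] s sums_unique2 by blast
  also have "\<dots> = exp (of_real l * (z - 1))"
    by (simp add: exp_of_real[symmetric] exp_add[symmetric] algebra_simps)
  finally show ?thesis .
qed

lemma nn_integral_poisson_power:
  assumes l: "0 < l" and m: "0 \<le> m"
  shows "(\<integral>\<^sup>+n. ennreal m ^ n \<partial>measure_pmf (poisson_pmf l)) = ennreal (exp (l * (m - 1)))"
proof -
  have s: "(\<lambda>n. pmf (poisson_pmf l) n * m ^ n) sums (exp (-l) * exp (l * m))"
  proof -
    have "pmf (poisson_pmf l) n * m ^ n = exp (-l) * ((l * m) ^ n /\<^sub>R fact n)" for n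
      using l by (simp add: field_simps power_mult_distrib)
    then show ?thesis using sums_mult[OF exp_converges[of "l * m"]] by simp
  qed
  have "(\<integral>\<^sup>+n. ennreal m ^ n \<partial>measure_pmf (poisson_pmf l))
      = (\<integral>\<^sup>+n. ennreal (pmf (poisson_pmf l) n * m ^ n) \<partial>count_space UNIV)"
    unfolding measure_pmf_eq_density using m
    by (subst nn_integral_density) (auto simp: ennreal_mult ennreal_power)
  also have "\<dots> = (\<Sum>n. ennreal (pmf (poisson_pmf l) n * m ^ n))"
    by (rule nn_integral_count_space_nat)
  also have "\<dots> = ennreal (exp (-l) * exp (l * m))"
    using s m by (intro suminf_ennreal_eq) auto
  finally show ?thesis by (simp add: exp_add[symmetric] algebra_simps)
qed

text \<open>The exponent of the law of a sum of jumps with intensity \<open>c(x) dx\<close>, without compensation of the small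
  jumps; it presupposes that \<open>min 1 \<bar>x\<bar> * c x\<close> is integrable.\<close>

definition levy_exp :: "(real \<Rightarrow> real) \<Rightarrow> real \<Rightarrow> complex" where
  "levy_exp c u = (CLINT x|lborel. complex_of_real (c x) * (iexp (u * x) - 1))"

text \<open>The law is a Poisson mixture of the convolution powers of the normalised intensity. Only the power 0
  charges Lebesgue null sets, and the Poisson weight of 0 is \<open>exp(-\<integral>c)\<close>. The exponential moment is
  recorded because it bounds tails uniformly when the small jumps are added in the next lemma.\<close>

lemma compound_poisson_exists:
  fixes c :: "real \<Rightarrow> real"
  assumes c: "integrable lborel c" and nn: "\<And>x. 0 \<le> c x"
  obtains Q where "real_distribution Q"
    "\<And>u. char Q u = exp (levy_exp c u)"
    "\<And>A. A \<in> null_sets lborel \<Longrightarrow> emeasure Q A \<le> ennreal (exp (- (\<integral>x. c x \<partial>lborel)))"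
    "\<And>s. 0 \<le> s \<Longrightarrow> integrable lborel (\<lambda>x. (exp (s * \<bar>x\<bar>) - 1) * c x) \<Longrightarrow>
       (\<integral>\<^sup>+x. ennreal (exp (s * \<bar>x\<bar>)) \<partial>Q)
         \<le> ennreal (exp (\<integral>x. (exp (s * \<bar>x\<bar>) - 1) * c x \<partial>lborel))"
proof -
  define l where "l = (\<integral>x. c x \<partial>lborel)"
  have l0: "0 \<le> l" unfolding l_def using nn by simp
  have cm[measurable]: "c \<in> borel_measurable borel" using c by auto
  show thesis
  proof (cases "l = 0")
    case True
    then have AE: "AE x in lborel. c x = 0"
      using integral_nonneg_eq_0_iff_AE[OF c] nn unfolding l_def by auto
    have 1: "(CLINT x|lborel. complex_of_real (c x) * (iexp (u * x) - 1)) = 0" for u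
      by (rule integral_eq_zero_AE) (use AE in auto)
    have 2: "(\<integral>x. (exp (s * \<bar>x\<bar>) - 1) * c x \<partial>lborel) = 0" for s
      by (rule integral_eq_zero_AE) (use AE in eventually_elim, simp)
    show thesis
    proof (rule that[of "return borel 0"])
      show "real_distribution (return borel (0::real))"
        by (simp add: real_distribution_def real_distribution_axioms_def prob_space_return)
      show "char (return borel 0) u = exp (levy_exp c u)" for u
        unfolding levy_exp_def 1 by (simp add: char_def integral_return)
      show "emeasure (return borel 0) A \<le> ennreal (exp (- (\<integral>x. c x \<partial>lborel)))"
        if "A \<in> null_sets lborel" for A :: "real set"
        using True that by (auto simp: l_def indicator_def)
      show "(\<integral>\<^sup>+x. ennreal (exp (s * \<bar>x\<bar>)) \<partial>return borel 0)
         \<le> ennreal (exp (\<integral>x. (exp (s * \<bar>x\<bar>) - 1) * c x \<partial>lborel))" for s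
        unfolding 2 by (simp add: nn_integral_return)
    qed
  next
    case False
    with l0 have l: "0 < l" by simp
    define M where "M = density lborel (\<lambda>x. ennreal (c x / l))"
    have "(\<integral>\<^sup>+x. ennreal (c x / l) \<partial>lborel) = ennreal (\<integral>x. c x / l \<partial>lborel)"
      using c nn l by (intro nn_integral_eq_integral) auto
    also have "(\<integral>x. c x / l \<partial>lborel) = 1"
      using l by (simp add: l_def)
    finally have "prob_space M"
      unfolding M_def by (intro prob_spaceI) (simp add: emeasure_density)
    then have M: "real_distribution M"
      by (simp add: real_distribution_def real_distribution_axioms_def M_def)
    have ac: "absolutely_continuous lborel M"
      unfolding M_def by (intro absolutely_continuousI_density) simp
    let ?P = "measure_pmf (poisson_pmf l)" and ?K = "\<lambda>n. conv_power n M"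
    have K: "?K \<in> ?P \<rightarrow>\<^sub>M subprob_algebra borel"
      using real_distribution_facts(3,5)[OF real_distribution_conv_power[OF M]]
      by (simp add: measurable_pmf_measure1 space_subprob_algebra)
    define Q where "Q = ?P \<bind> ?K"
    have Qs: "sets Q = sets borel" unfolding Q_def
      by (rule sets_bind[where N=borel])
        (auto simp: real_distribution_facts[OF real_distribution_conv_power[OF M]])
    have Qp: "prob_space Q"
      unfolding Q_def
      by (rule measure_pmf.prob_space_bind[OF _ K])
        (auto simp: real_distribution_facts[OF real_distribution_conv_power[OF M]])
    have Q: "real_distribution Q"
      using Qs Qp by (simp add: real_distribution_def real_distribution_axioms_def)
    have intQ: "(\<integral>x. f x \<partial>Q) = (\<integral>n. (\<integral>x. f x \<partial>?K n) \<partial>?P)"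
      if "f \<in> borel_measurable borel" "\<And>x. norm (f x) \<le> 1" for f :: "real \<Rightarrow> real"
      unfolding Q_def
    proof (rule integral_bind[where K=borel and B=1 and B'=1])
      show "AE n in ?P. emeasure (?K n) (space (?K n)) \<le> ennreal 1"
        using prob_space.emeasure_space_1[OF real_distribution_facts(1)[OF real_distribution_conv_power[OF M]]]
        by simp
    qed (use that K in \<open>auto simp: measure_pmf.finite_measure\<close>)
    have nnQ: "(\<integral>\<^sup>+x. f x \<partial>Q) = (\<integral>\<^sup>+n. (\<integral>\<^sup>+x. f x \<partial>?K n) \<partial>?P)"
      if "f \<in> borel_measurable borel" for f
      unfolding Q_def by (rule nn_integral_bind[OF that K])
    have char_M: "char M u = (CLINT x|lborel. complex_of_real (c x) * iexp (u * x)) / of_real l" for u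
      unfolding char_def M_def using nn l
      by (subst integral_density) (auto simp: scaleR_conv_of_real)
    show thesis
    proof (rule that[OF Q])
      fix u :: real
      have int: "integrable lborel (\<lambda>x. complex_of_real (c x) * iexp (u * x))"
        by (rule Bochner_Integration.integrable_bound[OF c]) (auto simp: norm_mult)
      have ex: "integrable (conv_power n M) (\<lambda>x. iexp (u * x))" for n
      proof -
        interpret real_distribution "conv_power n M" by (rule real_distribution_conv_power[OF M])
        show ?thesis by (rule integrable_const_bound[where B=1]) auto
      qed
      have exP: "integrable ?P (\<lambda>n. char (?K n) u)"
        by (rule measure_pmf.integrable_const_bound[where B=1])
          (auto intro!: AE_pmfI real_distribution.cmod_char_le_1 real_distribution_conv_power[OF M])
      interpret Q: real_distribution Q by (rule Q)
      have exQ: "integrable Q (\<lambda>x. iexp (u * x))"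
        by (rule Q.integrable_const_bound[where B=1]) auto
      have "Re (char Q u) = (\<integral>x. Re (iexp (u * x)) \<partial>Q)"
        unfolding char_def by (rule integral_Re[symmetric, OF exQ])
      also have "\<dots> = (\<integral>n. (\<integral>x. Re (iexp (u * x)) \<partial>?K n) \<partial>?P)"
        by (rule intQ, measurable) (use abs_Re_le_cmod[of "iexp (u * _)"] in simp)
      also have "\<dots> = (\<integral>n. Re (char (?K n) u) \<partial>?P)"
        unfolding char_def by (intro Bochner_Integration.integral_cong refl integral_Re[OF ex])
      also have "\<dots> = Re (\<integral>n. char (?K n) u \<partial>?P)"
        by (rule integral_Re[OF exP])
      finally have re: "Re (char Q u) = Re (\<integral>n. char (?K n) u \<partial>?P)" .
      have "Im (char Q u) = (\<integral>x. Im (iexp (u * x)) \<partial>Q)"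
        unfolding char_def by (rule integral_Im[symmetric, OF exQ])
      also have "\<dots> = (\<integral>n. (\<integral>x. Im (iexp (u * x)) \<partial>?K n) \<partial>?P)"
        by (rule intQ, measurable) (use abs_Im_le_cmod[of "iexp (u * _)"] in simp)
      also have "\<dots> = (\<integral>n. Im (char (?K n) u) \<partial>?P)"
        unfolding char_def by (intro Bochner_Integration.integral_cong refl integral_Im[OF ex])
      also have "\<dots> = Im (\<integral>n. char (?K n) u \<partial>?P)"
        by (rule integral_Im[OF exP])
      finally have im: "Im (char Q u) = Im (\<integral>n. char (?K n) u \<partial>?P)" .
      have "char Q u = (\<integral>n. char M u ^ n \<partial>?P)"
        using re im by (simp add: complex_eq_iff char_conv_power[OF M])
      also have "\<dots> = exp (of_real l * (char M u - 1))"
        by (rule integral_poisson_power[OF l])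
      also have "of_real l * (char M u - 1)
          = (CLINT x|lborel. complex_of_real (c x) * iexp (u * x)) - (CLINT x|lborel. complex_of_real (c x))"
        using l unfolding char_M l_def by (simp add: right_diff_distrib)
      also have "\<dots> = (CLINT x|lborel. complex_of_real (c x) * (iexp (u * x) - 1))"
        using int c by (simp add: right_diff_distrib)
      finally show "char Q u = exp (levy_exp c u)" by (simp only: levy_exp_def)
    next
      fix A :: "real set" assume A: "A \<in> null_sets lborel"
      then have [measurable]: "A \<in> sets borel" by auto
      have "emeasure Q A = (\<integral>\<^sup>+x. indicator A x \<partial>Q)"
        using Qs by simp
      also have "\<dots> = (\<integral>\<^sup>+n. emeasure (?K n) A \<partial>?P)"
        by (subst nnQ) (auto simp: real_distribution_facts[OF real_distribution_conv_power[OF M]])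
      also have "\<dots> \<le> (\<integral>\<^sup>+n. indicator {0} n \<partial>?P)"
      proof (intro nn_integral_mono)
        fix n :: nat
        show "emeasure (?K n) A \<le> indicator {0} n"
          using emeasure_conv_power_null[OF M ac A]
          by (cases n) (auto simp: indicator_def)
      qed
      also have "\<dots> = ennreal (exp (- l))"
        using l by (simp add: emeasure_pmf_single)
      finally show "emeasure Q A \<le> ennreal (exp (- (\<integral>x. c x \<partial>lborel)))"
        by (simp add: l_def)
    next
      fix s :: real assume s: "0 \<le> s" and i: "integrable lborel (\<lambda>x. (exp (s * \<bar>x\<bar>) - 1) * c x)"
      define m where "m = (\<integral>x. exp (s * \<bar>x\<bar>) * c x \<partial>lborel) / l"
      have i2: "integrable lborel (\<lambda>x. exp (s * \<bar>x\<bar>) * c x)"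
        using Bochner_Integration.integrable_add[OF i c] by (simp add: algebra_simps)
      have m0: "0 \<le> m" unfolding m_def using nn l by (intro divide_nonneg_pos integral_nonneg_AE) auto
      have "(\<integral>\<^sup>+x. ennreal (exp (s * \<bar>x\<bar>)) \<partial>M) = (\<integral>\<^sup>+x. ennreal (exp (s * \<bar>x\<bar>) * c x / l) \<partial>lborel)"
        unfolding M_def using nn l
        by (subst nn_integral_density) (auto simp: ennreal_mult[symmetric] mult.commute)
      also have "\<dots> = ennreal m"
        unfolding m_def using i2 nn l by (subst nn_integral_eq_integral) auto
      finally have Mm: "(\<integral>\<^sup>+x. ennreal (exp (s * \<bar>x\<bar>)) \<partial>M) = ennreal m" .
      have "(\<integral>\<^sup>+x. ennreal (exp (s * \<bar>x\<bar>)) \<partial>Q)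
          = (\<integral>\<^sup>+n. (\<integral>\<^sup>+x. ennreal (exp (s * \<bar>x\<bar>)) \<partial>?K n) \<partial>?P)"
        by (rule nnQ) simp
      also have "\<dots> \<le> (\<integral>\<^sup>+n. ennreal m ^ n \<partial>?P)"
        using nn_integral_exp_conv_power_le[OF M s] unfolding Mm by (intro nn_integral_mono)
      also have "\<dots> = ennreal (exp (l * (m - 1)))"
        by (rule nn_integral_poisson_power[OF l m0])
      also have "l * (m - 1) = (\<integral>x. (exp (s * \<bar>x\<bar>) - 1) * c x \<partial>lborel)"
        using i2 c l by (simp add: m_def l_def right_diff_distrib left_diff_distrib)
      finally show "(\<integral>\<^sup>+x. ennreal (exp (s * \<bar>x\<bar>)) \<partial>Q)
         \<le> ennreal (exp (\<integral>x. (exp (s * \<bar>x\<bar>) - 1) * c x \<partial>lborel))" .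
    qed
  qed
qed

text \<open>The intensity may have infinite mass at 0. Cutting off the jumps below \<open>1/k\<close> leaves compound Poisson laws
  whose moment of \<open>exp(\<bar>x\<bar>/r)\<close> is bounded independently of \<open>k\<close>, because \<open>exp t - 1 \<le> 2t\<close> on \<open>[0, 1]\<close>. So
  they are tight, and a weak limit has the desired characteristic function and inherits the tail bound.\<close>

lemma small_jump_law_exists:
  fixes c :: "real \<Rightarrow> real"
  assumes cm[measurable]: "c \<in> borel_measurable borel" and nn: "\<And>x. 0 \<le> c x"
    and int: "integrable lborel (\<lambda>x. \<bar>x\<bar> * c x)"
    and r: "0 < r" and supp: "\<And>x. r < \<bar>x\<bar> \<Longrightarrow> c x = 0"
  obtains Q where "real_distribution Q"
    "\<And>u. char Q u = exp (levy_exp c u)"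
    "\<And>t. measure Q {x. t < \<bar>x\<bar>} \<le> exp (2 / r * (\<integral>x. \<bar>x\<bar> * c x \<partial>lborel) - t / r)"
proof -
  define D where "D = exp (2 / r * (\<integral>x. \<bar>x\<bar> * c x \<partial>lborel))"
  define ck where "ck k x = c x * indicator {x. 1 / real (Suc k) \<le> \<bar>x\<bar>} x" for k :: nat and x
  have ckm[measurable]: "ck k \<in> borel_measurable borel" for k unfolding ck_def by measurable
  have cknn: "0 \<le> ck k x" for k x using nn by (simp add: ck_def)
  have ckle: "ck k x \<le> real (Suc k) * (\<bar>x\<bar> * c x)" for k x
  proof (cases "1 / real (Suc k) \<le> \<bar>x\<bar>")
    case True
    then have "1 \<le> real (Suc k) * \<bar>x\<bar>" by (simp add: field_simps)
    from mult_right_mono[OF this nn[of x]] True show ?thesis by (simp add: ck_def mult.assoc)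
  qed (use nn in \<open>auto simp: ck_def\<close>)
  have ckint: "integrable lborel (ck k)" for k
    by (rule Bochner_Integration.integrable_bound[OF integrable_mult_right[OF int, of "real (Suc k)"]])
      (use ckle cknn in \<open>auto simp: abs_of_nonneg intro!: AE_I2 order_trans[OF ckle]\<close>)
  have expbd: "0 \<le> (exp (1 / r * \<bar>x\<bar>) - 1) * ck k x \<and>
      (exp (1 / r * \<bar>x\<bar>) - 1) * ck k x \<le> 2 / r * (\<bar>x\<bar> * c x)" for k x
  proof (cases "\<bar>x\<bar> \<le> r")
    case True
    define t where "t = \<bar>x\<bar> / r"
    have t: "0 \<le> t" "t \<le> 1" using True r by (auto simp: t_def)
    have "exp t \<le> 1 + t + t\<^sup>2" using exp_bound t by blast
    moreover have "t\<^sup>2 \<le> t" using t by (simp add: power2_eq_square mult_left_le)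
    ultimately have e: "exp t - 1 \<le> 2 * t" by linarith
    have "(exp t - 1) * ck k x \<le> 2 * t * c x"
      by (rule mult_mono[OF e]) (use t nn in \<open>auto simp: ck_def indicator_def\<close>)
    moreover have "0 \<le> (exp t - 1) * ck k x" using t cknn by simp
    ultimately show ?thesis by (simp add: t_def)
  next
    case False
    then show ?thesis using supp[of x] by (simp add: ck_def)
  qed
  have expint: "integrable lborel (\<lambda>x. (exp (1 / r * \<bar>x\<bar>) - 1) * ck k x)" for k
  proof (rule Bochner_Integration.integrable_bound[OF integrable_mult_right[OF int, of "2 / r"]])
    show "AE x in lborel. norm ((exp (1 / r * \<bar>x\<bar>) - 1) * ck k x) \<le> norm (2 / r * (\<bar>x\<bar> * c x))"
    proof (rule AE_I2)
      fix x
      show "norm ((exp (1 / r * \<bar>x\<bar>) - 1) * ck k x) \<le> norm (2 / r * (\<bar>x\<bar> * c x))"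
        using expbd[of x k] unfolding real_norm_def by linarith
    qed
  qed measurable
  have "\<exists>Q. real_distribution Q \<and>
      (\<forall>u. char Q u = exp (levy_exp (ck k) u)) \<and>
      (\<integral>\<^sup>+x. ennreal (exp (1 / r * \<bar>x\<bar>)) \<partial>Q) \<le> ennreal D" for k
  proof -
    have r1: "0 \<le> 1 / r" using r by simp
    obtain Q where Q: "real_distribution Q"
      "\<And>u. char Q u = exp (levy_exp (ck k) u)"
      "(\<integral>\<^sup>+x. ennreal (exp (1 / r * \<bar>x\<bar>)) \<partial>Q)
         \<le> ennreal (exp (\<integral>x. (exp (1 / r * \<bar>x\<bar>) - 1) * ck k x \<partial>lborel))"
    proof (rule compound_poisson_exists[OF ckint[of k] cknn])
      fix Q
      assume a: "real_distribution Q"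
        "\<And>u. char Q u = exp (levy_exp (ck k) u)"
        "\<And>s. 0 \<le> s \<Longrightarrow> integrable lborel (\<lambda>x. (exp (s * \<bar>x\<bar>) - 1) * ck k x) \<Longrightarrow>
          (\<integral>\<^sup>+x. ennreal (exp (s * \<bar>x\<bar>)) \<partial>Q)
         \<le> ennreal (exp (\<integral>x. (exp (s * \<bar>x\<bar>) - 1) * ck k x \<partial>lborel))"
      show thesis by (rule that[OF a(1,2) a(3)[OF r1 expint[of k]]])
    qed
    have "(\<integral>x. (exp (1 / r * \<bar>x\<bar>) - 1) * ck k x \<partial>lborel) \<le> (\<integral>x. 2 / r * (\<bar>x\<bar> * c x) \<partial>lborel)"
      by (rule integral_mono[OF expint integrable_mult_right[OF int]]) (use expbd in blast)
    then have "exp (\<integral>x. (exp (1 / r * \<bar>x\<bar>) - 1) * ck k x \<partial>lborel) \<le> D"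
      by (simp add: D_def)
    then show ?thesis using Q by (meson ennreal_leI order_trans)
  qed
  then obtain P where P: "\<And>k. real_distribution (P k)"
    "\<And>k u. char (P k) u = exp (levy_exp (ck k) u)"
    "\<And>k. (\<integral>\<^sup>+x. ennreal (exp (1 / r * \<bar>x\<bar>)) \<partial>P k) \<le> ennreal D"
    by metis
  define g where "g t x = min (exp (\<bar>x\<bar> / r)) (exp (t / r))" for t x
  have gm[measurable]: "g t \<in> borel_measurable borel" for t
    unfolding g_def by measurable
  have g_int: "integrable N (g t)" if "real_distribution N" for N t
  proof -
    interpret real_distribution N by fact
    show ?thesis by (rule integrable_const_bound[where B="exp (t / r)"]) (auto simp: g_def abs_of_nonneg)
  qed
  have g_le: "(\<integral>x. g t x \<partial>P k) \<le> D" for k t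
  proof -
    have "ennreal (\<integral>x. g t x \<partial>P k) = (\<integral>\<^sup>+x. ennreal (g t x) \<partial>P k)"
      by (rule nn_integral_eq_integral[symmetric, OF g_int[OF P(1)]]) (simp add: g_def)
    also have "\<dots> \<le> (\<integral>\<^sup>+x. ennreal (exp (1 / r * \<bar>x\<bar>)) \<partial>P k)"
      by (intro nn_integral_mono ennreal_leI) (simp add: g_def)
    also have "\<dots> \<le> ennreal D" by (rule P(3))
    finally show ?thesis by (simp add: D_def)
  qed
  have tail: "measure N {x. t < \<bar>x\<bar>} \<le> exp (2 / r * (\<integral>x. \<bar>x\<bar> * c x \<partial>lborel) - t / r)"
    if N: "real_distribution N" and le: "(\<integral>x. g t x \<partial>N) \<le> D" for N t
  proof -
    interpret real_distribution N by fact
    have "exp (t / r) * measure N {x. t < \<bar>x\<bar>} = (\<integral>x. exp (t / r) * indicator {x. t < \<bar>x\<bar>} x \<partial>N)"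
      by simp
    also have "\<dots> \<le> (\<integral>x. g t x \<partial>N)"
    proof (intro integral_mono g_int[OF N])
      show "integrable N (\<lambda>x. exp (t / r) * indicator {x. t < \<bar>x\<bar>} x)"
        by (rule integrable_const_bound[where B="exp (t / r)"]) (auto simp: indicator_def)
    qed (use r in \<open>auto simp: g_def indicator_def divide_right_mono\<close>)
    finally have "exp (t / r) * measure N {x. t < \<bar>x\<bar>} \<le> D" using le by simp
    then show ?thesis by (simp add: D_def exp_diff field_simps)
  qed
  have "tight P"
    unfolding tight_def
  proof (intro conjI allI impI P(1))
    fix e :: real assume e: "0 < e"
    \<comment> \<open>chosen such that the tail bound \<open>D * exp (- t / r)\<close> is at most \<open>e / 2\<close>\<close>
    define t where "t = r * max 1 (ln (2 * D / e))"
    have t: "0 < t" using r by (simp add: t_def)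
    have D0: "0 < D" by (simp add: D_def)
    have "ln (2 * D / e) \<le> t / r" using r by (simp add: t_def)
    then have "2 * D / e \<le> exp (t / r)" using e D0 by (metis divide_pos_pos exp_ln exp_le_cancel_iff mult_pos_pos zero_less_numeral)
    then have De: "D / exp (t / r) \<le> e / 2" using e by (simp add: field_simps)
    show "\<exists>a b. a < b \<and> (\<forall>n. 1 - e < measure (P n) {a<..b})"
    proof (rule exI[of _ "-2*t"], rule exI[of _ "2*t"], intro conjI allI)
      show "-2*t < 2*t" using t by simp
      fix n
      interpret real_distribution "P n" by (rule P(1))
      have "1 - measure (P n) {-2*t<..2*t} = measure (P n) (UNIV - {-2*t<..2*t})"
        by (subst prob_compl[symmetric]) auto
      also have "\<dots> \<le> measure (P n) {x. t < \<bar>x\<bar>}"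
        by (rule finite_measure_mono) (use t in auto)
      also have "\<dots> \<le> D / exp (t / r)"
        using tail[OF P(1) g_le] by (simp add: D_def exp_diff)
      finally show "1 - e < measure (P n) {-2*t<..2*t}" using De e by linarith
    qed
  qed
  from tight_imp_convergent_subsubsequence[OF this strict_mono_id]
  obtain q Q where q: "strict_mono q" and Q: "real_distribution Q" and "weak_conv_m (P \<circ> id \<circ> q) Q"
    by blast
  then have w: "weak_conv_m (P \<circ> q) Q" by simp
  show thesis
  proof (rule that[OF Q])
    fix u :: real
    have "(\<lambda>k. levy_exp (ck k) u) \<longlonglongrightarrow> levy_exp c u"
      unfolding levy_exp_def
    proof (rule integral_dominated_convergence[where w="\<lambda>x. \<bar>u\<bar> * (\<bar>x\<bar> * c x)"])
      show "AE x in lborel. (\<lambda>k. complex_of_real (ck k x) * (iexp (u * x) - 1))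
          \<longlonglongrightarrow> complex_of_real (c x) * (iexp (u * x) - 1)"
      proof (rule AE_I2)
        fix x :: real
        show "(\<lambda>k. complex_of_real (ck k x) * (iexp (u * x) - 1))
          \<longlonglongrightarrow> complex_of_real (c x) * (iexp (u * x) - 1)"
        proof (cases "x = 0")
          case False
          then have "eventually (\<lambda>k. 1 / real (Suc k) < \<bar>x\<bar>) sequentially"
            using order_tendstoD(2)[OF LIMSEQ_inverse_real_of_nat, of "\<bar>x\<bar>"]
            by (simp add: inverse_eq_divide)
          then have "eventually (\<lambda>k. complex_of_real (ck k x) * (iexp (u * x) - 1)
              = complex_of_real (c x) * (iexp (u * x) - 1)) sequentially"
            by eventually_elim (auto simp: ck_def)
          then show ?thesis by (rule tendsto_eventually)
        qed simp
      qed
      show "AE x in lborel. norm (complex_of_real (ck k x) * (iexp (u * x) - 1)) \<le> \<bar>u\<bar> * (\<bar>x\<bar> * c x)" for k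
      proof (rule AE_I2)
        fix x :: real
        have "norm (iexp (u * x) - 1) \<le> \<bar>u * x\<bar>" using iexp_approx1[of "u * x" 0] by simp
        moreover have "ck k x \<le> c x" using nn by (simp add: ck_def indicator_def)
        ultimately have "ck k x * norm (iexp (u * x) - 1) \<le> c x * \<bar>u * x\<bar>"
          using cknn nn by (intro mult_mono) auto
        then show "norm (complex_of_real (ck k x) * (iexp (u * x) - 1)) \<le> \<bar>u\<bar> * (\<bar>x\<bar> * c x)"
          using cknn by (simp add: norm_mult abs_mult mult_ac)
      qed
      show "integrable lborel (\<lambda>x. \<bar>u\<bar> * (\<bar>x\<bar> * c x))"
        by (rule integrable_mult_right[OF int])
    qed measurable
    from tendsto_exp[OF this]
    have "(\<lambda>k. char (P k) u) \<longlonglongrightarrow> exp (levy_exp c u)"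
      by (simp add: P(2))
    from LIMSEQ_subseq_LIMSEQ[OF this q]
    have "(\<lambda>k. char ((P \<circ> q) k) u) \<longlonglongrightarrow> exp (levy_exp c u)"
      by (simp add: o_def)
    moreover have "(\<lambda>k. char ((P \<circ> q) k) u) \<longlonglongrightarrow> char Q u"
      by (rule levy_continuity1[OF _ Q w]) (simp add: P(1))
    ultimately show "char Q u = exp (levy_exp c u)"
      by (rule LIMSEQ_unique[symmetric])
  next
    fix t :: real
    have "(\<lambda>k. \<integral>x. g t x \<partial>((P \<circ> q) k)) \<longlonglongrightarrow> (\<integral>x. g t x \<partial>Q)"
      by (rule weak_conv_imp_integral_bdd_continuous_conv[OF _ Q w, of _ "exp (t / r)"])
        (use r in \<open>auto simp: P(1) g_def abs_of_nonneg intro!: continuous_intros\<close>)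
    then have "(\<integral>x. g t x \<partial>Q) \<le> D"
      by (rule LIMSEQ_le_const2) (auto simp: g_le)
    then show "measure Q {x. t < \<bar>x\<bar>} \<le> exp (2 / r * (\<integral>x. \<bar>x\<bar> * c x \<partial>lborel) - t / r)"
      by (rule tail[OF Q])
  qed
qed

section \<open>Fourier inversion and smooth densities\<close>

lemma has_real_derivative_lebesgue_integral:
  fixes f f' :: "real \<Rightarrow> real \<Rightarrow> real" and w :: "real \<Rightarrow> real"
  assumes f: "\<And>x. integrable lborel (f x)"
    and d: "\<And>x u. ((\<lambda>x. f x u) has_real_derivative f' x u) (at x)"
    and m: "\<And>x. f' x \<in> borel_measurable borel"
    and b: "\<And>x u. \<bar>f' x u\<bar> \<le> w u" and w: "integrable lborel w"
  shows "((\<lambda>x. LINT u|lborel. f x u) has_real_derivative (LINT u|lborel. f' x u)) (at x)"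
  unfolding DERIV_def tendsto_at_iff_sequentially
proof (intro allI impI)
  fix X :: "nat \<Rightarrow> real"
  assume X0: "\<forall>i. X i \<in> UNIV - {0}" and X: "X \<longlonglongrightarrow> 0"
  have "(\<lambda>i. LINT u|lborel. (f (x + X i) u - f x u) / X i) \<longlonglongrightarrow> (LINT u|lborel. f' x u)"
  proof (rule integral_dominated_convergence[OF _ _ w])
    show "f' x \<in> borel_measurable lborel" using m by simp
    show "(\<lambda>u. (f (x + X i) u - f x u) / X i) \<in> borel_measurable lborel" for i
      using f by (auto intro!: borel_measurable_divide borel_measurable_diff
          dest: borel_measurable_integrable)
    show "AE u in lborel. (\<lambda>i. (f (x + X i) u - f x u) / X i) \<longlonglongrightarrow> f' x u"
    proof (rule AE_I2)
      fix u
      show "(\<lambda>i. (f (x + X i) u - f x u) / X i) \<longlonglongrightarrow> f' x u"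
        using d[of u x] X X0 unfolding DERIV_def tendsto_at_iff_sequentially by (auto simp: o_def)
    qed
    show "AE u in lborel. norm ((f (x + X i) u - f x u) / X i) \<le> w u" for i
    proof (rule AE_I2)
      fix u
      have "\<bar>f (x + X i) u - f x u\<bar> \<le> w u * \<bar>x + X i - x\<bar>"
        using field_differentiable_bound[of UNIV "\<lambda>x. f x u" "\<lambda>x. f' x u" "w u" "x + X i" x] d b
        by simp
      then show "norm ((f (x + X i) u - f x u) / X i) \<le> w u"
        using X0 by (simp add: divide_le_eq abs_divide)
    qed
  qed
  moreover have "(LINT u|lborel. (f (x + X i) u - f x u) / X i)
      = ((LINT u|lborel. f (x + X i) u) - (LINT u|lborel. f x u)) / X i" for i
    by (simp only: integral_divide_zero Bochner_Integration.integral_diff[OF f f])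
  ultimately show "((\<lambda>h. ((LINT u|lborel. f (x + h) u) - (LINT u|lborel. f x u)) / h) \<circ> X)
      \<longlonglongrightarrow> (LINT u|lborel. f' x u)"
    by (simp only: o_def)
qed

text \<open>The derivative of order \<open>i\<close> of the inverse Fourier transform of \<open>\<phi>\<close>, formed under the integral sign. The
  real part is taken because a density is real.\<close>

definition fourier_deriv :: "(real \<Rightarrow> complex) \<Rightarrow> nat \<Rightarrow> real \<Rightarrow> real" where
  "fourier_deriv \<phi> i x = (LINT u|lborel. Re ((- \<i> * of_real u) ^ i * iexp (- (u * x)) * \<phi> u)) / (2 * pi)"

lemma has_real_derivative_Re_iexp:
  "((\<lambda>x. Re (c * iexp (- (u * x)))) has_real_derivative Re (c * (- \<i> * of_real u) * iexp (- (u * x)))) (at x)"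
  by (auto intro!: derivative_eq_intros simp: Re_exp Im_exp algebra_simps)

lemma integrable_fourier_deriv_integrand:
  fixes \<phi> :: "real \<Rightarrow> complex"
  assumes [measurable]: "\<phi> \<in> borel_measurable borel"
    and i: "integrable lborel (\<lambda>u. \<bar>u\<bar> ^ i * norm (\<phi> u))"
  shows "integrable lborel (\<lambda>u. Re ((- \<i> * of_real u) ^ i * iexp (- (u * x)) * \<phi> u))"
proof (rule Bochner_Integration.integrable_bound[OF i])
  show "AE u in lborel. norm (Re ((- \<i> * of_real u) ^ i * iexp (- (u * x)) * \<phi> u))
      \<le> norm (\<bar>u\<bar> ^ i * norm (\<phi> u))"
  proof (rule AE_I2)
    fix u
    have "norm (Re ((- \<i> * of_real u) ^ i * iexp (- (u * x)) * \<phi> u))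
        \<le> norm ((- \<i> * of_real u) ^ i * iexp (- (u * x)) * \<phi> u)"
      unfolding real_norm_def by (rule abs_Re_le_cmod)
    also have "\<dots> = norm (\<bar>u\<bar> ^ i * norm (\<phi> u))"
      by (simp add: norm_mult norm_power)
    finally show "norm (Re ((- \<i> * of_real u) ^ i * iexp (- (u * x)) * \<phi> u))
        \<le> norm (\<bar>u\<bar> ^ i * norm (\<phi> u))" .
  qed
qed measurable

lemma has_real_derivative_fourier_deriv:
  assumes m[measurable]: "\<phi> \<in> borel_measurable borel"
    and i: "integrable lborel (\<lambda>u. \<bar>u\<bar> ^ i * norm (\<phi> u))"
    and Si: "integrable lborel (\<lambda>u. \<bar>u\<bar> ^ Suc i * norm (\<phi> u))"
  shows "(fourier_deriv \<phi> i has_real_derivative fourier_deriv \<phi> (Suc i) x) (at x)"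
proof -
  have "((\<lambda>x. LINT u|lborel. Re ((- \<i> * of_real u) ^ i * iexp (- (u * x)) * \<phi> u))
      has_real_derivative (LINT u|lborel. Re ((- \<i> * of_real u) ^ Suc i * iexp (- (u * x)) * \<phi> u))) (at x)"
  proof (rule has_real_derivative_lebesgue_integral[OF integrable_fourier_deriv_integrand[OF m i] _ _ _ Si])
    fix x u
    show "((\<lambda>x. Re ((- \<i> * of_real u) ^ i * iexp (- (u * x)) * \<phi> u))
       has_real_derivative Re ((- \<i> * of_real u) ^ Suc i * iexp (- (u * x)) * \<phi> u)) (at x)"
      using has_real_derivative_Re_iexp[of "(- \<i> * of_real u) ^ i * \<phi> u" u x]
      by (simp add: mult_ac)
    have "\<bar>Re ((- \<i> * of_real u) ^ Suc i * iexp (- (u * x)) * \<phi> u)\<bar>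
        \<le> norm ((- \<i> * of_real u) ^ Suc i * iexp (- (u * x)) * \<phi> u)"
      by (rule abs_Re_le_cmod)
    then show "\<bar>Re ((- \<i> * of_real u) ^ Suc i * iexp (- (u * x)) * \<phi> u)\<bar>
        \<le> \<bar>u\<bar> ^ Suc i * norm (\<phi> u)"
      by (simp add: norm_mult norm_power)
  qed measurable
  from DERIV_cdivide[OF this, of "2 * pi"]
  show ?thesis unfolding fourier_deriv_def[abs_def] .
qed

lemma continuous_fourier_deriv:
  assumes m[measurable]: "\<phi> \<in> borel_measurable borel"
    and i: "integrable lborel (\<lambda>u. \<bar>u\<bar> ^ i * norm (\<phi> u))"
  shows "continuous_on UNIV (fourier_deriv \<phi> i)"
proof -
  have "(\<lambda>k. fourier_deriv \<phi> i (X k)) \<longlonglongrightarrow> fourier_deriv \<phi> i x" if "X \<longlonglongrightarrow> x" for X x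
    unfolding fourier_deriv_def
  proof (intro tendsto_divide tendsto_const)
    show "(\<lambda>k. LINT u|lborel. Re ((- \<i> * of_real u) ^ i * iexp (- (u * X k)) * \<phi> u)) \<longlonglongrightarrow>
       (LINT u|lborel. Re ((- \<i> * of_real u) ^ i * iexp (- (u * x)) * \<phi> u))"
    proof (rule integral_dominated_convergence[OF _ _ i])
      show "AE u in lborel. (\<lambda>k. Re ((- \<i> * of_real u) ^ i * iexp (- (u * X k)) * \<phi> u))
         \<longlonglongrightarrow> Re ((- \<i> * of_real u) ^ i * iexp (- (u * x)) * \<phi> u)"
        by (intro AE_I2 tendsto_intros that)
      show "AE u in lborel. norm (Re ((- \<i> * of_real u) ^ i * iexp (- (u * X k)) * \<phi> u))
          \<le> \<bar>u\<bar> ^ i * norm (\<phi> u)" for k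
      proof (rule AE_I2)
        fix u
        have "norm (Re ((- \<i> * of_real u) ^ i * iexp (- (u * X k)) * \<phi> u))
            \<le> norm ((- \<i> * of_real u) ^ i * iexp (- (u * X k)) * \<phi> u)"
          unfolding real_norm_def by (rule abs_Re_le_cmod)
        then show "norm (Re ((- \<i> * of_real u) ^ i * iexp (- (u * X k)) * \<phi> u))
          \<le> \<bar>u\<bar> ^ i * norm (\<phi> u)"
          by (simp add: norm_mult norm_power)
      qed
    qed measurable
  qed simp
  then show ?thesis
    by (auto simp: continuous_on_sequentially o_def)
qed

lemma C_class_fourier_deriv:
  assumes m[measurable]: "\<phi> \<in> borel_measurable borel"
    and int: "\<And>i. i \<le> n \<Longrightarrow> integrable lborel (\<lambda>u. \<bar>u\<bar> ^ i * norm (\<phi> u))"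
  shows "C_class n (fourier_deriv \<phi> 0)"
proof -
  have d: "(fourier_deriv \<phi> i has_real_derivative fourier_deriv \<phi> (Suc i) x) (at x)" if "i < n" for i x
    by (rule has_real_derivative_fourier_deriv[OF m int int]) (use that in auto)
  have eq: "(deriv ^^ i) (fourier_deriv \<phi> 0) = fourier_deriv \<phi> i" if "i \<le> n" for i
    using that
  proof (induction i)
    case (Suc i)
    then show ?case using d[of i] by (auto simp: DERIV_imp_deriv)
  qed simp
  show ?thesis
    unfolding C_class_def
    using eq d continuous_fourier_deriv[OF m int[OF order_refl]]
    by (auto simp: real_differentiable_def) 
qed

text \<open>Levy's inversion formula expresses \<open>\<mu> {a<..b}\<close> as \<open>P b - P a\<close>, where \<open>P\<close> is a parameter integral whose
  derivative is the inverse Fourier transform. That derivative is non-negative since \<open>P\<close> is monotone, so it is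
  a density of \<open>\<mu>\<close>, and densities are unique almost everywhere.\<close>

lemma density_eq_fourier:
  assumes D: "lebesgue_density \<mu> f" and \<mu>: "real_distribution \<mu>"
    and int: "integrable lborel (\<lambda>u. norm (char \<mu> u))"
  shows "AE x in lborel. f x = fourier_deriv (char \<mu>) 0 x"
proof -
  interpret real_distribution \<mu> by (rule \<mu>)
  have [measurable]: "f \<in> borel_measurable borel" and fn: "AE x in lborel. 0 \<le> f x"
    and \<mu>f: "\<mu> = density lborel (\<lambda>x. ennreal (f x))"
    using D by (auto simp: lebesgue_density_def)
  note cm[measurable] = char_measurable
  have atom: "measure \<mu> {a} = 0" for a
  proof -
    have "absolutely_continuous lborel (density lborel (\<lambda>x. ennreal (f x)))"
      by (rule absolutely_continuousI_density) simp
    then have "null_sets lborel \<subseteq> null_sets \<mu>" unfolding absolutely_continuous_def \<mu>f[symmetric] .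
    moreover have "{a} \<in> null_sets lborel" by (simp add: null_sets_def)
    ultimately have "{a} \<in> null_sets \<mu>" by blast
    then show ?thesis by (simp add: measure_def null_sets_def)
  qed
  define g where "g = fourier_deriv (char \<mu>) 0"
  have gc: "continuous_on UNIV g"
    unfolding g_def by (rule continuous_fourier_deriv[OF cm]) (use int in simp)
  then have [measurable]: "g \<in> borel_measurable borel"
    by (rule borel_measurable_continuous_onI)
  define p where "p x u = Re ((1 - iexp (- (u * x))) / (\<i> * of_real u) * char \<mu> u)" for x u :: real
  have pm[measurable]: "p x \<in> borel_measurable borel" for x unfolding p_def[abs_def] by measurable
  have kern: "norm ((iexp (- (u * a)) - iexp (- (u * b))) / (\<i> * of_real u)) \<le> \<bar>b - a\<bar>" for a b u :: real
  proof (cases "u = 0")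
    case False
    have "iexp (- (u * a)) - iexp (- (u * b)) = iexp (- (u * a)) * (1 - iexp (u * (a - b)))"
      by (simp add: exp_add[symmetric] algebra_simps)
    moreover have "norm (1 - iexp (u * (a - b))) \<le> \<bar>u * (a - b)\<bar>"
      using iexp_approx1[of "u * (a - b)" 0] by (simp add: norm_minus_commute)
    ultimately show ?thesis using False
      by (simp add: norm_divide norm_mult abs_mult divide_le_eq abs_minus_commute mult.commute)
  qed simp
  have pint: "integrable lborel (p x)" for x
  proof (rule Bochner_Integration.integrable_bound[OF integrable_mult_right[OF int, of "\<bar>x\<bar>"]])
    show "AE u in lborel. norm (p x u) \<le> norm (\<bar>x\<bar> * norm (char \<mu> u))"
    proof (rule AE_I2)
      fix u
      have "norm (p x u) \<le> norm ((1 - iexp (- (u * x))) / (\<i> * of_real u) * char \<mu> u)"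
        unfolding p_def real_norm_def by (rule abs_Re_le_cmod)
      also have "\<dots> \<le> \<bar>x\<bar> * norm (char \<mu> u)"
        using kern[of u 0 x] by (simp only: norm_mult) (intro mult_right_mono, auto)
      finally show "norm (p x u) \<le> norm (\<bar>x\<bar> * norm (char \<mu> u))" by simp
    qed
  qed measurable
  define P where "P x = (LINT u|lborel. p x u) / (2 * pi)" for x
  have Pd: "(P has_real_derivative g x) (at x)" for x
  proof -
    \<comment> \<open>At \<open>u = 0\<close> the integrand is 0 by the convention on division, so its derivative is not the expected one there; a single point does not matter for the integral.\<close>
    let ?p' = "\<lambda>x u. if u = 0 then 0 else Re (iexp (- (u * x)) * char \<mu> u)"
    have "((\<lambda>x. LINT u|lborel. p x u) has_real_derivative (LINT u|lborel. ?p' x u)) (at x)"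
    proof (rule has_real_derivative_lebesgue_integral[OF pint _ _ _ int])
      fix x u
      show "((\<lambda>x. p x u) has_real_derivative ?p' x u) (at x)"
      proof (cases "u = 0")
        case False
        have e: "p x u = Re (char \<mu> u / (\<i> * of_real u))
            - Re (char \<mu> u / (\<i> * of_real u) * iexp (- (u * x)))" for x
        proof -
          have "(1 - iexp (- (u * x))) / (\<i> * of_real u) * char \<mu> u
              = char \<mu> u / (\<i> * of_real u) - char \<mu> u / (\<i> * of_real u) * iexp (- (u * x))"
            by (simp add: divide_inverse algebra_simps)
          then show ?thesis unfolding p_def by (simp only: minus_complex.simps)
        qed
        have "((\<lambda>x. p x u) has_real_derivative
            0 - Re (char \<mu> u / (\<i> * of_real u) * (- \<i> * of_real u) * iexp (- (u * x)))) (at x)"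
          unfolding e by (intro DERIV_diff DERIV_const has_real_derivative_Re_iexp)
        then show ?thesis using False by (simp add: mult.commute)
      qed (simp add: p_def)
      have "\<bar>Re (iexp (- (u * x)) * char \<mu> u)\<bar> \<le> norm (iexp (- (u * x)) * char \<mu> u)"
        by (rule abs_Re_le_cmod)
      then show "\<bar>?p' x u\<bar> \<le> norm (char \<mu> u)" by (simp add: norm_mult)
    qed measurable
    moreover have "(LINT u|lborel. ?p' x u) = (LINT u|lborel. Re (iexp (- (u * x)) * char \<mu> u))"
    proof (rule integral_cong_AE)
      show "AE u in lborel. ?p' x u = Re (iexp (- (u * x)) * char \<mu> u)"
        using AE_lborel_singleton[of 0] by eventually_elim simp
    qed measurable
    ultimately have "((\<lambda>x. LINT u|lborel. p x u) has_real_derivative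
        (LINT u|lborel. Re (iexp (- (u * x)) * char \<mu> u))) (at x)" by simp
    from DERIV_cdivide[OF this, of "2 * pi"]
    show ?thesis by (simp add: P_def[abs_def] g_def fourier_deriv_def)
  qed
  have inv: "measure \<mu> {a<..b} = P b - P a" if ab: "a \<le> b" for a b
  proof -
    let ?F = "\<lambda>t. (iexp (- (t * a)) - iexp (- (t * b))) / (\<i> * of_real t) * char \<mu> t"
    have bF: "norm (?F t) \<le> \<bar>b - a\<bar> * norm (char \<mu> t)" for t
      using kern[of t a b] by (simp only: norm_mult) (intro mult_right_mono, auto)
    have iF: "integrable lborel ?F"
      by (rule Bochner_Integration.integrable_bound[OF integrable_mult_right[OF int, of "\<bar>b - a\<bar>"]])
        (use bF in \<open>auto intro!: AE_I2\<close>)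
    have "(\<lambda>T. CLBINT t=-real T..real T. ?F t) \<longlonglongrightarrow> (CLINT t|lborel. ?F t)"
    proof -
      have "(CLBINT t=-real T..real T. ?F t) = (CLINT t|lborel. indicator {-real T<..<real T} t *\<^sub>R ?F t)" for T
        by (simp add: interval_lebesgue_integral_def set_lebesgue_integral_def)
      moreover have "(\<lambda>T. CLINT t|lborel. indicator {-real T<..<real T} t *\<^sub>R ?F t) \<longlonglongrightarrow> (CLINT t|lborel. ?F t)"
      proof (rule integral_dominated_convergence[OF _ _ integrable_norm[OF iF]])
        show "AE t in lborel. (\<lambda>T. indicator {-real T<..<real T} t *\<^sub>R ?F t) \<longlonglongrightarrow> ?F t"
        proof (rule AE_I2)
          fix t
          obtain N where N: "\<bar>t\<bar> < real N" using reals_Archimedean2 by blast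
          have "eventually (\<lambda>T. indicator {-real T<..<real T} t *\<^sub>R ?F t = ?F t) sequentially"
            using eventually_ge_at_top[of N] by eventually_elim (use N in \<open>auto simp: indicator_def\<close>)
          then show "(\<lambda>T. indicator {-real T<..<real T} t *\<^sub>R ?F t) \<longlonglongrightarrow> ?F t"
            by (rule tendsto_eventually)
        qed
      qed (auto simp: indicator_def)
      ultimately show ?thesis by simp
    qed
    from tendsto_mult_left[OF this, of "1 / (2 * complex_of_real pi)"]
      Levy_Inversion[OF ab atom atom]
    have "complex_of_real (measure \<mu> {a<..b}) = 1 / (2 * pi) * (CLINT t|lborel. ?F t)"
      using LIMSEQ_unique by (auto simp: mult.commute)
    then have "measure \<mu> {a<..b} = Re (complex_of_real (1 / (2 * pi)) * (CLINT t|lborel. ?F t))"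
      by (metis Re_complex_of_real of_real_1 of_real_divide of_real_mult of_real_numeral)
    also have "\<dots> = (LINT t|lborel. Re (?F t)) / (2 * pi)"
      unfolding integral_Re[OF iF] by (simp only: times_complex.simps Re_complex_of_real Im_complex_of_real) simp
    also have "(LINT t|lborel. Re (?F t)) = (LINT t|lborel. p b t - p a t)"
      by (rule Bochner_Integration.integral_cong[OF refl])
        (simp add: p_def left_diff_distrib diff_divide_distrib)
    also have "\<dots> / (2 * pi) = P b - P a"
      using pint by (simp add: P_def diff_divide_distrib)
    finally show ?thesis .
  qed
  have g0: "0 \<le> g x" for x
  proof (rule ccontr)
    assume "\<not> 0 \<le> g x"
    with DERIV_neg_dec_right[OF Pd, of x] obtain d where d: "0 < d" "\<And>h. 0 < h \<Longrightarrow> h < d \<Longrightarrow> P (x + h) < P x"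
      by force
    have "P (x + d / 2) < P x" using d by simp
    moreover have "0 \<le> P (x + d / 2) - P x"
      using inv[of x "x + d / 2"] d by (metis measure_nonneg less_add_same_cancel1 half_gt_zero less_imp_le)
    ultimately show False by simp
  qed
  let ?N = "density lborel (\<lambda>x. ennreal (g x))"
  have Nab: "emeasure ?N {a<..b} = emeasure \<mu> {a<..b}" if "a \<le> b" for a b
  proof -
    have "emeasure ?N {a<..b} = (\<integral>\<^sup>+x. ennreal (g x) * indicator {a..b} x \<partial>lborel)"
      using AE_lborel_singleton[of a]
      by (subst emeasure_density) (auto intro!: nn_integral_cong_AE simp: indicator_def elim!: eventually_mono)
    also have "\<dots> = ennreal (P b - P a)"
      by (rule nn_integral_FTC_Icc) (use that Pd g0 in \<open>auto intro: DERIV_subset\<close>)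
    finally show ?thesis by (simp add: inv[OF that, symmetric] emeasure_eq_measure)
  qed
  have "\<mu> = ?N"
  proof (rule measure_eqI_lessThan)
    fix x :: real
    have U: "{x<..} = (\<Union>n. {x<..x + real n})"
    proof (safe, goal_cases)
      case (1 y)
      obtain n where "y - x < real n" using reals_Archimedean2 by blast
      with 1 show ?case by (auto intro!: exI[of _ n])
    qed auto
    have inc: "incseq (\<lambda>n. {x<..x + real n})" by (auto simp: incseq_def)
    show "emeasure \<mu> {x<..} < \<infinity>" by (simp add: emeasure_eq_measure)
    show "emeasure \<mu> {x<..} = emeasure ?N {x<..}"
      unfolding U using inc
      by (subst (1 2) SUP_emeasure_incseq[symmetric]) (auto simp: Nab)
  qed auto
  then have "density lborel (\<lambda>x. ennreal (f x)) = density lborel (\<lambda>x. ennreal (g x))"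
    using \<mu>f by simp
  then have "AE x in lborel. ennreal (f x) = ennreal (g x)"
    by (subst (asm) sigma_finite_measure.density_unique_iff[OF lborel.sigma_finite_measure_axioms]) auto
  with fn show ?thesis
    by eventually_elim (use g0 in \<open>simp add: g_def[symmetric]\<close>)
qed

section \<open>The truncated cosine integral\<close>

text \<open>The entire cosine integral \<open>Cin\<close> at \<open>ur\<close>, kept in the two variables in which it arises.\<close>

definition cin :: "real \<Rightarrow> real \<Rightarrow> real" where
  "cin u r = (LINT x:{0<..r}|lborel. (1 - cos (u * x)) / x)"

lemma one_minus_cos_over_bounds:
  fixes u x :: real
  assumes "0 < x"
  shows "0 \<le> (1 - cos (u * x)) / x" "(1 - cos (u * x)) / x \<le> u\<^sup>2 * x / 2"
proof -
  show "0 \<le> (1 - cos (u * x)) / x" using assms by simp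
  have "1 - cos (u * x) = 2 * (sin (u * x / 2))\<^sup>2"
    using cos_double_sin[of "u * x / 2"] by simp
  also have "\<dots> \<le> 2 * (u * x / 2)\<^sup>2"
    using abs_sin_x_le_abs_x[of "u * x / 2"] by (simp only: abs_le_square_iff)
  also have "\<dots> = (u * x)\<^sup>2 / 2" by (simp add: power2_eq_square)
  finally have "1 - (u * x)\<^sup>2 / 2 \<le> cos (u * x)" by linarith
  then have "(1 - cos (u * x)) / x \<le> ((u * x)\<^sup>2 / 2) / x"
    using assms by (intro divide_right_mono) auto
  then show "(1 - cos (u * x)) / x \<le> u\<^sup>2 * x / 2"
    using assms by (simp add: power2_eq_square)
qed

lemma emeasure_Ioc_less_top: "emeasure lborel {a<..b::real} < \<top>"
  by (cases "a \<le> b") auto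

lemma integrable_one_minus_cos_over:
  "set_integrable lborel {0<..r} (\<lambda>x::real. (1 - cos (u * x)) / x)"
  unfolding set_integrable_def
proof (rule Bochner_Integration.integrable_bound)
  show "integrable lborel (\<lambda>x. indicator {0<..r} x *\<^sub>R (u\<^sup>2 * \<bar>r\<bar> / 2))"
    by (rule integrable_scaleR_left, rule integrable_real_indicator) (auto intro: emeasure_Ioc_less_top)
  show "AE x in lborel. norm (indicator {0<..r} x *\<^sub>R ((1 - cos (u * x)) / x))
      \<le> norm (indicator {0<..r} x *\<^sub>R (u\<^sup>2 * \<bar>r\<bar> / 2))"
  proof (rule AE_I2)
    fix x
    show "norm (indicator {0<..r} x *\<^sub>R ((1 - cos (u * x)) / x))
      \<le> norm (indicator {0<..r} x *\<^sub>R (u\<^sup>2 * \<bar>r\<bar> / 2))"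
    proof (cases "x \<in> {0<..r}")
      case True
      then have "u\<^sup>2 * x / 2 \<le> u\<^sup>2 * \<bar>r\<bar> / 2" by (intro divide_right_mono mult_left_mono) auto
      then show ?thesis using True one_minus_cos_over_bounds[of x u]
        by simp
    qed simp
  qed
qed measurable

lemma set_integral_Ioc_FTC:
  fixes F f :: "real \<Rightarrow> real"
  assumes "a \<le> b" "\<And>x. a \<le> x \<Longrightarrow> x \<le> b \<Longrightarrow> (F has_real_derivative f x) (at x)"
    "continuous_on {a..b} f"
  shows "set_integrable lborel {a<..b} f" "(LINT x:{a<..b}|lborel. f x) = F b - F a"
proof -
  have i: "set_integrable lborel {a..b} f"
    by (rule borel_integrable_atLeastAtMost') (rule assms(3))
  then show "set_integrable lborel {a<..b} f"
    by (rule set_integrable_subset) auto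
  have hb: "has_bochner_integral lborel (\<lambda>x. indicator {a..b} x *\<^sub>R f x) (F b - F a)"
    by (rule has_bochner_integral_FTC_Icc)
      (use assms in \<open>auto simp: has_real_derivative_iff_has_vector_derivative[symmetric] intro: DERIV_subset\<close>)
  have "(LINT x:{a<..b}|lborel. f x) = (LINT x:{a..b}|lborel. f x)"
    unfolding set_lebesgue_integral_def
  proof (rule integral_cong_AE)
    show "AE x in lborel. indicator {a<..b} x *\<^sub>R f x = indicator {a..b} x *\<^sub>R f x"
      using AE_lborel_singleton[of a] by eventually_elim (auto simp: indicator_def)
    show "(\<lambda>x. indicator {a..b} x *\<^sub>R f x) \<in> borel_measurable lborel"
      using hb by (rule borel_measurable_has_bochner_integral)
    show "(\<lambda>x. indicator {a<..b} x *\<^sub>R f x) \<in> borel_measurable lborel"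
      using \<open>set_integrable lborel {a<..b} f\<close> unfolding set_integrable_def
      by (rule borel_measurable_integrable)
  qed
  also have "\<dots> = F b - F a"
    unfolding set_lebesgue_integral_def using hb by (rule has_bochner_integral_integral_eq)
  finally show "(LINT x:{a<..b}|lborel. f x) = F b - F a" .
qed

text \<open>Below \<open>1/u\<close> the integrand is at most \<open>u\<^sup>2 x / 2\<close>. Beyond \<open>1/u\<close> it is compared with the derivatives of
  \<open>ln x - sin(ux)/(ux) \<plusminus> 1/(ux)\<close>, which bound it from both sides and are integrated exactly.\<close>

lemma cin_bounds:
  assumes u: "0 < u" and r: "0 < r"
  shows "max 0 (ln (u * r)) - 2 \<le> cin u r" "cin u r \<le> max 0 (ln (u * r)) + 4"
proof -
  let ?f = "\<lambda>x::real. (1 - cos (u * x)) / x"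
  note int = integrable_one_minus_cos_over
  have cin0: "0 \<le> cin u r'" for r'
    unfolding cin_def set_lebesgue_integral_def
    by (rule integral_nonneg_AE) (auto simp: indicator_def one_minus_cos_over_bounds intro!: AE_I2)
  have small: "cin u r' \<le> 1 / 2" if r': "0 < r'" "u * r' \<le> 1" for r'
  proof -
    have "cin u r' \<le> (LINT x:{0<..r'}|lborel. u\<^sup>2 * r' / 2)"
      unfolding cin_def
    proof (rule set_integral_mono[OF int])
      show "set_integrable lborel {0<..r'} (\<lambda>x. u\<^sup>2 * r' / 2)"
        unfolding set_integrable_def
        by (rule integrable_scaleR_left, rule integrable_real_indicator) (auto intro: emeasure_Ioc_less_top)
      fix x assume x: "x \<in> {0<..r'}"
      then have "u\<^sup>2 * x / 2 \<le> u\<^sup>2 * r' / 2" by (intro divide_right_mono mult_left_mono) auto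
      then show "?f x \<le> u\<^sup>2 * r' / 2" using one_minus_cos_over_bounds[of x u] x by simp
    qed
    also have "\<dots> = (u * r')\<^sup>2 / 2"
      using r' by (simp add: set_lebesgue_integral_def power2_eq_square)
    also have "\<dots> \<le> 1 / 2" using r' u by (simp add: power_le_one)
    finally show ?thesis .
  qed
  show "max 0 (ln (u * r)) - 2 \<le> cin u r" "cin u r \<le> max 0 (ln (u * r)) + 4"
  proof -
    consider "u * r \<le> 1" | "1 < u * r" by linarith
    then have "max 0 (ln (u * r)) - 2 \<le> cin u r \<and> cin u r \<le> max 0 (ln (u * r)) + 4"
    proof cases
      case 1
      then have "ln (u * r) \<le> 0" using u r by (simp add: ln_le_zero_iff)
      then show ?thesis using small[OF r 1] cin0[of r] by simp
    next
      case 2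
      define a where "a = 1 / u"
      have a: "0 < a" "a < r" "u * a = 1" using 2 u by (auto simp: a_def field_simps)
      have split: "cin u r = cin u a + (LINT x:{a<..r}|lborel. ?f x)"
      proof -
        have e: "{0<..r} = {0<..a} \<union> {a<..r}" using a by auto
        have "set_integrable lborel {a<..r} ?f"
          by (rule set_integrable_subset[OF int[of r u]]) (use e in auto)
        then show ?thesis unfolding cin_def e
          by (intro set_integral_Un int) auto
      qed
      have ca: "0 \<le> cin u a" "cin u a \<le> 1 / 2" using cin0 small[of a] a u by auto
      let ?F = "\<lambda>c x. ln x - sin (u * x) / (u * x) + c / (u * x)"
      let ?g = "\<lambda>c x. 1 / x - cos (u * x) / x + sin (u * x) / (u * x\<^sup>2) - c / (u * x\<^sup>2)"
      have dF: "(?F c has_real_derivative ?g c x) (at x)" if "a \<le> x" for x c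
      proof -
        have x: "0 < x" using that a by simp
        show ?thesis
          using x u
          by (auto intro!: derivative_eq_intros simp: field_simps power2_eq_square)
      qed
      have cg: "continuous_on {a..r} (?g c)" for c
        using a u by (intro continuous_intros) auto
      note G = set_integral_Ioc_FTC[of a r "?F c" "?g c" for c, OF less_imp_le[OF a(2)] dF cg]
      have intf: "set_integrable lborel {a<..r} ?f"
        by (rule set_integrable_subset[OF int[of r u]])
          (use a in auto)
      have s: "\<bar>sin (u * r) / (u * r)\<bar> \<le> 1" "0 \<le> 1 / (u * r)" "1 / (u * r) \<le> 1"
      proof -
        have "\<bar>sin (u * r)\<bar> \<le> 1" by simp
        then have "\<bar>sin (u * r)\<bar> \<le> u * r" using 2 by linarith
        then show "\<bar>sin (u * r) / (u * r)\<bar> \<le> 1" using 2 by (simp add: abs_divide divide_le_eq)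
      qed (use 2 in auto)
      have s1: "0 \<le> sin (1::real)" "sin (1::real) \<le> 1"
        using pi_gt3 by (auto intro!: sin_ge_zero)
      have ln: "ln r - ln a = ln (u * r)" using u r by (simp add: a_def ln_div ln_mult)
      define X where "X = sin (u * r) / (u * r)"
      define Y where "Y = 1 / (u * r)"
      have s': "\<bar>X\<bar> \<le> 1" "0 \<le> Y" "Y \<le> 1" using s by (simp_all only: X_def Y_def)
      have F: "?F c r - ?F c a = ln (u * r) - X + c * Y + sin 1 - c" for c
        using ln a(3) by (simp add: X_def Y_def)
      have "(LINT x:{a<..r}|lborel. ?f x) \<le> (LINT x:{a<..r}|lborel. ?g (-1) x)"
      proof (rule set_integral_mono[OF intf G(1)])
        fix x assume "x \<in> {a<..r}"
        then have x: "0 < u * x\<^sup>2" using a u by (auto intro!: mult_pos_pos)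
        have "- 1 \<le> sin (u * x)" by simp
        then have "- 1 / (u * x\<^sup>2) \<le> sin (u * x) / (u * x\<^sup>2)" using x by (intro divide_right_mono) auto
        then show "?f x \<le> ?g (-1) x" by (simp add: diff_divide_distrib)
      qed auto
      also have "\<dots> = ?F (-1) r - ?F (-1) a" by (rule G(2)) auto
      also have "\<dots> \<le> ln (u * r) + 3" unfolding F using s' s1 by linarith
      finally have up: "(LINT x:{a<..r}|lborel. ?f x) \<le> ln (u * r) + 3" .
      have "ln (u * r) - 2 \<le> ?F 1 r - ?F 1 a" unfolding F using s' s1 by linarith
      also have "\<dots> = (LINT x:{a<..r}|lborel. ?g 1 x)" by (rule G(2)[symmetric]) auto
      also have "\<dots> \<le> (LINT x:{a<..r}|lborel. ?f x)"
      proof (rule set_integral_mono[OF G(1) intf])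
        fix x assume "x \<in> {a<..r}"
        then have x: "0 < u * x\<^sup>2" using a u by (auto intro!: mult_pos_pos)
        have "sin (u * x) \<le> 1" by simp
        then have "sin (u * x) / (u * x\<^sup>2) \<le> 1 / (u * x\<^sup>2)" using x by (intro divide_right_mono) auto
        then show "?g 1 x \<le> ?f x" by (simp add: diff_divide_distrib)
      qed auto
      finally have lo: "ln (u * r) - 2 \<le> (LINT x:{a<..r}|lborel. ?f x)" .
      have "0 < ln (u * r)" using 2 by simp
      then show ?thesis using up lo ca split by simp
    qed
    then show "max 0 (ln (u * r)) - 2 \<le> cin u r" "cin u r \<le> max 0 (ln (u * r)) + 4" by auto
  qed
qed

lemma set_integral_inverse_Ioc:
  assumes "0 < a" "a \<le> b"
  shows "set_integrable lborel {a<..b} (\<lambda>x::real. 1 / x)"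
    "(LINT x:{a<..b}|lborel. 1 / x) = ln (b / a)"
proof -
  have d: "(ln has_real_derivative 1 / x) (at x)" if "a \<le> x" for x
    using that assms by (auto intro!: derivative_eq_intros)
  have c: "continuous_on {a..b} (\<lambda>x. 1 / x)" using assms by (auto intro!: continuous_intros)
  note F = set_integral_Ioc_FTC[OF assms(2) d c]
  show "set_integrable lborel {a<..b} (\<lambda>x::real. 1 / x)" by (rule F(1))
  have "(LINT x:{a<..b}|lborel. 1 / x) = ln b - ln a" by (rule F(2))
  then show "(LINT x:{a<..b}|lborel. 1 / x) = ln (b / a)" using assms by (simp add: ln_div)
qed

lemma set_integral_cos_over_le:
  assumes u: "0 < u" and a: "0 < a" "a \<le> b"
  shows "set_integrable lborel {a<..b} (\<lambda>x::real. cos (u * x) / x)"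
    "(LINT x:{a<..b}|lborel. cos (u * x) / x) \<le> max 0 (- ln (u * a)) + 6"
proof -
  note i1 = set_integral_inverse_Ioc[OF a]
  have i2: "set_integrable lborel {a<..b} (\<lambda>x. (1 - cos (u * x)) / x)"
    by (rule set_integrable_subset[OF integrable_one_minus_cos_over[of b u]]) (use a in auto)
  have e: "cos (u * x) / x = 1 / x - (1 - cos (u * x)) / x" for x :: real
    by (simp add: diff_divide_distrib)
  show "set_integrable lborel {a<..b} (\<lambda>x::real. cos (u * x) / x)"
    unfolding e by (rule set_integral_diff(1)[OF i1(1) i2])
  have split: "cin u b = cin u a + (LINT x:{a<..b}|lborel. (1 - cos (u * x)) / x)"
  proof -
    have e: "{0<..b} = {0<..a} \<union> {a<..b}" using a by auto
    show ?thesis unfolding cin_def e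
      by (intro set_integral_Un integrable_one_minus_cos_over i2) auto
  qed
  have "(LINT x:{a<..b}|lborel. cos (u * x) / x) = ln (b / a) - (cin u b - cin u a)"
    unfolding e using set_integral_diff(2)[OF i1(1) i2] i1(2) split by simp
  also have "ln (b / a) = ln (u * b) - ln (u * a)"
    using a u by (simp add: ln_div ln_mult)
  finally show "(LINT x:{a<..b}|lborel. cos (u * x) / x) \<le> max 0 (- ln (u * a)) + 6"
    using cin_bounds[OF u, of b] cin_bounds[OF u, of a] a by linarith
qed

section \<open>Testing a density with differenced Gaussians\<close>

text \<open>The negative of the symmetric second difference; on \<open>exp(ivx)\<close> it acts as multiplication by
  \<open>2 - 2 cos(vh) \<ge> 0\<close>, which is why it is preferred to a first-order difference.\<close>

definition sdiff :: "real \<Rightarrow> (real \<Rightarrow> real) \<Rightarrow> real \<Rightarrow> real" where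
  "sdiff h g x = 2 * g x - g (x + h) - g (x - h)"

text \<open>The normalising factor makes this the unnormalised Fourier transform of
  \<open>exp(-v\<^sup>2/2) (2 - 2 cos v)\<^sup>M\<close>.\<close>

definition gauss_sdiff :: "nat \<Rightarrow> real \<Rightarrow> real" where
  "gauss_sdiff M = (sdiff 1 ^^ M) (\<lambda>y. sqrt (2 * pi) * exp (- y\<^sup>2 / 2))"

lemma gauss_sdiff_0: "gauss_sdiff 0 y = sqrt (2 * pi) * exp (- y\<^sup>2 / 2)"
  by (simp add: gauss_sdiff_def)

lemma gauss_sdiff_Suc:
  "gauss_sdiff (Suc M) y = 2 * gauss_sdiff M y - gauss_sdiff M (y + 1) - gauss_sdiff M (y - 1)"
  by (simp add: gauss_sdiff_def sdiff_def)

lemma measurable_gauss_sdiff[measurable]: "gauss_sdiff M \<in> borel_measurable borel"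
proof (induction M)
  case 0
  then show ?case unfolding gauss_sdiff_0[abs_def] by measurable
next
  case (Suc M)
  note Suc[measurable]
  show ?case unfolding gauss_sdiff_Suc[abs_def] by measurable
qed

lemma abs_gauss_sdiff_le: "\<bar>gauss_sdiff M y\<bar> \<le> 4 ^ M * sqrt (2 * pi)"
proof (induction M arbitrary: y)
  case 0
  then show ?case by (simp add: gauss_sdiff_0 abs_mult)
next
  case (Suc M)
  show ?case using Suc[of y] Suc[of "y + 1"] Suc[of "y - 1"]
    unfolding gauss_sdiff_Suc by simp
qed

lemma integrable_gaussian: "integrable lborel (\<lambda>v::real. exp (- v\<^sup>2 / 2))"
  and integral_gaussian: "(LINT v|lborel. exp (- v\<^sup>2 / 2)) = sqrt (2 * pi)"
proof -
  have e: "exp (- v\<^sup>2 / 2) = sqrt (2 * pi) * std_normal_density v" for v :: real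
    by (simp add: std_normal_density_def)
  have "integrable lborel (\<lambda>v. sqrt (2 * pi) * std_normal_density v)"
    by (intro integrable_mult_right integrable_normal_density) simp
  then show "integrable lborel (\<lambda>v::real. exp (- v\<^sup>2 / 2))"
    unfolding e .
  have "(LINT v|lborel. sqrt (2 * pi) * std_normal_density v) = sqrt (2 * pi) * 1"
    by (simp only: integral_mult_right_zero integral_normal_density zero_less_one)
  then show "(LINT v|lborel. exp (- v\<^sup>2 / 2)) = sqrt (2 * pi)"
    unfolding e by simp
qed

lemma integrable_times_gaussian:
  fixes c :: "real \<Rightarrow> complex"
  assumes [measurable]: "c \<in> borel_measurable borel" and b: "\<And>v. norm (c v) \<le> B"
  shows "integrable lborel (\<lambda>v. of_real (exp (- v\<^sup>2 / 2)) * c v)"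
proof (rule Bochner_Integration.integrable_bound[OF integrable_mult_right[OF integrable_gaussian, of B]])
  show "AE v in lborel. norm (of_real (exp (- v\<^sup>2 / 2)) * c v) \<le> norm (B * exp (- v\<^sup>2 / 2))"
  proof (rule AE_I2)
    fix v
    have "0 \<le> B" using b[of 0] norm_ge_zero order_trans by blast
    then show "norm (of_real (exp (- v\<^sup>2 / 2)) * c v) \<le> norm (B * exp (- v\<^sup>2 / 2))"
      using b[of v] by (simp add: norm_mult mult.commute)
  qed
qed measurable

lemma norm_versine_power_le: "norm (complex_of_real ((2 - 2 * cos v) ^ M)) \<le> 4 ^ M"
proof -
  have "\<bar>2 - 2 * cos v\<bar> \<le> 4" using cos_le_one[of v] cos_ge_minus_one[of v] by linarith
  then have "\<bar>2 - 2 * cos v\<bar> ^ M \<le> 4 ^ M" by (intro power_mono) auto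
  then show ?thesis by (simp only: norm_of_real power_abs)
qed

text \<open>The test in frequency space, with the non-negative weight on which the second differences of a Gaussian act;
  \<open>2 - 2 * cos v\<close> is twice the versed sine.\<close>

abbreviation versine_integral :: "nat \<Rightarrow> (real \<Rightarrow> complex) \<Rightarrow> complex" where
  "versine_integral M f \<equiv> (CLINT v|lborel. of_real (exp (- v\<^sup>2 / 2)) * (of_real ((2 - 2 * cos v) ^ M) * f v))"

lemma fourier_gauss_sdiff:
  "(versine_integral M (\<lambda>v. iexp (v * y)))
    = of_real (gauss_sdiff M y)"
proof (induction M arbitrary: y)
  case 0
  have "char std_normal_distribution y
      = (CLINT v|lborel. std_normal_density v *\<^sub>R iexp (y * v))"
    unfolding char_def by (subst integral_density) (auto simp: normal_density_nonneg)
  also have "\<dots> = (CLINT v|lborel. of_real (1 / sqrt (2 * pi)) * (of_real (exp (- v\<^sup>2 / 2)) * iexp (v * y)))"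
    by (intro Bochner_Integration.integral_cong refl)
      (simp add: std_normal_density_def scaleR_conv_of_real mult.commute)
  also have "\<dots> = of_real (1 / sqrt (2 * pi)) * (CLINT v|lborel. of_real (exp (- v\<^sup>2 / 2)) * iexp (v * y))"
    by simp
  finally have "of_real (exp (- (y^2) / 2)) * complex_of_real (sqrt (2 * pi))
      = (CLINT v|lborel. of_real (exp (- v\<^sup>2 / 2)) * iexp (v * y))"
    by (simp add: char_std_normal_distribution)
  then show ?case by (simp add: gauss_sdiff_0 mult.commute)
next
  case (Suc M)
  let ?c = "\<lambda>y v. of_real (exp (- v\<^sup>2 / 2)) * (of_real ((2 - 2 * cos v) ^ M) * iexp (v * y))"
  have i: "integrable lborel (?c y)" for y
    by (rule integrable_times_gaussian[of _ "4 ^ M"]) (use norm_versine_power_le in \<open>auto simp: norm_mult\<close>)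
  have "of_real (exp (- v\<^sup>2 / 2)) * (of_real ((2 - 2 * cos v) ^ Suc M) * iexp (v * y))
      = 2 * ?c y v - ?c (y + 1) v - ?c (y - 1) v" for v
  proof -
    have "iexp (v * (y + 1)) + iexp (v * (y - 1)) = iexp (v * y) * (iexp v + iexp (- v))"
      by (simp add: distrib_left right_diff_distrib exp_add[symmetric])
    also have "iexp v + iexp (- v) = of_real (2 * cos v)"
      by (simp add: complex_eq_iff Re_exp Im_exp)
    finally have *: "iexp (v * (y + 1)) + iexp (v * (y - 1)) = iexp (v * y) * of_real (2 * cos v)" .
    have "2 * ?c y v - ?c (y + 1) v - ?c (y - 1) v
        = of_real (exp (- v\<^sup>2 / 2)) * of_real ((2 - 2 * cos v) ^ M)
          * (2 * iexp (v * y) - (iexp (v * (y + 1)) + iexp (v * (y - 1))))"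
      by (simp only: algebra_simps)
    also have "\<dots> = of_real (exp (- v\<^sup>2 / 2)) * of_real ((2 - 2 * cos v) ^ M)
          * ((2 - of_real (2 * cos v)) * iexp (v * y))"
      unfolding * by (simp only: algebra_simps)
    finally show ?thesis by (simp add: mult_ac)
  qed
  then have "(versine_integral (Suc M) (\<lambda>v. iexp (v * y)))
      = (CLINT v|lborel. 2 * ?c y v - ?c (y + 1) v - ?c (y - 1) v)"
    by (intro Bochner_Integration.integral_cong refl)
  also have "\<dots> = 2 * (CLINT v|lborel. ?c y v) - (CLINT v|lborel. ?c (y + 1) v) - (CLINT v|lborel. ?c (y - 1) v)"
    by (simp only: Bochner_Integration.integral_diff integrable_mult_right
        Bochner_Integration.integrable_diff i integral_mult_right_zero)
  also have "\<dots> = of_real (gauss_sdiff (Suc M) y)"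
    unfolding Suc by (simp add: gauss_sdiff_Suc)
  finally show ?case .
qed

text \<open>Fubini and the previous lemma: testing a law with a differenced Gaussian at scale \<open>1/s\<close> is the same as
  integrating its characteristic function against a non-negative weight.\<close>

lemma integral_versine_char:
  assumes R: "real_distribution R"
  shows "(versine_integral M (\<lambda>v. char R (v * s)))
    = of_real (\<integral>y. gauss_sdiff M (s * y) \<partial>R)"
proof -
  interpret R: real_distribution R by (rule R)
  interpret P: pair_sigma_finite lborel R ..
  let ?w = "\<lambda>v. of_real (exp (- v\<^sup>2 / 2)) * complex_of_real ((2 - 2 * cos v) ^ M)"
  have wi: "integrable lborel ?w"
    by (rule integrable_times_gaussian[OF _ norm_versine_power_le]) measurable
  have "integrable (lborel \<Otimes>\<^sub>M R) (\<lambda>(v, y). ?w v * iexp (v * s * y))"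
  proof (rule P.Fubini_integrable)
    show "integrable lborel (\<lambda>v. \<integral>y. norm (case (v, y) of (v, y) \<Rightarrow> ?w v * iexp (v * s * y)) \<partial>R)"
      using integrable_norm[OF wi] by (simp add: norm_mult R.prob_space del: R.space_eq_univ)
    show "AE v in lborel. integrable R (\<lambda>y. case (v, y) of (v, y) \<Rightarrow> ?w v * iexp (v * s * y))"
      by (intro AE_I2 R.integrable_const_bound[where B="norm (?w _)"]) (auto simp: norm_mult)
  qed measurable
  from P.Fubini_integral[OF this]
  have "(\<integral>y. (CLINT v|lborel. ?w v * iexp (v * s * y)) \<partial>R) = (CLINT v|lborel. \<integral>y. ?w v * iexp (v * s * y) \<partial>R)"
    by simp
  also have "(CLINT v|lborel. \<integral>y. ?w v * iexp (v * s * y) \<partial>R)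
      = (CLINT v|lborel. ?w v * char R (v * s))"
    by (simp add: char_def)
  also have "(\<integral>y. (CLINT v|lborel. ?w v * iexp (v * s * y)) \<partial>R) = (\<integral>y. of_real (gauss_sdiff M (s * y)) \<partial>R)"
    using fourier_gauss_sdiff[of M "s * _"] by (simp add: mult.assoc)
  finally show ?thesis
    by (simp add: mult.assoc integral_complex_of_real)
qed

lemma has_real_derivative_sdiff_power:
  assumes "\<And>x. (g has_real_derivative g' x) (at x)"
  shows "((sdiff h ^^ M) g has_real_derivative (sdiff h ^^ M) g' x) (at x)"
proof (induction M arbitrary: x)
  case (Suc M)
  have "((\<lambda>x. 2 * (sdiff h ^^ M) g x - (sdiff h ^^ M) g (x + h) - (sdiff h ^^ M) g (x - h))
    has_real_derivative (2 * (sdiff h ^^ M) g' x - (sdiff h ^^ M) g' (x + h) * (1 + 0)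
      - (sdiff h ^^ M) g' (x - h) * (1 - 0))) (at x)"
    by (intro DERIV_diff DERIV_cmult DERIV_chain2[where f="(sdiff h ^^ M) g"] Suc DERIV_add DERIV_ident DERIV_const)
  then show ?case by (simp add: sdiff_def[abs_def])
qed (use assms in simp)

lemma C_class_SucD:
  assumes "C_class (Suc n) g"
  shows "(g has_real_derivative deriv g x) (at x)" "C_class n (deriv g)"
proof -
  have "(deriv ^^ 0) g differentiable (at x)"
    using assms unfolding C_class_def by blast
  then show "(g has_real_derivative deriv g x) (at x)"
    using DERIV_deriv_iff_real_differentiable by auto
  have "(deriv ^^ i) (deriv g) = (deriv ^^ Suc i) g" for i
    by (simp add: funpow_swap1)
  then show "C_class n (deriv g)"
    using assms unfolding C_class_def by auto
qed

text \<open>Each second difference is a sum of two first differences, and the mean value theorem turns each of these into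
  \<open>h\<close> times a value of the differenced derivative. So every step uses up one derivative only.\<close>

lemma abs_sdiff_power_le:
  assumes "C_class n g" and h: "0 < h"
    and "\<And>y. \<bar>y - c\<bar> \<le> R \<Longrightarrow> \<bar>(deriv ^^ n) g y\<bar> \<le> B"
    and "\<bar>x - c\<bar> + real n * h \<le> R"
  shows "\<bar>(sdiff h ^^ n) g x\<bar> \<le> (2 * h) ^ n * B"
  using assms(1,3,4)
proof (induction n arbitrary: g x)
  case (Suc n)
  note C = C_class_SucD[OF Suc.prems(1)]
  have IH: "\<bar>(sdiff h ^^ n) (deriv g) y\<bar> \<le> (2 * h) ^ n * B" if y: "\<bar>y - x\<bar> \<le> h" for y
  proof (rule Suc.IH[OF C(2)])
    show "\<bar>(deriv ^^ n) (deriv g) y\<bar> \<le> B" if "\<bar>y - c\<bar> \<le> R" for y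
      using Suc.prems(2)[OF that] by (simp add: funpow_swap1)
    show "\<bar>y - c\<bar> + real n * h \<le> R"
      using Suc.prems(3) y by (simp add: algebra_simps)
  qed
  have d: "((sdiff h ^^ n) g has_real_derivative (sdiff h ^^ n) (deriv g) y) (at y)" for y
    by (rule has_real_derivative_sdiff_power[OF C(1)])
  have D: "\<bar>(sdiff h ^^ n) g x - (sdiff h ^^ n) g y\<bar> \<le> (2 * h) ^ n * B * h" if y: "\<bar>y - x\<bar> \<le> h" for y
  proof -
    have "\<bar>(sdiff h ^^ n) g x - (sdiff h ^^ n) g y\<bar> \<le> (2 * h) ^ n * B * \<bar>x - y\<bar>"
      using field_differentiable_bound[of "{x - h..x + h}" "(sdiff h ^^ n) g" "(sdiff h ^^ n) (deriv g)"
          "(2 * h) ^ n * B" x y] IH y h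
      by (auto intro: has_field_derivative_at_within d simp: abs_le_iff)
    also have "\<dots> \<le> (2 * h) ^ n * B * h"
    proof (rule mult_left_mono)
      show "0 \<le> (2 * h) ^ n * B" using IH[of x] h by (auto intro: order_trans[OF abs_ge_zero])
    qed (use y in \<open>simp add: abs_minus_commute\<close>)
    finally show ?thesis .
  qed
  have e: "(sdiff h ^^ Suc n) g x = ((sdiff h ^^ n) g x - (sdiff h ^^ n) g (x + h))
      + ((sdiff h ^^ n) g x - (sdiff h ^^ n) g (x - h))"
    by (simp add: sdiff_def)
  have "\<bar>x + h - x\<bar> \<le> h" "\<bar>x - h - x\<bar> \<le> h" using h by auto
  from D[OF this(1)] D[OF this(2)]
  have "\<bar>(sdiff h ^^ Suc n) g x\<bar> \<le> (2 * h) ^ n * B * h + (2 * h) ^ n * B * h"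
    unfolding e by linarith
  then show ?case by (simp add: algebra_simps)
qed simp

lemma integrable_sdiff_power:
  assumes "integrable lborel g"
  shows "integrable lborel ((sdiff h ^^ M) g)"
    "(LINT x|lborel. \<bar>(sdiff h ^^ M) g x\<bar>) \<le> 4 ^ M * (LINT x|lborel. \<bar>g x\<bar>)"
proof -
  have "integrable lborel ((sdiff h ^^ M) g) \<and>
    (LINT x|lborel. \<bar>(sdiff h ^^ M) g x\<bar>) \<le> 4 ^ M * (LINT x|lborel. \<bar>g x\<bar>)"
  proof (induction M)
    case 0
    then show ?case using assms by simp
  next
    case (Suc M)
    let ?G = "(sdiff h ^^ M) g"
    have i: "integrable lborel (\<lambda>x. ?G (x + c))" for c
      using lborel_integrable_real_affine[of ?G 1 c] Suc by (simp add: add.commute)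
    have e: "(LINT x|lborel. \<bar>?G (x + c)\<bar>) = (LINT x|lborel. \<bar>?G x\<bar>)" for c
      using lborel_integral_real_affine[of 1 "\<lambda>x. \<bar>?G x\<bar>" c] by (simp add: add.commute)
    have eq: "(sdiff h ^^ Suc M) g = (\<lambda>x. 2 * ?G x - ?G (x + h) - ?G (x + - h))"
      by (auto simp: sdiff_def)
    have 1: "integrable lborel ((sdiff h ^^ Suc M) g)"
      unfolding eq using Suc i[of h] i[of "- h"]
      by (intro Bochner_Integration.integrable_diff integrable_mult_right) auto
    have "(LINT x|lborel. \<bar>(sdiff h ^^ Suc M) g x\<bar>)
        \<le> (LINT x|lborel. 2 * \<bar>?G x\<bar> + \<bar>?G (x + h)\<bar> + \<bar>?G (x + - h)\<bar>)"
    proof (rule integral_mono)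
      show "integrable lborel (\<lambda>x. 2 * \<bar>?G x\<bar> + \<bar>?G (x + h)\<bar> + \<bar>?G (x + - h)\<bar>)"
        using Suc i[of h] i[of "- h"]
        by (intro Bochner_Integration.integrable_add integrable_mult_right integrable_abs) auto
      show "integrable lborel (\<lambda>x. \<bar>(sdiff h ^^ Suc M) g x\<bar>)" by (rule integrable_abs[OF 1])
      have tri: "\<bar>2 * a - b - c\<bar> \<le> 2 * \<bar>a\<bar> + \<bar>b\<bar> + \<bar>c\<bar>" for a b c :: real by linarith
      show "\<bar>(sdiff h ^^ Suc M) g x\<bar> \<le> 2 * \<bar>?G x\<bar> + \<bar>?G (x + h)\<bar> + \<bar>?G (x + - h)\<bar>" for x
        unfolding eq by (rule tri)
    qed
    also have "\<dots> = 4 * (LINT x|lborel. \<bar>?G x\<bar>)"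
    proof -
      have i0: "integrable lborel ?G" using Suc by simp
      have "(LINT x|lborel. 2 * \<bar>?G x\<bar> + \<bar>?G (x + h)\<bar> + \<bar>?G (x + - h)\<bar>)
        = 2 * (LINT x|lborel. \<bar>?G x\<bar>) + (LINT x|lborel. \<bar>?G (x + h)\<bar>) + (LINT x|lborel. \<bar>?G (x + - h)\<bar>)"
        using integrable_abs[OF i0] integrable_abs[OF i[of h]] integrable_abs[OF i[of "-h"]]
        by (simp del: add_uminus_conv_diff)
      then show ?thesis unfolding e by simp
    qed
    finally show ?case using 1 Suc by simp
  qed
  then show "integrable lborel ((sdiff h ^^ M) g)"
    "(LINT x|lborel. \<bar>(sdiff h ^^ M) g x\<bar>) \<le> 4 ^ M * (LINT x|lborel. \<bar>g x\<bar>)" by auto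
qed

lemma integrable_mult_bounded:
  fixes g k :: "real \<Rightarrow> real"
  assumes g: "integrable lborel g" and [measurable]: "k \<in> borel_measurable borel" and b: "\<And>x. \<bar>k x\<bar> \<le> B"
  shows "integrable lborel (\<lambda>x. g x * k x)"
proof (rule Bochner_Integration.integrable_bound[OF integrable_mult_left[OF g, of B]])
  show "AE x in lborel. norm (g x * k x) \<le> norm (g x * B)"
    using b by (auto intro!: AE_I2 mult_left_mono intro: order_trans[OF _ abs_ge_self] simp: abs_mult)
qed (use borel_measurable_integrable[OF g] in measurable)

text \<open>Summation by parts: translation invariance moves the second differences from the Gaussian to \<open>g\<close>.\<close>

lemma integral_gauss_sdiff_parts:
  assumes "integrable lborel g" and h: "h \<noteq> 0"
  shows "(LINT x|lborel. g x * gauss_sdiff M ((x - z) / h))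
    = (LINT x|lborel. (sdiff h ^^ M) g x * gauss_sdiff 0 ((x - z) / h))"
  using assms(1)
proof (induction M arbitrary: g)
  case (Suc M)
  have i: "integrable lborel (\<lambda>x. k x * gauss_sdiff M ((x - c) / h))" if "integrable lborel k" for k c
    by (rule integrable_mult_bounded[OF that _ abs_gauss_sdiff_le]) measurable
  have iz: "integrable lborel (\<lambda>x. g x * gauss_sdiff M ((x - z - c) / h))" for c
    using i[OF Suc.prems, of "z + c"] by (simp only: diff_diff_eq)
  have ish: "integrable lborel (\<lambda>x. g (x + c))" for c
    using lborel_integrable_real_affine[OF Suc.prems, of 1 c] by (simp add: add.commute)
  have sh: "(LINT x|lborel. g x * gauss_sdiff M ((x - z - c) / h))
      = (LINT x|lborel. g (x + c) * gauss_sdiff M ((x - z) / h))" for c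
    using lborel_integral_real_affine[of 1 "\<lambda>x. g x * gauss_sdiff M ((x - z - c) / h)" c]
    by (simp add: add.commute)
  have "g x * gauss_sdiff (Suc M) ((x - z) / h) = 2 * (g x * gauss_sdiff M ((x - z) / h))
      - g x * gauss_sdiff M ((x - z - (-h)) / h) - g x * gauss_sdiff M ((x - z - h) / h)" for x
    using h unfolding gauss_sdiff_Suc by (simp add: algebra_simps add_divide_distrib diff_divide_distrib)
  then have "(LINT x|lborel. g x * gauss_sdiff (Suc M) ((x - z) / h))
      = 2 * (LINT x|lborel. g x * gauss_sdiff M ((x - z) / h))
      - (LINT x|lborel. g x * gauss_sdiff M ((x - z - (-h)) / h))
      - (LINT x|lborel. g x * gauss_sdiff M ((x - z - h) / h))"
    by (simp only: Bochner_Integration.integral_diff integrable_mult_right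
        Bochner_Integration.integrable_diff i[OF Suc.prems] iz integral_mult_right_zero)
  also have "\<dots> = 2 * (LINT x|lborel. g x * gauss_sdiff M ((x - z) / h))
      - (LINT x|lborel. g (x + -h) * gauss_sdiff M ((x - z) / h))
      - (LINT x|lborel. g (x + h) * gauss_sdiff M ((x - z) / h))"
    unfolding sh ..
  also have "\<dots> = (LINT x|lborel. sdiff h g x * gauss_sdiff M ((x - z) / h))"
    using i[OF Suc.prems, of z] i[OF ish, of "-h" z] i[OF ish, of h z]
    by (simp add: sdiff_def left_diff_distrib mult.assoc)
  also have "\<dots> = (LINT x|lborel. (sdiff h ^^ M) (sdiff h g) x * gauss_sdiff 0 ((x - z) / h))"
    by (rule Suc.IH) (use integrable_sdiff_power(1)[OF Suc.prems, where h=h and M=1] in simp)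
  finally show ?case by (simp add: funpow_swap1)
qed simp


lemma integral_scaled_gaussian:
  fixes h z :: real
  assumes h: "0 < h"
  shows "integrable lborel (\<lambda>x. gauss_sdiff 0 ((x - z) / h))"
    "(LINT x|lborel. gauss_sdiff 0 ((x - z) / h)) = h * (2 * pi)"
proof -
  let ?G = "\<lambda>x. gauss_sdiff 0 ((x - z) / h)"
  have e: "?G (z + h * y) = sqrt (2 * pi) * exp (- y\<^sup>2 / 2)" for y
    using h by (simp add: gauss_sdiff_0)
  have "integrable lborel (\<lambda>y. ?G (z + h * y))"
    unfolding e by (rule integrable_mult_right[OF integrable_gaussian])
  then show "integrable lborel ?G"
    using lborel_integrable_real_affine_iff[of h ?G z] h by simp
  have "(LINT x|lborel. ?G x) = h * (LINT y|lborel. ?G (z + h * y))"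
    using lborel_integral_real_affine[of h ?G z] h by simp
  then show "(LINT x|lborel. ?G x) = h * (2 * pi)"
    unfolding e integral_mult_right_zero integral_gaussian by simp
qed

text \<open>After summation by parts, \<open>n\<close> of the differences of \<open>g\<close> near \<open>c\<close> give \<open>h\<^sup>n\<close>, the remaining one is
  bounded trivially, and the integral of the Gaussian at scale \<open>h\<close> gives another factor \<open>h\<close>. Since \<open>C\<^sup>n\<close>
  gives no control at infinity, the part away from \<open>c\<close> is left to the decay of the Gaussian.\<close>

lemma gauss_sdiff_smooth_bound:
  fixes g :: "real \<Rightarrow> real"
  assumes C: "C_class n g" and g: "integrable lborel g" and g1: "(LINT x|lborel. \<bar>g x\<bar>) \<le> 1"
  obtains K where "0 \<le> K" "\<And>h z. 0 < h \<Longrightarrow> real (Suc n) * h \<le> 1 \<Longrightarrow> \<bar>z - c\<bar> \<le> 1 / 2 \<Longrightarrow>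
    \<bar>LINT x|lborel. g x * gauss_sdiff (Suc n) ((x - z) / h)\<bar>
      \<le> K * h ^ Suc n + 4 ^ Suc n * sqrt (2 * pi) * exp (- 1 / (8 * h\<^sup>2))"
proof -
  have "compact ((deriv ^^ n) g ` cball c 3)"
    by (rule compact_continuous_image)
      (use C in \<open>auto simp: C_class_def intro: continuous_on_subset\<close>)
  then obtain B where B: "0 < B" "\<And>y. \<bar>y - c\<bar> \<le> 3 \<Longrightarrow> \<bar>(deriv ^^ n) g y\<bar> \<le> B"
    using bounded_pos[of "(deriv ^^ n) g ` cball c 3"]
    by (auto dest!: compact_imp_bounded simp: dist_real_def abs_minus_commute)
  show thesis
  proof (rule that[of "4 * 2 ^ n * B * (2 * pi)"])
    show "0 \<le> 4 * 2 ^ n * B * (2 * pi)" using B by simp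
    fix h z :: real
    assume h: "0 < h" and hn: "real (Suc n) * h \<le> 1" and z: "\<bar>z - c\<bar> \<le> 1 / 2"
    let ?D = "(sdiff h ^^ Suc n) g" and ?G = "\<lambda>x. gauss_sdiff 0 ((x - z) / h)"
    let ?e = "sqrt (2 * pi) * exp (- 1 / (8 * h\<^sup>2))"
    note D = integrable_sdiff_power[OF g, where h=h and M="Suc n"]
    have G0: "0 \<le> ?G x" for x by (simp add: gauss_sdiff_0)
    have Gb: "\<bar>?G x\<bar> \<le> 4 ^ 0 * sqrt (2 * pi)" for x by (rule abs_gauss_sdiff_le)
    note hb = integral_scaled_gaussian[OF h, of z]
    have pt: "\<bar>?D x * ?G x\<bar> \<le> 4 * (2 * h) ^ n * B * ?G x + \<bar>?D x\<bar> * ?e" for x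
    proof (cases "\<bar>x - c\<bar> \<le> 1")
      case True
      have b: "\<bar>(sdiff h ^^ n) g y\<bar> \<le> (2 * h) ^ n * B" if "\<bar>y - x\<bar> \<le> h" for y
      proof (rule abs_sdiff_power_le[OF C h B(2)])
        have "0 \<le> real n * h" "h + real n * h \<le> 1" using hn h by (auto simp: algebra_simps)
        then show "\<bar>y - c\<bar> + real n * h \<le> 3" using True that by linarith
      qed
      have x: "\<bar>x - x\<bar> \<le> h" "\<bar>x + h - x\<bar> \<le> h" "\<bar>x - h - x\<bar> \<le> h" using h by auto
      have "?D x = 2 * (sdiff h ^^ n) g x - (sdiff h ^^ n) g (x + h) - (sdiff h ^^ n) g (x - h)"
        by (simp add: sdiff_def)
      then have "\<bar>?D x\<bar> \<le> 4 * ((2 * h) ^ n * B)"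
        using b[OF x(1)] b[OF x(2)] b[OF x(3)] by linarith
      then have "\<bar>?D x\<bar> * ?G x \<le> 4 * ((2 * h) ^ n * B) * ?G x"
        by (rule mult_right_mono[OF _ G0])
      moreover have "0 \<le> \<bar>?D x\<bar> * ?e" by simp
      ultimately show ?thesis
        unfolding abs_mult abs_of_nonneg[OF G0] mult.assoc by linarith
    next
      case False
      then have "1 / 2 \<le> \<bar>x - z\<bar>" using z by linarith
      then have "(1 / 2)\<^sup>2 \<le> \<bar>x - z\<bar>\<^sup>2" by (intro power_mono) auto
      then have "1 / 4 / h\<^sup>2 \<le> (x - z)\<^sup>2 / h\<^sup>2"
        by (intro divide_right_mono) (auto simp: power2_eq_square)
      then have "1 / (8 * h\<^sup>2) \<le> ((x - z) / h)\<^sup>2 / 2"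
        by (simp add: power_divide)
      then have "?G x \<le> ?e" by (simp add: gauss_sdiff_0)
      then have "\<bar>?D x\<bar> * ?G x \<le> \<bar>?D x\<bar> * ?e" by (intro mult_left_mono) auto
      moreover have "0 \<le> 4 * (2 * h) ^ n * B * ?G x" using h B G0[of x] by simp
      ultimately show ?thesis unfolding abs_mult abs_of_nonneg[OF G0] by linarith
    qed
    have i: "integrable lborel (\<lambda>x. ?D x * ?G x)"
      by (rule integrable_mult_bounded[OF D(1) _ Gb]) measurable
    have "(LINT x|lborel. g x * gauss_sdiff (Suc n) ((x - z) / h)) = (LINT x|lborel. ?D x * ?G x)"
      by (rule integral_gauss_sdiff_parts[OF g]) (use h in simp)
    also have "\<bar>\<dots>\<bar> \<le> (LINT x|lborel. \<bar>?D x * ?G x\<bar>)"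
      by (rule integral_abs_bound)
    also have "\<dots> \<le> (LINT x|lborel. 4 * (2 * h) ^ n * B * ?G x + \<bar>?D x\<bar> * ?e)"
      by (rule integral_mono[OF integrable_abs[OF i]])
        (intro Bochner_Integration.integrable_add integrable_mult_right integrable_mult_left hb
          integrable_abs D, rule pt)
    also have "\<dots> = 4 * (2 * h) ^ n * B * (h * (2 * pi)) + (LINT x|lborel. \<bar>?D x\<bar>) * ?e"
      by (simp only: Bochner_Integration.integral_add integrable_mult_right integrable_mult_left hb
          integrable_abs D integral_mult_right_zero integral_mult_left_zero)
    also have "\<dots> \<le> 4 * (2 * h) ^ n * B * (h * (2 * pi)) + 4 ^ Suc n * ?e"
    proof (intro add_left_mono mult_right_mono)
      show "(LINT x|lborel. \<bar>?D x\<bar>) \<le> 4 ^ Suc n"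
        by (rule order_trans[OF D(2)]) (use g1 in simp)
    qed simp
    also have "\<dots> = 4 * 2 ^ n * B * (2 * pi) * h ^ Suc n + 4 ^ Suc n * sqrt (2 * pi) * exp (- 1 / (8 * h\<^sup>2))"
      by (simp add: power_mult_distrib mult_ac)
    finally show "\<bar>LINT x|lborel. g x * gauss_sdiff (Suc n) ((x - z) / h)\<bar>
      \<le> 4 * 2 ^ n * B * (2 * pi) * h ^ Suc n + 4 ^ Suc n * sqrt (2 * pi) * exp (- 1 / (8 * h\<^sup>2))" .
  qed
qed

text \<open>The law of \<open>-c - Z\<close>: adding it to \<open>X\<close> removes the drift \<open>c\<close> and multiplies the characteristic function by
  the conjugate of that of \<open>Z\<close>.\<close>

lemma char_reflect_shift:
  assumes Q: "real_distribution Q"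
  shows "real_distribution (distr Q borel (\<lambda>z. - c - z))"
    "char (distr Q borel (\<lambda>z. - c - z)) t = iexp (- (t * c)) * cnj (char Q t)"
proof -
  interpret Q: real_distribution Q by (rule Q)
  show "real_distribution (distr Q borel (\<lambda>z. - c - z))"
    by (rule Q.real_distribution_distr) simp
  have i: "integrable Q (\<lambda>x. iexp (t * x))"
    by (rule Q.integrable_const_bound[where B=1]) auto
  have "char (distr Q borel (\<lambda>z. - c - z)) t = (\<integral>z. iexp (t * (- c - z)) \<partial>Q)"
    unfolding char_def by (rule integral_distr) auto
  also have "\<dots> = (\<integral>z. iexp (- (t * c)) * cnj (iexp (t * z)) \<partial>Q)"
    by (intro Bochner_Integration.integral_cong refl)
      (simp add: exp_cnj exp_add[symmetric] algebra_simps minus_diff_commute)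
  also have "\<dots> = iexp (- (t * c)) * cnj (char Q t)"
    by (simp add: char_def)
  finally show "char (distr Q borel (\<lambda>z. - c - z)) t = iexp (- (t * c)) * cnj (char Q t)" .
qed

text \<open>The integral is the expectation of \<open>gauss_sdiff (Suc n) ((X - c - Z) / h)\<close> with independent \<open>X\<close> and
  \<open>Z\<close> of laws \<open>\<mu>\<close> and \<open>Q\<close>. The smoothness estimate applies for every fixed value of \<open>Z\<close> of modulus at most
  1/2; the other values are paid for by their probability.\<close>

lemma versine_char_upper_bound:
  fixes g :: "real \<Rightarrow> real"
  assumes \<mu>: "real_distribution \<mu>" and \<mu>g: "\<mu> = density lborel (\<lambda>x. ennreal (g x))"
    and gm[measurable]: "g \<in> borel_measurable borel" and g0: "\<And>x. 0 \<le> g x" and C: "C_class n g"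
  obtains K where "0 \<le> K" "\<And>h Q. 0 < h \<Longrightarrow> real (Suc n) * h \<le> 1 \<Longrightarrow> real_distribution Q \<Longrightarrow>
    norm (versine_integral (Suc n) (\<lambda>v. iexp (- (v / h * c)) * cnj (char Q (v / h)) * char \<mu> (v / h)))
      \<le> K * h ^ Suc n + 4 ^ Suc n * sqrt (2 * pi) * (exp (- 1 / (8 * h\<^sup>2)) + measure Q {x. 1 / 2 < \<bar>x\<bar>})"
proof -
  interpret \<mu>: real_distribution \<mu> by (rule \<mu>)
  have "(\<integral>\<^sup>+x. ennreal (g x) \<partial>lborel) = emeasure \<mu> (space \<mu>)"
    unfolding \<mu>g by (simp add: emeasure_density)
  then have g1: "(\<integral>\<^sup>+x. ennreal (g x) \<partial>lborel) = 1" using \<mu>.emeasure_space_1 by simp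
  then have gi: "integrable lborel g"
    using g0 by (intro integrableI_nonneg) auto
  have "ennreal (LINT x|lborel. g x) = 1"
    using nn_integral_eq_integral[OF gi] g0 g1 by simp
  then have gL: "(LINT x|lborel. \<bar>g x\<bar>) \<le> 1"
    using g0 by simp
  from gauss_sdiff_smooth_bound[OF C gi gL, of c] obtain K where K: "0 \<le> K"
    "\<And>h z. 0 < h \<Longrightarrow> real (Suc n) * h \<le> 1 \<Longrightarrow> \<bar>z - c\<bar> \<le> 1 / 2 \<Longrightarrow>
    \<bar>LINT x|lborel. g x * gauss_sdiff (Suc n) ((x - z) / h)\<bar>
      \<le> K * h ^ Suc n + 4 ^ Suc n * sqrt (2 * pi) * exp (- 1 / (8 * h\<^sup>2))" by blast
  let ?b = "4 ^ Suc n * sqrt (2 * pi)"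
  show thesis
  proof (rule that[OF K(1)])
    fix h :: real and Q
    assume h: "0 < h" "real (Suc n) * h \<le> 1" and Q: "real_distribution Q"
    interpret Q: real_distribution Q by (rule Q)
    let ?Q' = "distr Q borel (\<lambda>z. - c - z)"
    note Q' = char_reflect_shift[OF Q, of c]
    let ?R = "?Q' \<star> \<mu>"
    have R: "real_distribution ?R" by (rule real_distribution_convolution[OF Q'(1) \<mu>])
    have "(versine_integral (Suc n) (\<lambda>v. iexp (- (v / h * c)) * cnj (char Q (v / h)) * char \<mu> (v / h)))
      = of_real (\<integral>y. gauss_sdiff (Suc n) (1 / h * y) \<partial>?R)"
      using integral_versine_char[OF R, of "Suc n" "1 / h"]
      by (simp add: char_convolution[OF Q'(1) \<mu>] Q'(2))
    also have "(\<integral>y. gauss_sdiff (Suc n) (1 / h * y) \<partial>?R)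
        = (\<integral>q. (\<integral>x. gauss_sdiff (Suc n) (1 / h * (q + x)) \<partial>\<mu>) \<partial>?Q')"
      by (rule integral_convolution[OF Q'(1) \<mu>, of _ ?b], measurable)
        (simp only: real_norm_def abs_gauss_sdiff_le)
    also have "\<dots> = (\<integral>z. (\<integral>x. gauss_sdiff (Suc n) (1 / h * (- c - z + x)) \<partial>\<mu>) \<partial>Q)"
      by (rule integral_distr) auto
    also have "\<dots> = (\<integral>z. (LINT x|lborel. g x * gauss_sdiff (Suc n) ((x - (c + z)) / h)) \<partial>Q)"
      unfolding \<mu>g using g0
      by (subst integral_density) (auto simp: algebra_simps diff_divide_distrib)
    finally have eq: "(versine_integral (Suc n) (\<lambda>v. iexp (- (v / h * c)) * cnj (char Q (v / h)) * char \<mu> (v / h)))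
      = of_real (\<integral>z. (LINT x|lborel. g x * gauss_sdiff (Suc n) ((x - (c + z)) / h)) \<partial>Q)"
      (is "_ = of_real (\<integral>z. ?I z \<partial>Q)") .
    let ?A = "K * h ^ Suc n + ?b * exp (- 1 / (8 * h\<^sup>2))"
    have A0: "0 \<le> ?A" using K(1) h by simp
    have Ib: "\<bar>?I z\<bar> \<le> ?b" for z
    proof -
      have "\<bar>?I z\<bar> \<le> (LINT x|lborel. \<bar>g x * gauss_sdiff (Suc n) ((x - (c + z)) / h)\<bar>)"
        by (rule integral_abs_bound)
      also have "\<dots> \<le> (LINT x|lborel. g x * ?b)"
      proof (rule integral_mono)
        show "integrable lborel (\<lambda>x. \<bar>g x * gauss_sdiff (Suc n) ((x - (c + z)) / h)\<bar>)"
          by (intro integrable_abs integrable_mult_bounded[OF gi _ abs_gauss_sdiff_le]) measurable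
        show "\<bar>g x * gauss_sdiff (Suc n) ((x - (c + z)) / h)\<bar> \<le> g x * ?b" for x
          using abs_gauss_sdiff_le g0[of x] by (simp only: abs_mult abs_of_nonneg mult_left_mono)
      qed (use gi in simp)
      also have "\<dots> = (LINT x|lborel. g x) * ?b" by simp
      also have "\<dots> \<le> 1 * ?b" using gL g0 by (intro mult_right_mono) auto
      finally show ?thesis by simp
    qed
    have pt: "\<bar>?I z\<bar> \<le> ?A + ?b * indicator {x. 1 / 2 < \<bar>x\<bar>} z" for z
    proof (cases "1 / 2 < \<bar>z\<bar>")
      case True
      then show ?thesis using Ib[of z] A0 by simp
    next
      case False
      then show ?thesis using K(2)[OF h, of "c + z"] by simp
    qed
    have [measurable]: "?I \<in> borel_measurable borel" by measurable
    have "\<bar>\<integral>z. ?I z \<partial>Q\<bar> \<le> (\<integral>z. \<bar>?I z\<bar> \<partial>Q)" by (rule integral_abs_bound)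
    also have "\<dots> \<le> (\<integral>z. ?A + ?b * indicator {x. 1 / 2 < \<bar>x\<bar>} z \<partial>Q)"
    proof (rule integral_mono)
      show "integrable Q (\<lambda>z. \<bar>?I z\<bar>)"
        by (rule Q.integrable_const_bound[where B="?b"]) (use Ib in auto)
      show "integrable Q (\<lambda>z. ?A + ?b * indicator {x. 1 / 2 < \<bar>x\<bar>} z)"
        by (rule Q.integrable_const_bound[where B="?A + ?b"])
          (use A0 in \<open>auto simp: indicator_def abs_of_nonneg\<close>)
    qed (rule pt)
    also have "\<dots> = ?A + ?b * measure Q {x. 1 / 2 < \<bar>x\<bar>}"
    proof -
      have "integrable Q (\<lambda>z. indicator {x. 1 / 2 < \<bar>x\<bar>} z :: real)"
        by (rule Q.integrable_const_bound[where B=1]) (auto simp: indicator_def)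
      then show ?thesis
        by (subst Bochner_Integration.integral_add) (use Q.prob_space in auto)
    qed
    finally show "norm (versine_integral (Suc n) (\<lambda>v. iexp (- (v / h * c)) * cnj (char Q (v / h)) * char \<mu> (v / h)))
      \<le> K * h ^ Suc n + 4 ^ Suc n * sqrt (2 * pi) * (exp (- 1 / (8 * h\<^sup>2)) + measure Q {x. 1 / 2 < \<bar>x\<bar>})"
      unfolding eq norm_of_real by (simp add: distrib_left)
  qed
qed

section \<open>Jump exponents and Fourier transforms of jump densities\<close>

definition fourier :: "(real \<Rightarrow> real) \<Rightarrow> real \<Rightarrow> complex" where
  "fourier c u = (CLINT x|lborel. complex_of_real (c x) * iexp (u * x))"

lemma norm_iexp_minus_1_le:
  fixes u x :: real
  shows "norm (iexp (u * x) - 1) \<le> (2 + \<bar>u\<bar>) * min 1 \<bar>x\<bar>"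
proof -
  have 1: "norm (iexp (u * x) - 1) \<le> \<bar>u\<bar> * \<bar>x\<bar>"
    using iexp_approx1[of "u * x" 0] by (simp add: abs_mult)
  have "norm (iexp (u * x) - 1) \<le> norm (iexp (u * x)) + norm (1::complex)" by (rule norm_triangle_ineq4)
  then have 2: "norm (iexp (u * x) - 1) \<le> 2" by simp
  have "0 \<le> \<bar>u\<bar> * \<bar>x\<bar>" by simp
  show ?thesis
  proof (cases "\<bar>x\<bar> \<le> 1")
    case True
    then show ?thesis using 1 by (simp add: min_def distrib_right)
  next
    case False
    then show ?thesis using 2 by (simp add: min_def) 
  qed
qed

lemma integrable_levy_exp:
  assumes [measurable]: "c \<in> borel_measurable borel" and c: "integrable lborel (\<lambda>x. min 1 \<bar>x\<bar> * c x)"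
  shows "integrable lborel (\<lambda>x. complex_of_real (c x) * (iexp (u * x) - 1))"
proof (rule Bochner_Integration.integrable_bound[OF integrable_mult_right[OF c, of "2 + \<bar>u\<bar>"]])
  show "AE x in lborel. norm (complex_of_real (c x) * (iexp (u * x) - 1))
      \<le> norm ((2 + \<bar>u\<bar>) * (min 1 \<bar>x\<bar> * c x))"
  proof (rule AE_I2)
    fix x
    have "\<bar>c x\<bar> * norm (iexp (u * x) - 1) \<le> \<bar>c x\<bar> * ((2 + \<bar>u\<bar>) * min 1 \<bar>x\<bar>)"
      by (rule mult_left_mono[OF norm_iexp_minus_1_le]) simp
    then show "norm (complex_of_real (c x) * (iexp (u * x) - 1))
      \<le> norm ((2 + \<bar>u\<bar>) * (min 1 \<bar>x\<bar> * c x))"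
      by (simp add: norm_mult abs_mult mult_ac)
  qed
qed measurable

lemma integrable_min_abs_mult_indicator:
  fixes c :: "real \<Rightarrow> real"
  assumes [measurable]: "c \<in> borel_measurable borel" "A \<in> sets borel"
    and c: "integrable lborel (\<lambda>x. min 1 \<bar>x\<bar> * c x)"
  shows "integrable lborel (\<lambda>x. min 1 \<bar>x\<bar> * (c x * indicator A x))"
proof (rule Bochner_Integration.integrable_bound[OF c])
  show "AE x in lborel. norm (min 1 \<bar>x\<bar> * (c x * indicator A x)) \<le> norm (min 1 \<bar>x\<bar> * c x)"
    by (rule AE_I2) (simp add: indicator_def)
qed measurable

lemma integrable_min_absI:
  assumes "integrable lborel (c :: real \<Rightarrow> real)"
  shows "integrable lborel (\<lambda>x. min 1 \<bar>x\<bar> * c x)"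
  by (rule Bochner_Integration.integrable_bound[OF assms])
    (use borel_measurable_integrable[OF assms] in \<open>auto simp: abs_mult mult_left_le_one_le\<close>)

lemma levy_exp_add:
  assumes "c1 \<in> borel_measurable borel" "integrable lborel (\<lambda>x. min 1 \<bar>x\<bar> * c1 x)"
    and "c2 \<in> borel_measurable borel" "integrable lborel (\<lambda>x. min 1 \<bar>x\<bar> * c2 x)"
    and "\<And>x. c x = c1 x + c2 x"
  shows "levy_exp c u = levy_exp c1 u + levy_exp c2 u"
  unfolding levy_exp_def assms(5) using integrable_levy_exp[OF assms(1,2), of u] integrable_levy_exp[OF assms(3,4), of u]
  by (simp add: distrib_right)

lemma integrable_fourier:
  assumes c: "integrable lborel c"
  shows "integrable lborel (\<lambda>x. complex_of_real (c x) * iexp (u * x))"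
  by (rule Bochner_Integration.integrable_bound[OF c])
    (use borel_measurable_integrable[OF c] in \<open>auto simp: norm_mult\<close>)

lemma levy_exp_integrable_eq:
  assumes c: "integrable lborel c"
  shows "levy_exp c u = fourier c u - complex_of_real (\<integral>x. c x \<partial>lborel)"
  unfolding levy_exp_def fourier_def using integrable_fourier[OF c, of u] c
  by (simp add: right_diff_distrib)

lemma norm_fourier_le:
  assumes c: "integrable lborel c" and nn: "\<And>x. 0 \<le> c x"
  shows "norm (fourier c u) \<le> (\<integral>x. c x \<partial>lborel)"
proof -
  have "norm (fourier c u) \<le> (\<integral>x. norm (complex_of_real (c x) * iexp (u * x)) \<partial>lborel)"
    unfolding fourier_def by (rule integral_norm_bound)
  then show ?thesis using nn by (simp add: norm_mult)
qed

lemma Re_fourier: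
  assumes c: "integrable lborel c"
  shows "Re (fourier c u) = (\<integral>x. cos (u * x) * c x \<partial>lborel)"
  unfolding fourier_def integral_Re[OF integrable_fourier[OF c], symmetric]
  by (simp add: Re_exp mult.commute)

lemma Re_levy_exp:
  assumes "c \<in> borel_measurable borel" "integrable lborel (\<lambda>x. min 1 \<bar>x\<bar> * c x)"
  shows "integrable lborel (\<lambda>x. (1 - cos (u * x)) * c x)"
    "Re (levy_exp c u) = - (\<integral>x. (1 - cos (u * x)) * c x \<partial>lborel)"
proof -
  note i = integrable_levy_exp[OF assms, of u]
  have e: "Re (complex_of_real (c x) * (iexp (u * x) - 1)) = - ((1 - cos (u * x)) * c x)" for x
    by (simp add: Re_exp algebra_simps)
  from integrable_Re[OF i] show "integrable lborel (\<lambda>x. (1 - cos (u * x)) * c x)"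
    unfolding e by simp
  show "Re (levy_exp c u) = - (\<integral>x. (1 - cos (u * x)) * c x \<partial>lborel)"
    unfolding levy_exp_def integral_Re[OF i, symmetric] e by simp
qed

lemma integrable_reflect:
  fixes f :: "real \<Rightarrow> real"
  assumes "integrable lborel f" shows "integrable lborel (\<lambda>x. f (- x))"
  using lborel_integrable_real_affine[OF assms, of "-1" 0] by simp

lemma AE_reflect:
  assumes "AE x in lborel. P (x::real)" shows "AE x in lborel. P (- x)"
proof -
  from assms obtain N where N: "N \<in> null_sets lborel" "{x. \<not> P x} \<subseteq> N"
    by (auto simp: eventually_ae_filter)
  have Nb: "N \<in> sets borel" using N by auto
  have "emeasure lborel (uminus -` N) = emeasure (distr lborel borel uminus) N"
    using Nb by (subst emeasure_distr) auto
  also have "\<dots> = 0" using N by (auto simp: lborel_distr_uminus)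
  finally have "uminus -` N \<in> null_sets lborel"
    using measurable_sets[of "uminus :: real \<Rightarrow> real" borel borel N] Nb by (auto intro!: null_setsI)
  then show ?thesis by (rule AE_I') (use N in auto)
qed

text \<open>Folds the line onto the positive half-axis, where only \<open>b x + b (- x)\<close> matters for even integrands.\<close>

lemma integral_split_reflect:
  fixes f :: "real \<Rightarrow> real"
  assumes f: "integrable lborel f"
  shows "(\<integral>x. f x \<partial>lborel) = (\<integral>x. indicator {0<..} x * (f x + f (- x)) \<partial>lborel)"
proof -
  have [measurable]: "f \<in> borel_measurable borel" using f by auto
  have i: "integrable lborel (\<lambda>x. indicator A x * f x)" if "A \<in> sets borel" for A :: "real set"
    using integrable_mult_indicator[OF _ f, of A] that by simp
  have "(\<integral>x. f x \<partial>lborel) = (\<integral>x. indicator {0<..} x * f x + indicator {..<0} x * f x \<partial>lborel)"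
    by (rule integral_cong_AE, measurable)
      (use AE_lborel_singleton[of 0] in eventually_elim, auto simp: indicator_def)
  also have "\<dots> = (\<integral>x. indicator {0<..} x * f x \<partial>lborel) + (\<integral>x. indicator {..<0} x * f x \<partial>lborel)"
    by (rule Bochner_Integration.integral_add) (auto intro: i)
  also have "(\<integral>x. indicator {..<0} x * f x \<partial>lborel) = (\<integral>x. indicator {0<..} x * f (- x) \<partial>lborel)"
    using lborel_integral_real_affine[of "-1" "\<lambda>x. indicator {..<0} x * f x" 0]
    by (simp add: indicator_def)
  also have "(\<integral>x. indicator {0<..} x * f x \<partial>lborel) + (\<integral>x. indicator {0<..} x * f (- x) \<partial>lborel)
      = (\<integral>x. indicator {0<..} x * (f x + f (- x)) \<partial>lborel)"
    using i[of "{0<..}"] integrable_mult_indicator[OF _ integrable_reflect[OF f], of "{0<..}"]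
    by (simp add: distrib_left)
  finally show ?thesis .
qed

section \<open>Jump densities behaving like \<open>\<alpha> / x\<close> near zero\<close>

text \<open>The order of \<open>b\<close> at 0 is not an assumption of the locale: it enters through \<open>band \<epsilon> d\<close> for varying
  \<open>\<epsilon>\<close>, so that each estimate can choose its own precision.\<close>

locale jump_density =
  fixes b :: "real \<Rightarrow> real" and \<alpha> :: real
  assumes b_measurable[measurable]: "b \<in> borel_measurable borel"
    and b_nonneg: "\<And>x. 0 \<le> b x"
    and b_integrable: "integrable lborel (\<lambda>x. min 1 \<bar>x\<bar> * b x)"
    and \<alpha>_pos: "0 < \<alpha>"
begin

text \<open>The bound \<open>d \<le> 1\<close> makes \<open>min 1 \<bar>x\<bar>\<close> equal to \<open>\<bar>x\<bar>\<close> for jumps of size up to \<open>d\<close>.\<close>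

definition band :: "real \<Rightarrow> real \<Rightarrow> bool" where
  "band \<epsilon> d \<longleftrightarrow> 0 < \<epsilon> \<and> 0 < d \<and> d \<le> 1 \<and>
    (AE x in lborel. 0 < x \<longrightarrow> x \<le> d \<longrightarrow> \<bar>x * (b x + b (- x)) - \<alpha>\<bar> \<le> \<epsilon>)"

lemma integrable_even_shell:
  assumes a: "0 \<le> a" "r \<le> 1" and [measurable]: "F \<in> borel_measurable borel"
    and even: "\<And>x. F (- x) = F x" and C: "\<And>x. a < x \<Longrightarrow> x \<le> r \<Longrightarrow> \<bar>F x\<bar> \<le> C * x"
  shows "integrable lborel (\<lambda>x. F x * (b x * indicator {x. a < \<bar>x\<bar> \<and> \<bar>x\<bar> \<le> r} x))"
proof (rule Bochner_Integration.integrable_bound[OF integrable_mult_right[OF b_integrable, of C]])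
  show "AE x in lborel. norm (F x * (b x * indicator {x. a < \<bar>x\<bar> \<and> \<bar>x\<bar> \<le> r} x))
      \<le> norm (C * (min 1 \<bar>x\<bar> * b x))"
  proof (rule AE_I2)
    fix x
    show "norm (F x * (b x * indicator {x. a < \<bar>x\<bar> \<and> \<bar>x\<bar> \<le> r} x)) \<le> norm (C * (min 1 \<bar>x\<bar> * b x))"
    proof (cases "a < \<bar>x\<bar> \<and> \<bar>x\<bar> \<le> r")
      case True
      have "F \<bar>x\<bar> = F x" using even[of x] by (cases "0 \<le> x") auto
      then have "\<bar>F x\<bar> \<le> C * \<bar>x\<bar>" using C[of "\<bar>x\<bar>"] True by simp
      then have "\<bar>F x\<bar> * b x \<le> C * \<bar>x\<bar> * b x" by (rule mult_right_mono[OF _ b_nonneg])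
      also have "\<dots> \<le> norm (C * (min 1 \<bar>x\<bar> * b x))"
      proof -
        have "min 1 \<bar>x\<bar> = \<bar>x\<bar>" using True a by simp
        then show ?thesis by (simp only: real_norm_def mult.assoc abs_ge_self)
      qed
      finally show ?thesis using True b_nonneg[of x] by (simp add: abs_mult)
    qed simp
  qed
qed measurable

text \<open>The main source of quantitative information on \<open>b\<close>: an even function integrated against the jumps of
  size in \<open>(a, r]\<close> behaves as if \<open>b x + b (- x)\<close> were \<open>\<alpha> / x\<close>, up to an error of \<open>\<epsilon> / x\<close>. The cases
  \<open>F = \<bar>x\<bar>\<close>, \<open>1 - cos(ux)\<close>, \<open>1\<close> and \<open>cos(ux)\<close> are used below.\<close>

lemma even_shell_integral:
  assumes bd: "band \<epsilon> d" and a: "0 \<le> a" "a \<le> r" "r \<le> d" and [measurable]: "F \<in> borel_measurable borel"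
    and even: "\<And>x. F (- x) = F x" and C: "\<And>x. a < x \<Longrightarrow> x \<le> r \<Longrightarrow> \<bar>F x\<bar> \<le> C * x"
  shows "\<bar>(\<integral>x. F x * (b x * indicator {x. a < \<bar>x\<bar> \<and> \<bar>x\<bar> \<le> r} x) \<partial>lborel)
      - \<alpha> * (LINT x:{a<..r}|lborel. F x / x)\<bar> \<le> \<epsilon> * (LINT x:{a<..r}|lborel. \<bar>F x\<bar> / x)"
proof -
  let ?S = "{x. a < \<bar>x\<bar> \<and> \<bar>x\<bar> \<le> r}"
  have r1: "r \<le> 1" using bd a by (simp add: band_def)
  have i: "integrable lborel (\<lambda>x. F x * (b x * indicator ?S x))"
    by (rule integrable_even_shell[OF a(1) r1 _ even C]) auto
  have bnd: "\<bar>F x / x\<bar> \<le> \<bar>C\<bar>" if "a < x" "x \<le> r" for x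
  proof -
    have "\<bar>F x\<bar> \<le> \<bar>C\<bar> * x" using C[OF that] that a by (meson abs_ge_self less_imp_le mult_right_mono order_trans le_less_trans)
    then show ?thesis using that a by (simp add: abs_divide divide_le_eq)
  qed
  have iC: "integrable lborel (\<lambda>x. indicator {a<..r} x *\<^sub>R \<bar>C\<bar>)"
    by (rule integrable_scaleR_left, rule integrable_real_indicator) (auto intro: emeasure_Ioc_less_top)
  have iF: "integrable lborel (\<lambda>x. indicator {a<..r} x * (F x / x))"
    by (rule Bochner_Integration.integrable_bound[OF iC]) (use bnd in \<open>auto simp: indicator_def\<close>)
  have iaF: "integrable lborel (\<lambda>x. indicator {a<..r} x * (\<bar>F x\<bar> / x))"
    by (rule Bochner_Integration.integrable_bound[OF iC])
      (use bnd in \<open>auto simp: indicator_def abs_divide\<close>)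
  let ?f = "\<lambda>x. indicator {0<..} x * (F x * (b x * indicator ?S x) + F (- x) * (b (- x) * indicator ?S (- x)))"
  have fi: "integrable lborel ?f"
    using integrable_mult_indicator[OF _ Bochner_Integration.integrable_add[OF i integrable_reflect[OF i]], of "{0<..}"]
    by simp
  have "\<bar>(\<integral>x. F x * (b x * indicator ?S x) \<partial>lborel) - \<alpha> * (LINT x:{a<..r}|lborel. F x / x)\<bar>
      = \<bar>\<integral>x. ?f x - \<alpha> * (indicator {a<..r} x * (F x / x)) \<partial>lborel\<bar>"
  proof -
    have "(LINT x:{a<..r}|lborel. F x / x) = (\<integral>x. indicator {a<..r} x * (F x / x) \<partial>lborel)"
      by (simp add: set_lebesgue_integral_def)
    then show ?thesis
      unfolding integral_split_reflect[OF i]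
      by (simp only: Bochner_Integration.integral_diff[OF fi integrable_mult_right[OF iF]] integral_mult_right_zero)
  qed
  also have "\<dots> \<le> (\<integral>x. \<bar>?f x - \<alpha> * (indicator {a<..r} x * (F x / x))\<bar> \<partial>lborel)"
    by (rule integral_abs_bound)
  also have "\<dots> \<le> (\<integral>x. \<epsilon> * (indicator {a<..r} x * (\<bar>F x\<bar> / x)) \<partial>lborel)"
  proof (rule integral_mono_AE)
    show "integrable lborel (\<lambda>x. \<bar>?f x - \<alpha> * (indicator {a<..r} x * (F x / x))\<bar>)"
      using fi iF by (intro integrable_abs Bochner_Integration.integrable_diff integrable_mult_right) auto
    show "integrable lborel (\<lambda>x. \<epsilon> * (indicator {a<..r} x * (\<bar>F x\<bar> / x)))"
      using iaF by (rule integrable_mult_right)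
    have "AE x in lborel. 0 < x \<longrightarrow> x \<le> d \<longrightarrow> \<bar>x * (b x + b (- x)) - \<alpha>\<bar> \<le> \<epsilon>"
      using bd by (simp add: band_def)
    then show "AE x in lborel. \<bar>?f x - \<alpha> * (indicator {a<..r} x * (F x / x))\<bar>
        \<le> \<epsilon> * (indicator {a<..r} x * (\<bar>F x\<bar> / x))"
    proof eventually_elim
      case (elim x)
      show ?case
      proof (cases "a < x \<and> x \<le> r")
        case True
        then have x: "0 < x" "x \<le> d" using a by auto
        have "?f x - \<alpha> * (indicator {a<..r} x * (F x / x)) = (F x / x) * (x * (b x + b (- x)) - \<alpha>)"
          using True x by (simp add: even indicator_def field_simps)
        then have "\<bar>?f x - \<alpha> * (indicator {a<..r} x * (F x / x))\<bar>
            = \<bar>F x / x\<bar> * \<bar>x * (b x + b (- x)) - \<alpha>\<bar>" by (simp only: abs_mult)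
        also have "\<dots> \<le> \<bar>F x / x\<bar> * \<epsilon>" using elim x by (intro mult_left_mono) auto
        finally show ?thesis using True x by (simp add: abs_divide mult.commute)
      next
        case False
        then show ?thesis using a by (auto simp: indicator_def)
      qed
    qed
  qed
  also have "\<dots> = \<epsilon> * (LINT x:{a<..r}|lborel. \<bar>F x\<bar> / x)"
    by (simp only: set_lebesgue_integral_def real_scaleR_def integral_mult_right_zero)
  finally show ?thesis .
qed

definition small :: "real \<Rightarrow> real \<Rightarrow> real" where
  "small r x = b x * indicator {x. \<bar>x\<bar> \<le> r} x"

lemma measurable_small[measurable]: "small r \<in> borel_measurable borel"
  unfolding small_def[abs_def] by measurable

lemma small_nonneg: "0 \<le> small r x"
  using b_nonneg by (simp add: small_def)

lemma small_integrable: "integrable lborel (\<lambda>x. min 1 \<bar>x\<bar> * small r x)"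
  unfolding small_def by (rule integrable_min_abs_mult_indicator[OF _ _ b_integrable]) auto

lemma small_first_moment:
  assumes bd: "band \<epsilon> d" and r: "0 < r" "r \<le> d"
  shows "integrable lborel (\<lambda>x. \<bar>x\<bar> * small r x)"
    "(\<integral>x. \<bar>x\<bar> * small r x \<partial>lborel) \<le> (\<alpha> + \<epsilon>) * r"
proof -
  have e: "\<bar>x\<bar> * (b x * indicator {x. 0 < \<bar>x\<bar> \<and> \<bar>x\<bar> \<le> r} x) = \<bar>x\<bar> * small r x" for x
    by (cases "x = 0") (auto simp: small_def indicator_def)
  have r1: "r \<le> 1" using bd r by (simp add: band_def)
  show "integrable lborel (\<lambda>x. \<bar>x\<bar> * small r x)"
    using integrable_even_shell[of 0 r abs 1] r1 unfolding e by simp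
  have 1: "(LINT x:{0<..r}|lborel. \<bar>x\<bar> / x) = r" "(LINT x:{0<..r}|lborel. \<bar>\<bar>x\<bar>\<bar> / x) = r"
  proof -
    have "(LINT x:{0<..r}|lborel. \<bar>x\<bar> / x) = (LINT x:{0<..r}|lborel. 1)"
      by (rule set_lebesgue_integral_cong) auto
    also have "\<dots> = r" using r by (simp add: set_lebesgue_integral_def)
    finally show "(LINT x:{0<..r}|lborel. \<bar>x\<bar> / x) = r" "(LINT x:{0<..r}|lborel. \<bar>\<bar>x\<bar>\<bar> / x) = r" by auto
  qed
  have "\<bar>(\<integral>x. \<bar>x\<bar> * small r x \<partial>lborel) - \<alpha> * r\<bar> \<le> \<epsilon> * r"
    using even_shell_integral[OF bd, of 0 r abs 1] r unfolding e 1 by simp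
  then show "(\<integral>x. \<bar>x\<bar> * small r x \<partial>lborel) \<le> (\<alpha> + \<epsilon>) * r"
    by (simp add: distrib_right)
qed

lemma Re_levy_exp_small:
  assumes bd: "band \<epsilon> d" and r: "0 < r" "r \<le> d" and u: "0 < u"
  shows "(\<alpha> - \<epsilon>) * cin u r \<le> - Re (levy_exp (small r) u)"
    "- Re (levy_exp (small r) u) \<le> (\<alpha> + \<epsilon>) * cin u r"
proof -
  have e: "(1 - cos (u * x)) * (b x * indicator {x. 0 < \<bar>x\<bar> \<and> \<bar>x\<bar> \<le> r} x)
      = (1 - cos (u * x)) * small r x" for x
    by (cases "x = 0") (auto simp: small_def indicator_def)
  have C: "\<bar>1 - cos (u * x)\<bar> \<le> u * x" if "0 < x" for x
  proof -
    have "1 - cos (u * x) \<le> norm (iexp (u * x) - 1)"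
      using abs_Re_le_cmod[of "iexp (u * x) - 1"] by (simp add: Re_exp)
    also have "\<dots> \<le> \<bar>u * x\<bar>" using iexp_approx1[of "u * x" 0] by simp
    finally show ?thesis using that u by simp
  qed
  have "\<bar>(\<integral>x. (1 - cos (u * x)) * small r x \<partial>lborel) - \<alpha> * cin u r\<bar>
      \<le> \<epsilon> * (LINT x:{0<..r}|lborel. \<bar>1 - cos (u * x)\<bar> / x)"
    using even_shell_integral[OF bd, of 0 r "\<lambda>x. 1 - cos (u * x)" u] r C
    unfolding e by (simp add: cin_def)
  moreover have "\<bar>1 - cos (u * x)\<bar> = 1 - cos (u * x)" for x by simp
  ultimately have "\<bar>(\<integral>x. (1 - cos (u * x)) * small r x \<partial>lborel) - \<alpha> * cin u r\<bar> \<le> \<epsilon> * cin u r"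
    by (simp add: cin_def)
  then show "(\<alpha> - \<epsilon>) * cin u r \<le> - Re (levy_exp (small r) u)"
    "- Re (levy_exp (small r) u) \<le> (\<alpha> + \<epsilon>) * cin u r"
    by (simp_all add: Re_levy_exp(2)[OF measurable_small small_integrable] abs_le_iff left_diff_distrib distrib_right)
qed

lemma integrable_away:
  assumes r: "0 < r" and [measurable]: "A \<in> sets borel" and A: "\<And>x. x \<in> A \<Longrightarrow> r < \<bar>x\<bar>"
  shows "integrable lborel (\<lambda>x. b x * indicator A x)"
proof (rule Bochner_Integration.integrable_bound[OF integrable_mult_right[OF b_integrable, of "1 / min 1 r"]])
  show "AE x in lborel. norm (b x * indicator A x) \<le> norm (1 / min 1 r * (min 1 \<bar>x\<bar> * b x))"
  proof (rule AE_I2)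
    fix x
    show "norm (b x * indicator A x) \<le> norm (1 / min 1 r * (min 1 \<bar>x\<bar> * b x))"
    proof (cases "x \<in> A")
      case True
      then have "min 1 r \<le> min 1 \<bar>x\<bar>" using A[of x] by auto
      then have "1 \<le> min 1 \<bar>x\<bar> / min 1 r" using r by simp
      from mult_right_mono[OF this b_nonneg[of x]] show ?thesis
        using True b_nonneg[of x] r by (simp add: abs_mult)
    qed simp
  qed
qed measurable

lemma shell_mass:
  assumes bd: "band \<epsilon> d" and r: "0 < r" "r \<le> d"
  shows "\<bar>(\<integral>x. b x * indicator {x. r < \<bar>x\<bar> \<and> \<bar>x\<bar> \<le> d} x \<partial>lborel) - \<alpha> * ln (d / r)\<bar> \<le> \<epsilon> * ln (d / r)"
proof -
  have "\<bar>1\<bar> \<le> 1 / r * x" if "r < x" for x using that r by (simp add: field_simps)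
  then show ?thesis
    using even_shell_integral[OF bd, of r d "\<lambda>_. 1" "1 / r"] r set_integral_inverse_Ioc[of r d] by simp
qed

text \<open>The part \<open>\<alpha> / x\<close> of the density contributes only a bounded amount when \<open>u * r \<ge> 1\<close>, because the cosine
  oscillates; the deviation of size \<open>\<epsilon> / x\<close> need not cancel in this way and costs the logarithm.\<close>

lemma shell_cos:
  assumes bd: "band \<epsilon> d" and r: "0 < r" "r \<le> d" and u: "0 < u"
  shows "(\<integral>x. cos (u * x) * (b x * indicator {x. r < \<bar>x\<bar> \<and> \<bar>x\<bar> \<le> d} x) \<partial>lborel)
    \<le> \<alpha> * (max 0 (- ln (u * r)) + 6) + \<epsilon> * ln (d / r)"
proof -
  have e: "0 < \<epsilon>" using bd by (simp add: band_def)
  have C: "\<bar>cos (u * x)\<bar> \<le> 1 / r * x" if "r < x" for x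
  proof -
    have "1 \<le> 1 / r * x" using that r by (simp add: field_simps)
    then show ?thesis using abs_cos_le_one[of "u * x"] by linarith
  qed
  note ci = set_integral_cos_over_le[OF u r]
  have "(LINT x:{r<..d}|lborel. \<bar>cos (u * x)\<bar> / x) \<le> (LINT x:{r<..d}|lborel. 1 / x)"
  proof (rule set_integral_mono[OF _ set_integral_inverse_Ioc(1)[OF r]])
    have "set_integrable lborel {r<..d} (\<lambda>x. \<bar>cos (u * x) / x\<bar>)"
      using ci(1) by (rule set_integrable_abs)
    moreover have "set_integrable lborel {r<..d} (\<lambda>x. \<bar>cos (u * x) / x\<bar>)
        = set_integrable lborel {r<..d} (\<lambda>x. \<bar>cos (u * x)\<bar> / x)"
      by (rule set_integrable_cong) (use r in auto)
    ultimately show "set_integrable lborel {r<..d} (\<lambda>x. \<bar>cos (u * x)\<bar> / x)" by simp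
  qed (use r in \<open>auto intro!: divide_right_mono\<close>)
  also have "\<dots> = ln (d / r)" by (rule set_integral_inverse_Ioc(2)[OF r])
  finally have "\<epsilon> * (LINT x:{r<..d}|lborel. \<bar>cos (u * x)\<bar> / x) \<le> \<epsilon> * ln (d / r)"
    using e by (intro mult_left_mono) auto
  moreover have "\<alpha> * (LINT x:{r<..d}|lborel. cos (u * x) / x) \<le> \<alpha> * (max 0 (- ln (u * r)) + 6)"
    using ci(2) \<alpha>_pos by (intro mult_left_mono) auto
  ultimately show ?thesis
    using even_shell_integral[OF bd, of r d "\<lambda>x. cos (u * x)" "1 / r"] r C by simp
qed

text \<open>Non-negativity bounds \<open>b x\<close> by \<open>b x + b (- x)\<close>, although the two sides may be distributed unevenly.\<close>

lemma AE_shell_bound: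
  assumes bd: "band \<epsilon> d" and r: "0 < r"
  shows "AE x in lborel. r < \<bar>x\<bar> \<and> \<bar>x\<bar> \<le> d \<longrightarrow> b x \<le> (\<alpha> + \<epsilon>) / r"
proof -
  have A: "AE x in lborel. 0 < x \<longrightarrow> x \<le> d \<longrightarrow> \<bar>x * (b x + b (- x)) - \<alpha>\<bar> \<le> \<epsilon>"
    using bd by (simp add: band_def)
  have key: "b x \<le> (\<alpha> + \<epsilon>) / r \<and> b (- x) \<le> (\<alpha> + \<epsilon>) / r"
    if "r < x" "\<bar>x * (b x + b (- x)) - \<alpha>\<bar> \<le> \<epsilon>" for x
  proof -
    have "r * (b x + b (- x)) \<le> x * (b x + b (- x))"
      using that b_nonneg by (intro mult_right_mono add_nonneg_nonneg) auto
    also have "\<dots> \<le> \<alpha> + \<epsilon>" using that by linarith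
    finally have "b x + b (- x) \<le> (\<alpha> + \<epsilon>) / r" using r by (simp add: field_simps)
    then show ?thesis using b_nonneg[of x] b_nonneg[of "- x"] by simp
  qed
  from A AE_reflect[OF A] show ?thesis
  proof eventually_elim
    case (elim x)
    show ?case
    proof (intro impI)
      assume x: "r < \<bar>x\<bar> \<and> \<bar>x\<bar> \<le> d"
      show "b x \<le> (\<alpha> + \<epsilon>) / r"
        using key[of x] key[of "- x"] elim x r by (cases "0 \<le> x") auto
    qed
  qed
qed

text \<open>The jumps larger than \<open>d\<close> can only decrease the modulus, and those up to \<open>d\<close> are estimated by \<open>cin\<close>.\<close>

lemma norm_exp_levy_exp_le:
  assumes bd: "band \<epsilon> d" and ea: "\<epsilon> \<le> \<alpha>" and u: "u \<noteq> 0"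
  shows "norm (exp (levy_exp b u)) \<le> exp (- ((\<alpha> - \<epsilon>) * (ln (\<bar>u\<bar> * d) - 2)))"
proof -
  have d: "0 < d" "d \<le> d" using bd by (auto simp: band_def)
  have u': "0 < \<bar>u\<bar>" using u by simp
  have c: "cos (u * x) = cos (\<bar>u\<bar> * x)" for x by (cases "0 \<le> u") auto
  note R = Re_levy_exp[OF b_measurable b_integrable, of "\<bar>u\<bar>"]
  note Rs = Re_levy_exp[OF measurable_small[of d] small_integrable[of d], of "\<bar>u\<bar>"]
  have "(\<integral>x. (1 - cos (\<bar>u\<bar> * x)) * small d x \<partial>lborel) \<le> (\<integral>x. (1 - cos (\<bar>u\<bar> * x)) * b x \<partial>lborel)"
    by (rule integral_mono[OF Rs(1) R(1)]) (use b_nonneg in \<open>auto simp: small_def indicator_def intro!: mult_nonneg_nonneg\<close>)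
  moreover have "Re (levy_exp b u) = - (\<integral>x. (1 - cos (\<bar>u\<bar> * x)) * b x \<partial>lborel)"
    using Re_levy_exp(2)[OF b_measurable b_integrable, of u] unfolding c .
  ultimately have "Re (levy_exp b u) \<le> Re (levy_exp (small d) \<bar>u\<bar>)"
    using Rs(2) by simp
  also have "\<dots> \<le> - ((\<alpha> - \<epsilon>) * cin \<bar>u\<bar> d)"
    using Re_levy_exp_small(1)[OF bd d u'] by simp
  also have "\<dots> \<le> - ((\<alpha> - \<epsilon>) * (ln (\<bar>u\<bar> * d) - 2))"
    using cin_bounds(1)[OF u' d(1)] ea by (intro le_imp_neg_le mult_left_mono) auto
  finally show ?thesis by simp
qed

end

section \<open>Mean squares of Fourier transforms and integrable decay\<close>

lemma measurable_fourier[measurable]: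
  assumes [measurable]: "c \<in> borel_measurable borel"
  shows "fourier c \<in> borel_measurable borel"
  unfolding fourier_def[abs_def] by measurable

lemma measurable_levy_exp[measurable]:
  assumes [measurable]: "c \<in> borel_measurable borel"
  shows "levy_exp c \<in> borel_measurable borel"
  unfolding levy_exp_def[abs_def] by measurable

text \<open>A weighted form of the Plancherel inequality. With \<open>c\<close> normalised to a probability density, the squared modulus
  of its Fourier transform is the characteristic function of a difference of two independent copies. So the
  integral is the expectation of a Gaussian function of width \<open>h\<close>, which a bounded density makes of order
  \<open>h\<close>.\<close>

lemma gaussian_fourier_L2:
  fixes c :: "real \<Rightarrow> real"
  assumes c: "integrable lborel c" and nn: "\<And>x. 0 \<le> c x" and B: "AE x in lborel. c x \<le> B" "0 \<le> B"
    and h: "0 < h"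
  shows "integrable lborel (\<lambda>v. exp (- v\<^sup>2 / 2) * (norm (fourier c (v / h)))\<^sup>2)"
    "(LINT v|lborel. exp (- v\<^sup>2 / 2) * (norm (fourier c (v / h)))\<^sup>2)
      \<le> 2 * pi * (\<integral>x. c x \<partial>lborel) * B * h"
proof -
  define l where "l = (\<integral>x. c x \<partial>lborel)"
  have cm[measurable]: "c \<in> borel_measurable borel" using c by auto
  have l0: "0 \<le> l" unfolding l_def using nn by simp
  have le: "norm (fourier c u) \<le> l" for u
    unfolding l_def by (rule norm_fourier_le[OF c nn])
  show i: "integrable lborel (\<lambda>v. exp (- v\<^sup>2 / 2) * (norm (fourier c (v / h)))\<^sup>2)"
  proof (rule Bochner_Integration.integrable_bound[OF integrable_mult_left[OF integrable_gaussian, of "l\<^sup>2"]])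
    show "AE v in lborel. norm (exp (- v\<^sup>2 / 2) * (norm (fourier c (v / h)))\<^sup>2) \<le> norm (exp (- v\<^sup>2 / 2) * l\<^sup>2)"
      using le by (auto intro!: AE_I2 power_mono simp: abs_mult)
  qed measurable
  show "(LINT v|lborel. exp (- v\<^sup>2 / 2) * (norm (fourier c (v / h)))\<^sup>2)
      \<le> 2 * pi * (\<integral>x. c x \<partial>lborel) * B * h"
  proof (cases "l = 0")
    case True
    then have "fourier c u = 0" for u using le[of u] by simp
    then show ?thesis using True by (simp add: l_def)
  next
    case False
    with l0 have l: "0 < l" by simp
    define P where "P = density lborel (\<lambda>x. ennreal (c x / l))"
    have "(\<integral>\<^sup>+x. ennreal (c x / l) \<partial>lborel) = ennreal (\<integral>x. c x / l \<partial>lborel)"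
      using c nn l by (intro nn_integral_eq_integral) auto
    also have "(\<integral>x. c x / l \<partial>lborel) = 1" using l by (simp add: l_def)
    finally have "prob_space P"
      unfolding P_def by (intro prob_spaceI) (simp add: emeasure_density)
    then have P: "real_distribution P"
      by (simp add: real_distribution_def real_distribution_axioms_def P_def)
    have char_P: "fourier c u = of_real l * char P u" for u
      unfolding char_def P_def fourier_def using nn l
      by (subst integral_density) (auto simp: scaleR_conv_of_real)
    let ?P' = "distr P borel (\<lambda>z. - 0 - z)"
    note P' = char_reflect_shift[OF P, of 0]
    define R where "R = (?P' \<star> P)"
    have R: "real_distribution R" unfolding R_def by (rule real_distribution_convolution[OF P'(1) P])
    interpret P: real_distribution P by (rule P)
    have cR: "char R t = of_real ((norm (char P t))\<^sup>2)" for t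
      unfolding R_def char_convolution[OF P'(1) P] P'(2)
      using complex_norm_square[of "char P t"] by (simp add: mult.commute)
    have "complex_of_real (LINT v|lborel. exp (- v\<^sup>2 / 2) * (norm (fourier c (v / h)))\<^sup>2)
        = (CLINT v|lborel. of_real (exp (- v\<^sup>2 / 2) * (norm (fourier c (v / h)))\<^sup>2))"
      by (rule integral_complex_of_real[symmetric])
    also have "\<dots> = (CLINT v|lborel. of_real (l\<^sup>2) * (of_real (exp (- v\<^sup>2 / 2)) * (of_real ((2 - 2 * cos v) ^ 0) * char R (v * (1 / h)))))"
      using l by (intro Bochner_Integration.integral_cong refl)
        (simp add: cR char_P norm_mult power_mult_distrib mult_ac)
    also have "\<dots> = of_real (l\<^sup>2) * of_real (\<integral>y. gauss_sdiff 0 (1 / h * y) \<partial>R)"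
      by (simp only: integral_mult_right_zero integral_versine_char[OF R])
    finally have 1: "(LINT v|lborel. exp (- v\<^sup>2 / 2) * (norm (fourier c (v / h)))\<^sup>2)
        = l\<^sup>2 * (\<integral>y. gauss_sdiff 0 (1 / h * y) \<partial>R)"
      by (simp only: of_real_mult[symmetric] of_real_eq_iff)
    have b: "\<bar>gauss_sdiff 0 y\<bar> \<le> sqrt (2 * pi)" for y using abs_gauss_sdiff_le[of 0 y] by simp
    have G0: "0 \<le> gauss_sdiff 0 y" for y by (simp add: gauss_sdiff_0)
    have "(\<integral>y. gauss_sdiff 0 (1 / h * y) \<partial>R)
        = (\<integral>q. (\<integral>x. gauss_sdiff 0 (1 / h * (q + x)) \<partial>P) \<partial>?P')"
      unfolding R_def by (rule integral_convolution[OF P'(1) P, of _ "sqrt (2 * pi)"]) (use b in auto)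
    also have "\<dots> = (\<integral>z. (\<integral>x. gauss_sdiff 0 (1 / h * (- 0 - z + x)) \<partial>P) \<partial>P)"
      by (rule integral_distr) auto
    also have "\<dots> \<le> (\<integral>z. 2 * pi * B * h / l \<partial>P)"
    proof (rule integral_mono)
      have inner: "(\<integral>x. gauss_sdiff 0 (1 / h * (- 0 - z + x)) \<partial>P) \<le> 2 * pi * B * h / l" for z
      proof -
        note G = integral_scaled_gaussian[OF h, of z]
        have "(\<integral>x. gauss_sdiff 0 (1 / h * (- 0 - z + x)) \<partial>P)
            = (\<integral>x. c x / l * gauss_sdiff 0 ((x - z) / h) \<partial>lborel)"
          unfolding P_def using nn l by (subst integral_density) auto
        also have "\<dots> \<le> (\<integral>x. B / l * gauss_sdiff 0 ((x - z) / h) \<partial>lborel)"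
        proof (rule integral_mono_AE)
          show "integrable lborel (\<lambda>x. c x / l * gauss_sdiff 0 ((x - z) / h))"
            by (rule integrable_mult_bounded[OF _ _ b]) (use c in auto)
          show "integrable lborel (\<lambda>x. B / l * gauss_sdiff 0 ((x - z) / h))"
            by (rule integrable_mult_right[OF G(1)])
          show "AE x in lborel. c x / l * gauss_sdiff 0 ((x - z) / h) \<le> B / l * gauss_sdiff 0 ((x - z) / h)"
            using B(1) by eventually_elim (use l G0 in \<open>auto intro!: mult_right_mono divide_right_mono\<close>)
        qed
        also have "\<dots> = 2 * pi * B * h / l" using G(2) by simp
        finally show ?thesis .
      qed
      show "(\<integral>x. gauss_sdiff 0 (1 / h * (- 0 - z + x)) \<partial>P) \<le> 2 * pi * B * h / l" for z
        by (rule inner)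
      show "integrable P (\<lambda>z. \<integral>x. gauss_sdiff 0 (1 / h * (- 0 - z + x)) \<partial>P)"
      proof (rule P.integrable_const_bound[where B="2 * pi * B * h / l"])
        show "AE z in P. norm (\<integral>x. gauss_sdiff 0 (1 / h * (- 0 - z + x)) \<partial>P) \<le> 2 * pi * B * h / l"
        proof (rule AE_I2)
          fix z
          have "0 \<le> (\<integral>x. gauss_sdiff 0 (1 / h * (- 0 - z + x)) \<partial>P)"
            by (rule integral_nonneg_AE) (simp add: G0)
          then show "norm (\<integral>x. gauss_sdiff 0 (1 / h * (- 0 - z + x)) \<partial>P) \<le> 2 * pi * B * h / l"
            using inner[of z] by simp
        qed
      qed measurable
    qed simp
    also have "\<dots> = 2 * pi * B * h / l" using P.prob_space by simp
    finally have "l\<^sup>2 * (\<integral>y. gauss_sdiff 0 (1 / h * y) \<partial>R) \<le> l\<^sup>2 * (2 * pi * B * h / l)"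
      by (rule mult_left_mono) simp
    also have "\<dots> = 2 * pi * l * B * h" using l by (simp add: power2_eq_square)
    finally show ?thesis unfolding 1 by (simp add: l_def)
  qed
qed

text \<open>The bound involves \<open>exp (Re z)\<close> rather than \<open>exp (norm z)\<close>: the real part of the transform of the large jumps stays
  almost bounded, whereas its modulus may be of the order of their mass, which is logarithmically large.\<close>

lemma norm_exp_minus_1_le: "norm (exp z - 1) \<le> norm z * max 1 (exp (Re z))" for z :: complex
proof -
  have "norm (exp z - exp 0) \<le> max 1 (exp (Re z)) * norm (z - 0)"
  proof (rule field_differentiable_bound[of "closed_segment 0 z"])
    fix w assume "w \<in> closed_segment 0 z"
    then obtain t where t: "0 \<le> t" "t \<le> 1" "w = t *\<^sub>R z" by (auto simp: closed_segment_def)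
    have "t * Re z \<le> max 0 (Re z)"
      using t mult_left_le_one_le[of "Re z" t] by (cases "0 \<le> Re z") (auto simp: max_def mult_nonneg_nonpos)
    then have "exp (Re w) \<le> exp (max 0 (Re z))" using t by simp
    also have "\<dots> = max 1 (exp (Re z))" by (simp add: max_def)
    finally show "norm (exp w) \<le> max 1 (exp (Re z))" by simp
    show "(exp has_field_derivative exp w) (at w within closed_segment 0 z)"
      by (rule DERIV_exp[THEN has_field_derivative_at_within])
  qed auto
  then show ?thesis by (simp add: mult.commute)
qed

lemma versine_bounds: "0 \<le> 2 - 2 * cos v" "2 - 2 * cos v \<le> v\<^sup>2" for v :: real
proof -
  show "0 \<le> 2 - 2 * cos v" using cos_le_one[of v] by linarith
  have "1 - cos v = 2 * (sin (v / 2))\<^sup>2" using cos_double_sin[of "v / 2"] by simp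
  moreover have "(sin (v / 2))\<^sup>2 \<le> (v / 2)\<^sup>2"
    using abs_sin_x_le_abs_x[of "v / 2"] by (simp only: abs_le_square_iff)
  ultimately show "2 - 2 * cos v \<le> v\<^sup>2" by (simp add: power_divide)
qed

lemma integrable_even_power_decay:
  fixes \<phi> :: "real \<Rightarrow> complex"
  assumes [measurable]: "\<phi> \<in> borel_measurable borel" and b1: "\<And>u. norm (\<phi> u) \<le> 1"
    and b2: "\<And>u. u \<noteq> 0 \<Longrightarrow> norm (\<phi> u) \<le> C * \<bar>u\<bar> powr (- p)" and p: "real i + 1 < p"
  shows "integrable lborel (\<lambda>u. \<bar>u\<bar> ^ i * norm (\<phi> u))"
proof -
  define q where "q = p - real i"
  have q: "1 < q" using p by (simp add: q_def)
  let ?t = "\<lambda>x::real. x powr (- q) * indicator {1..} x"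
  have nn: "(\<integral>\<^sup>+x. ennreal (x powr (- q)) * indicator {1..} x \<partial>lborel)
      = ennreal (0 - 1 powr (1 - q) / (1 - q))"
  proof (rule nn_integral_FTC_atLeast[where F="\<lambda>x. x powr (1 - q) / (1 - q)"])
    show "((\<lambda>x. x powr (1 - q) / (1 - q)) has_real_derivative x powr (- q)) (at x)" if "1 \<le> x" for x
    proof -
      have "((\<lambda>x. x powr (1 - q)) has_real_derivative (1 - q) * x powr (1 - q - 1)) (at x)"
        using that by (intro has_real_derivative_powr) auto
      from DERIV_cdivide[OF this, of "1 - q"] show ?thesis using q by simp
    qed
    have "((\<lambda>x. x powr (- (q - 1))) \<longlongrightarrow> 0) at_top"
      using q by (intro tendsto_neg_powr filterlim_ident) auto
    then have "((\<lambda>x. x powr (1 - q) / (1 - q)) \<longlongrightarrow> 0 / (1 - q)) at_top"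
      using q by (intro tendsto_divide tendsto_const) auto
    then show "((\<lambda>x. x powr (1 - q) / (1 - q)) \<longlongrightarrow> 0) at_top" by simp
  qed auto
  have ti: "integrable lborel ?t"
  proof (rule integrableI_nonneg)
    have "(\<integral>\<^sup>+x. ennreal (?t x) \<partial>lborel) = (\<integral>\<^sup>+x. ennreal (x powr (- q)) * indicator {1..} x \<partial>lborel)"
      by (intro nn_integral_cong) (simp add: indicator_def)
    then show "(\<integral>\<^sup>+x. ennreal (?t x) \<partial>lborel) < \<infinity>" unfolding nn by simp
  qed (auto simp: indicator_def)
  have t2: "integrable lborel (\<lambda>x. ?t (- x))" using integrable_reflect[OF ti] .
  let ?w = "\<lambda>x. indicator {-1..1} x + (\<bar>C\<bar> * ?t x + \<bar>C\<bar> * ?t (- x))"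
  have wi: "integrable lborel ?w"
    using ti t2 by (intro Bochner_Integration.integrable_add integrable_mult_right) auto
  show ?thesis
  proof (rule Bochner_Integration.integrable_bound[OF wi])
    show "AE u in lborel. norm (\<bar>u\<bar> ^ i * norm (\<phi> u)) \<le> norm (?w u)"
    proof (rule AE_I2)
      fix u :: real
      have w0: "0 \<le> \<bar>C\<bar> * ?t u" "0 \<le> \<bar>C\<bar> * ?t (- u)" by (auto simp: indicator_def)
      have "\<bar>u\<bar> ^ i * norm (\<phi> u) \<le> ?w u"
      proof (cases "\<bar>u\<bar> \<le> 1")
        case True
        then have "\<bar>u\<bar> ^ i * norm (\<phi> u) \<le> 1"
          using b1[of u] by (intro mult_le_one power_le_one) auto
        also have "1 \<le> ?w u" using True w0 by (simp add: abs_le_iff)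
        finally show ?thesis .
      next
        case False
        then have u: "u \<noteq> 0" "1 \<le> \<bar>u\<bar>" by auto
        have "\<bar>u\<bar> ^ i * norm (\<phi> u) \<le> \<bar>u\<bar> ^ i * (C * \<bar>u\<bar> powr (- p))"
          by (intro mult_left_mono b2 u) auto
        also have "\<dots> \<le> \<bar>u\<bar> ^ i * (\<bar>C\<bar> * \<bar>u\<bar> powr (- p))"
          by (intro mult_left_mono mult_right_mono) auto
        also have "\<dots> = \<bar>C\<bar> * \<bar>u\<bar> powr (- q)"
        proof -
          have "\<bar>u\<bar> ^ i = \<bar>u\<bar> powr real i" using u by (simp add: powr_realpow)
          then have "\<bar>u\<bar> ^ i * \<bar>u\<bar> powr (- p) = \<bar>u\<bar> powr (- q)"
            by (simp add: powr_add[symmetric] q_def)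
          then show ?thesis by (simp add: mult.left_commute)
        qed
        also have "\<dots> \<le> ?w u" using u w0 by (cases "0 \<le> u") (auto simp: indicator_def)
        finally show ?thesis .
      qed
      moreover have "0 \<le> \<bar>u\<bar> ^ i * norm (\<phi> u)" by simp
      ultimately show "norm (\<bar>u\<bar> ^ i * norm (\<phi> u)) \<le> norm (?w u)"
        unfolding real_norm_def by linarith
    qed
  qed measurable
qed

context jump_density
begin

section \<open>Null sets of the law\<close>

text \<open>For every \<open>r\<close> the law \<open>\<mu>\<close> has the compound Poisson law of the jumps larger than \<open>r\<close> as a convolution
  factor, so a null set has \<open>\<mu>\<close>-measure at most \<open>exp(-\<integral>b)\<close>, the integral being taken over \<open>\<bar>x\<bar> > r\<close>. This
  integral grows like \<open>\<alpha> ln(1/r)\<close>.\<close>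

lemma emeasure_null_of_jump_factor:
  assumes \<mu>: "real_distribution \<mu>" and G: "real_distribution G"
    and ch: "\<And>u. char \<mu> u = char G u * exp (levy_exp b u)"
    and bd: "band \<epsilon> d" and ea: "\<epsilon> < \<alpha>" and A: "A \<in> null_sets lborel"
  shows "emeasure \<mu> A = 0"
proof -
  interpret \<mu>: real_distribution \<mu> by (rule \<mu>)
  have d: "0 < d" "d \<le> 1" using bd by (auto simp: band_def)
  have Ab: "A \<in> sets borel" using A by auto
  have key: "measure \<mu> A \<le> exp (- ((\<alpha> - \<epsilon>) * t))" if t: "0 \<le> t" for t
  proof -
    define r where "r = d * exp (- t)"
    have r: "0 < r" "r \<le> d" using d t by (auto simp: r_def mult_left_le)
    have "d / r = exp t" using d by (simp add: r_def exp_minus divide_inverse)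
    then have lnr: "ln (d / r) = t" by simp
    let ?big = "\<lambda>x. b x * indicator {x. r < \<bar>x\<bar>} x"
    obtain Q where Q: "real_distribution Q"
      "\<And>u. char Q u = exp (levy_exp (small r) u)"
    proof (rule small_jump_law_exists[OF measurable_small small_nonneg small_first_moment(1)[OF bd r] r(1)])
      show "small r x = 0" if "r < \<bar>x\<bar>" for x using that by (simp add: small_def)
    qed blast
    have bi: "integrable lborel ?big" by (rule integrable_away[OF r(1)]) auto
    have bnn: "0 \<le> ?big x" for x using b_nonneg by simp
    obtain P where P: "real_distribution P"
      "\<And>u. char P u = exp (levy_exp ?big u)"
      "\<And>A. A \<in> null_sets lborel \<Longrightarrow> emeasure P A \<le> ennreal (exp (- (\<integral>x. ?big x \<partial>lborel)))"
      by (rule compound_poisson_exists[OF bi bnn]) blast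
    have GQ: "real_distribution (G \<star> Q)" by (rule real_distribution_convolution[OF G Q(1)])
    have lev: "levy_exp b u = levy_exp (small r) u + levy_exp ?big u" for u
      by (rule levy_exp_add[OF measurable_small small_integrable _ integrable_min_absI[OF bi]])
        (auto simp: small_def indicator_def)
    have eq: "\<mu> = ((G \<star> Q) \<star> P)"
    proof (rule Levy_uniqueness[OF \<mu> real_distribution_convolution[OF GQ P(1)]], rule ext)
      fix u
      show "char \<mu> u = char ((G \<star> Q) \<star> P) u"
        unfolding char_convolution[OF GQ P(1)] char_convolution[OF G Q(1)] ch lev exp_add
          Q(2) P(2) mult.assoc ..
    qed
    note D = real_distribution_facts[OF P(1)] real_distribution_facts[OF GQ]
    have "emeasure \<mu> A = (\<integral>\<^sup>+x. emeasure P {a. a + x \<in> A} \<partial>(G \<star> Q))"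
      unfolding eq by (rule convolution_emeasure) (use Ab D in auto)
    also have "\<dots> \<le> (\<integral>\<^sup>+x. ennreal (exp (- (\<integral>x. ?big x \<partial>lborel))) \<partial>(G \<star> Q))"
      by (intro nn_integral_mono P(3) null_sets_lborel_translate A)
    also have "\<dots> = ennreal (exp (- (\<integral>x. ?big x \<partial>lborel)))"
      using prob_space.emeasure_space_1[OF D(6)] by simp
    finally have "measure \<mu> A \<le> exp (- (\<integral>x. ?big x \<partial>lborel))"
      by (simp add: \<mu>.emeasure_eq_measure)
    moreover have "(\<alpha> - \<epsilon>) * t \<le> (\<integral>x. ?big x \<partial>lborel)"
    proof -
      let ?sh = "\<lambda>x. b x * indicator {x. r < \<bar>x\<bar> \<and> \<bar>x\<bar> \<le> d} x"
      have si: "integrable lborel ?sh" by (rule integrable_away[OF r(1)]) auto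
      have "(\<alpha> - \<epsilon>) * t \<le> (\<integral>x. ?sh x \<partial>lborel)"
        using shell_mass[OF bd r] unfolding lnr by (simp add: abs_le_iff left_diff_distrib)
      also have "\<dots> \<le> (\<integral>x. ?big x \<partial>lborel)"
        by (rule integral_mono[OF si bi]) (use b_nonneg in \<open>auto simp: indicator_def\<close>)
      finally show ?thesis .
    qed
    ultimately show ?thesis by (meson exp_le_cancel_iff neg_le_iff_le order_trans)
  qed
  have "measure \<mu> A = 0"
  proof (rule ccontr)
    assume "measure \<mu> A \<noteq> 0"
    then have m: "0 < measure \<mu> A" using measure_nonneg[of \<mu> A] by linarith
    define x where "x = 1 / measure \<mu> A"
    have x: "0 < x" using m by (simp add: x_def)
    have "measure \<mu> A \<le> exp (- x)"
      using key[of "x / (\<alpha> - \<epsilon>)"] x ea by simp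
    then have "measure \<mu> A * exp x \<le> exp (- x) * exp x" by (rule mult_right_mono) simp
    then have "measure \<mu> A * exp x \<le> 1" by (simp add: exp_add[symmetric])
    moreover have "measure \<mu> A * (1 + x) \<le> measure \<mu> A * exp x"
      using m by (intro mult_left_mono exp_ge_add_one_self) auto
    moreover have "measure \<mu> A * (1 + x) = measure \<mu> A + 1" using m by (simp add: x_def distrib_left)
    ultimately show False using m by linarith
  qed
  then show ?thesis by (simp add: \<mu>.emeasure_eq_measure)
qed

section \<open>The tested modulus of the characteristic function\<close>

lemma Re_levy_exp_abs: "Re (levy_exp (small r) \<bar>u\<bar>) = Re (levy_exp (small r) u)"
proof -
  have c: "cos (\<bar>u\<bar> * x) = cos (u * x)" for x by (cases "0 \<le> u") auto
  show ?thesis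
    unfolding Re_levy_exp(2)[OF measurable_small small_integrable] c ..
qed

text \<open>Both exponentials are controlled by the same logarithm \<open>L = ln (\<bar>v / h\<bar> * \<rho>)\<close>: where \<open>L \<ge> 0\<close> the small jumps give decay, where
  \<open>L < 0\<close> the large ones may give growth, and \<open>- 2 * (\<alpha> - \<epsilon>) * L\<close> dominates in both cases. The zero of order
  \<open>2 * M\<close> of the versine factor compensates the resulting singularity at \<open>v = 0\<close>.\<close>

lemma versine_weight_le:
  assumes bd: "band \<epsilon> d" and ea: "2 * \<epsilon> \<le> \<alpha>" and M: "\<alpha> \<le> real M"
    and h: "0 < h" and \<rho>: "0 < \<rho>" "\<rho> \<le> d" and v: "v \<noteq> 0" and \<Lambda>: "0 \<le> \<Lambda>"
    and r: "r \<le> \<alpha> * (max 0 (- ln (\<bar>v / h\<bar> * \<rho>)) + 6) + \<epsilon> * ln (d / \<rho>) + \<Lambda>"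
  shows "(2 - 2 * cos v) ^ M * exp (2 * Re (levy_exp (small \<rho>) (v / h))) * max 1 (exp r)
    \<le> exp (10 * \<alpha> + \<Lambda>) * \<rho> powr (- \<epsilon>) * (\<rho> / h) powr (- 2 * (\<alpha> - \<epsilon>)) * (1 + v ^ (2 * M))"
proof -
  have e: "0 < \<epsilon>" and d: "0 < d" "d \<le> 1" using bd by (auto simp: band_def)
  define L where "L = ln (\<bar>v / h\<bar> * \<rho>)"
  have u: "0 < \<bar>v / h\<bar>" using v h by simp
  have L: "L = ln \<bar>v\<bar> + ln (\<rho> / h)"
    using v h \<rho> by (simp add: L_def abs_divide ln_mult ln_div)
  have "2 * Re (levy_exp (small \<rho>) (v / h)) \<le> - 2 * ((\<alpha> - \<epsilon>) * cin \<bar>v / h\<bar> \<rho>)"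
    using Re_levy_exp_small(1)[OF bd \<rho> u] by (simp only: Re_levy_exp_abs)
  also have "\<dots> \<le> - 2 * ((\<alpha> - \<epsilon>) * (max 0 L - 2))"
    using mult_left_mono[OF cin_bounds(1)[OF u \<rho>(1)], of "\<alpha> - \<epsilon>"] ea e by (simp add: L_def)
  finally have A: "2 * Re (levy_exp (small \<rho>) (v / h)) \<le> 4 * (\<alpha> - \<epsilon>) - 2 * (\<alpha> - \<epsilon>) * max 0 L"
    by (simp add: algebra_simps)
  have lnd: "0 \<le> ln (d / \<rho>)" "ln (d / \<rho>) \<le> - ln \<rho>" using d \<rho> by (auto simp: ln_div)
  have "max 0 r \<le> \<alpha> * max 0 (- L) + 6 * \<alpha> + \<epsilon> * ln (d / \<rho>) + \<Lambda>"
  proof -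
    have "0 \<le> \<alpha> * max 0 (- L) + 6 * \<alpha> + \<epsilon> * ln (d / \<rho>) + \<Lambda>"
      using \<alpha>_pos e lnd \<Lambda> by (intro add_nonneg_nonneg mult_nonneg_nonneg) auto
    moreover have "r \<le> \<alpha> * max 0 (- L) + 6 * \<alpha> + \<epsilon> * ln (d / \<rho>) + \<Lambda>"
      using r unfolding L_def[symmetric] distrib_left by simp
    ultimately show ?thesis by (rule max.boundedI)
  qed
  moreover have "\<epsilon> * ln (d / \<rho>) \<le> \<epsilon> * - ln \<rho>" using lnd e by (intro mult_left_mono) auto
  ultimately have R: "max 0 r \<le> \<alpha> * max 0 (- L) + 6 * \<alpha> - \<epsilon> * ln \<rho> + \<Lambda>" by simp
  have Lc: "- 2 * (\<alpha> - \<epsilon>) * max 0 L + \<alpha> * max 0 (- L) \<le> - 2 * (\<alpha> - \<epsilon>) * L"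
  proof (cases "0 \<le> L")
    case False
    then have "\<alpha> * (- L) \<le> (2 * (\<alpha> - \<epsilon>)) * (- L)" using ea by (intro mult_right_mono) auto
    then show ?thesis using False by (simp add: algebra_simps)
  qed simp
  have sum: "2 * Re (levy_exp (small \<rho>) (v / h)) + max 0 r
      \<le> (10 * \<alpha> + \<Lambda>) - \<epsilon> * ln \<rho> - 2 * (\<alpha> - \<epsilon>) * ln (\<rho> / h) - 2 * (\<alpha> - \<epsilon>) * ln \<bar>v\<bar>"
    using A R Lc e unfolding L by (simp add: algebra_simps)
  have "exp (2 * Re (levy_exp (small \<rho>) (v / h))) * max 1 (exp r)
      = exp (2 * Re (levy_exp (small \<rho>) (v / h)) + max 0 r)"
    by (simp add: exp_add max_def)
  also have "\<dots> \<le> exp ((10 * \<alpha> + \<Lambda>) - \<epsilon> * ln \<rho> - 2 * (\<alpha> - \<epsilon>) * ln (\<rho> / h) - 2 * (\<alpha> - \<epsilon>) * ln \<bar>v\<bar>)"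
    using sum by simp
  also have "\<dots> = exp (10 * \<alpha> + \<Lambda>) * \<rho> powr (- \<epsilon>) * (\<rho> / h) powr (- 2 * (\<alpha> - \<epsilon>)) * exp (- 2 * (\<alpha> - \<epsilon>) * ln \<bar>v\<bar>)"
    using \<rho> h by (simp add: powr_def exp_add[symmetric] exp_diff[symmetric] algebra_simps)
  finally have 1: "exp (2 * Re (levy_exp (small \<rho>) (v / h))) * max 1 (exp r)
      \<le> exp (10 * \<alpha> + \<Lambda>) * \<rho> powr (- \<epsilon>) * (\<rho> / h) powr (- 2 * (\<alpha> - \<epsilon>)) * exp (- 2 * (\<alpha> - \<epsilon>) * ln \<bar>v\<bar>)" .
  have vp: "v ^ (2 * M) = exp (2 * real M * ln \<bar>v\<bar>)"
  proof -
    have "v ^ (2 * M) = \<bar>v\<bar> ^ (2 * M)" by (simp add: power_mult)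
    also have "\<dots> = \<bar>v\<bar> powr real (2 * M)" by (rule powr_realpow[symmetric]) (use v in simp)
    finally show ?thesis using v by (simp add: powr_def)
  qed
  have S: "(2 - 2 * cos v) ^ M \<le> v ^ (2 * M)"
    unfolding power_mult by (rule power_mono) (use versine_bounds in auto)
  have "v ^ (2 * M) * exp (- 2 * (\<alpha> - \<epsilon>) * ln \<bar>v\<bar>) = exp ((2 * real M - 2 * (\<alpha> - \<epsilon>)) * ln \<bar>v\<bar>)"
    unfolding vp by (simp add: exp_add[symmetric] algebra_simps)
  also have "\<dots> \<le> 1 + v ^ (2 * M)"
  proof (cases "0 \<le> ln \<bar>v\<bar>")
    case True
    have "(2 * real M - 2 * (\<alpha> - \<epsilon>)) * ln \<bar>v\<bar> \<le> 2 * real M * ln \<bar>v\<bar>"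
      using True ea e by (intro mult_right_mono) auto
    then show ?thesis unfolding vp by (simp add: add_increasing)
  next
    case False
    have "(2 * real M - 2 * (\<alpha> - \<epsilon>)) * ln \<bar>v\<bar> \<le> 0"
      using False M e by (intro mult_nonneg_nonpos) auto
    then show ?thesis unfolding vp by (simp add: add_increasing2)
  qed
  finally have 2: "v ^ (2 * M) * exp (- 2 * (\<alpha> - \<epsilon>) * ln \<bar>v\<bar>) \<le> 1 + v ^ (2 * M)" .
  let ?D = "exp (10 * \<alpha> + \<Lambda>) * \<rho> powr (- \<epsilon>) * (\<rho> / h) powr (- 2 * (\<alpha> - \<epsilon>))"
  have "(2 - 2 * cos v) ^ M * (exp (2 * Re (levy_exp (small \<rho>) (v / h))) * max 1 (exp r))
      \<le> v ^ (2 * M) * (?D * exp (- 2 * (\<alpha> - \<epsilon>) * ln \<bar>v\<bar>))"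
    by (rule mult_mono[OF S 1]) (auto simp: le_max_iff_disj)
  also have "\<dots> = ?D * (v ^ (2 * M) * exp (- 2 * (\<alpha> - \<epsilon>) * ln \<bar>v\<bar>))" by (simp only: mult_ac)
  also have "\<dots> \<le> ?D * (1 + v ^ (2 * M))" by (rule mult_left_mono[OF 2]) simp
  finally show ?thesis by (simp only: mult.assoc)
qed

text \<open>The tested modulus: the weight of the test times the squared modulus of the characteristic function of the jumps
  of size at most \<open>r\<close>, at frequency \<open>v / h\<close>.\<close>

definition weight :: "nat \<Rightarrow> real \<Rightarrow> real \<Rightarrow> real \<Rightarrow> real" where
  "weight M h r v = exp (- v\<^sup>2 / 2) * ((2 - 2 * cos v) ^ M * exp (2 * Re (levy_exp (small r) (v / h))))"

lemma weight_bounds: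
  "0 \<le> weight M h r v" "weight M h r v \<le> exp (- v\<^sup>2 / 2) * 4 ^ M"
proof -
  have "Re (levy_exp (small r) (v / h)) \<le> 0"
    unfolding Re_levy_exp(2)[OF measurable_small small_integrable] using small_nonneg
    by (simp add: integral_nonneg_AE)
  then have 1: "exp (2 * Re (levy_exp (small r) (v / h))) \<le> 1" by simp
  have 2: "0 \<le> (2 - 2 * cos v) ^ M" using versine_bounds by simp
  have "2 - 2 * cos v \<le> 4" using cos_ge_minus_one[of v] by linarith
  then have 3: "(2 - 2 * cos v) ^ M \<le> 4 ^ M" by (rule power_mono[OF _ versine_bounds(1)])
  show "0 \<le> weight M h r v" using 2 by (simp add: weight_def)
  have "(2 - 2 * cos v) ^ M * exp (2 * Re (levy_exp (small r) (v / h))) \<le> 4 ^ M * 1"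
    by (rule mult_mono[OF 3 1]) auto
  then show "weight M h r v \<le> exp (- v\<^sup>2 / 2) * 4 ^ M" by (simp add: weight_def)
qed

lemma measurable_weight[measurable]: "weight M h r \<in> borel_measurable borel"
  unfolding weight_def[abs_def] by measurable

lemma integrable_weight: "integrable lborel (weight M h r)"
  by (rule Bochner_Integration.integrable_bound[OF integrable_mult_left[OF integrable_gaussian, of "4 ^ M"]])
    (use weight_bounds in \<open>auto intro!: AE_I2\<close>)

text \<open>All factors are bounded below on \<open>[1, 2]\<close>, that is, for frequencies of order \<open>1 / h\<close>.\<close>

lemma integral_weight_ge:
  assumes bd: "band \<epsilon> d" and h: "0 < h" and \<rho>: "h \<le> \<rho>" "\<rho> \<le> d"
  shows "exp (- 2) * (2 - 2 * cos 1) ^ M * exp (- 2 * (\<alpha> + \<epsilon>) * (ln 2 + 4)) * (\<rho> / h) powr (- 2 * (\<alpha> + \<epsilon>))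
    \<le> (\<integral>v. weight M h \<rho> v \<partial>lborel)"
proof -
  have e: "0 < \<epsilon>" and d: "0 < d" "d \<le> 1" using bd by (auto simp: band_def)
  have \<rho>0: "0 < \<rho>" using h \<rho> by simp
  let ?c = "exp (- 2) * ((2 - 2 * cos 1) ^ M * exp (- 2 * ((\<alpha> + \<epsilon>) * (ln 2 + ln (\<rho> / h) + 4))))"
  have pt: "?c \<le> weight M h \<rho> v" if v: "1 \<le> v" "v \<le> 2" for v
  proof -
    have 1: "exp (- 2) \<le> exp (- v\<^sup>2 / 2)"
      using power_mono[of v 2 2] v by simp
    have "cos v \<le> cos 1" using v pi_gt3 by (intro cos_monotone_0_pi_le) auto
    then have 2: "(2 - 2 * cos 1) ^ M \<le> (2 - 2 * cos v) ^ M"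
      using versine_bounds[of 1] by (intro power_mono) auto
    have u: "0 < v / h" using v h by simp
    have "ln (v / h * \<rho>) \<le> ln 2 + ln (\<rho> / h)"
    proof -
      have "ln (v / h * \<rho>) = ln v + ln (\<rho> / h)" using v h \<rho>0 by (simp add: ln_mult ln_div)
      also have "ln v \<le> ln 2" using v by simp
      finally show ?thesis by simp
    qed
    moreover have "0 \<le> ln (\<rho> / h)" using h \<rho> by simp
    ultimately have "max 0 (ln (v / h * \<rho>)) + 4 \<le> ln 2 + ln (\<rho> / h) + 4" by simp
    with cin_bounds(2)[OF u \<rho>0] have "cin (v / h) \<rho> \<le> ln 2 + ln (\<rho> / h) + 4" by linarith
    then have "(\<alpha> + \<epsilon>) * cin (v / h) \<rho> \<le> (\<alpha> + \<epsilon>) * (ln 2 + ln (\<rho> / h) + 4)"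
      using \<alpha>_pos e by (intro mult_left_mono) auto
    with Re_levy_exp_small(2)[OF bd \<rho>0 \<rho>(2) u]
    have "- ((\<alpha> + \<epsilon>) * (ln 2 + ln (\<rho> / h) + 4)) \<le> Re (levy_exp (small \<rho>) (v / h))" by linarith
    then have 3: "exp (- 2 * ((\<alpha> + \<epsilon>) * (ln 2 + ln (\<rho> / h) + 4)))
        \<le> exp (2 * Re (levy_exp (small \<rho>) (v / h)))" by simp
    show ?thesis unfolding weight_def
      by (intro mult_mono 1 2 3) (use versine_bounds in auto)
  qed
  have "exp (- 2) * (2 - 2 * cos 1) ^ M * exp (- 2 * (\<alpha> + \<epsilon>) * (ln 2 + 4)) * (\<rho> / h) powr (- 2 * (\<alpha> + \<epsilon>)) = ?c"
    using h \<rho>0 by (simp add: powr_def exp_add[symmetric] algebra_simps)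
  also have "?c = (\<integral>v. ?c * indicator {1..2::real} v \<partial>lborel)" by simp
  also have "\<dots> \<le> (\<integral>v. weight M h \<rho> v \<partial>lborel)"
  proof (rule integral_mono[OF _ integrable_weight])
    show "integrable lborel (\<lambda>v. ?c * indicator {1..2::real} v)" by simp
    show "?c * indicator {1..2} v \<le> weight M h \<rho> v" for v
      using pt[of v] weight_bounds(1)[of M h \<rho> v] by (simp add: indicator_def)
  qed
  finally show ?thesis .
qed

end

section \<open>Lower bound for the tested characteristic function\<close>

lemma power_div_fact_le_exp:
  fixes x :: real
  assumes "0 \<le> x"
  shows "x ^ m / fact m \<le> exp x"
proof -
  have s: "(\<lambda>n. x ^ n /\<^sub>R fact n) sums exp x" by (rule exp_converges)
  have "sum (\<lambda>n. x ^ n /\<^sub>R fact n) {m} \<le> exp x"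
    by (rule sum_le_suminf[OF sums_summable[OF s], unfolded sums_unique[OF s, symmetric]])
      (use assms in auto)
  then show ?thesis by (simp add: divide_inverse mult.commute)
qed

lemma exp_minus_le_power:
  fixes x :: real
  assumes "0 < x"
  shows "exp (- x) \<le> fact m * (1 / x) ^ m"
proof -
  have "x ^ m / fact m \<le> exp x" using assms by (intro power_div_fact_le_exp) auto
  then have "1 / exp x \<le> 1 / (x ^ m / fact m)" using assms by (intro divide_left_mono) auto
  moreover have "1 / (x ^ m / fact m) = fact m * (1 / x) ^ m" by (simp add: power_one_over)
  moreover have "exp (- x) = 1 / exp x" by (simp add: exp_minus divide_inverse)
  ultimately show ?thesis by simp
qed

lemma integrable_gaussian_power: "integrable lborel (\<lambda>v::real. exp (- v\<^sup>2 / 2) * v ^ k)"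
proof -
  have "exp (- v\<^sup>2 / 2) * v ^ k = sqrt (2 * pi) * (std_normal_density v * v ^ k)" for v :: real
    by (simp add: std_normal_density_def)
  then show ?thesis
    by (simp only: integrable_mult_right integrable_std_normal_moment)
qed

context jump_density
begin

text \<open>The product of the two characteristic functions is \<open>weight M h \<rho>\<close> up to the factor \<open>exp(z + w - l)\<close>, where
  \<open>z\<close> and \<open>w\<close> are the Fourier transforms of the jumps beyond \<open>\<rho>\<close>, split so that the density behind \<open>z\<close> is bounded by a
  multiple of \<open>1 / \<rho>\<close> and the mass behind \<open>w\<close> is at most 1/4. Then \<open>exp w\<close> differs from 1 by at most 1/2, and
  \<open>exp z - 1\<close> is small in mean, so at least half of the integral of the weight survives, up to the subtracted
  error term.\<close>

lemma versine_lower_bound: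
  assumes bd: "band \<epsilon> d" and ea: "2 * \<epsilon> \<le> \<alpha>" and M: "\<alpha> \<le> real M"
  obtains c C \<Lambda> where "0 < c" "0 \<le> C"
    "\<And>h \<rho>. 0 < h \<Longrightarrow> h \<le> \<rho> \<Longrightarrow> \<rho> \<le> d \<Longrightarrow>
      exp (- \<Lambda>) * \<rho> powr (\<alpha> + \<epsilon>) * (c * (\<rho> / h) powr (- 2 * (\<alpha> + \<epsilon>))
          - C * (\<rho> powr (- 2 * \<epsilon>) * (\<rho> / h) powr (- 2 * (\<alpha> - \<epsilon>) - 1 / 2)))
        \<le> norm (versine_integral M (\<lambda>v. cnj (exp (levy_exp (small \<rho>) (v / h))) * exp (levy_exp b (v / h))))"
proof -
  have e: "0 < \<epsilon>" and d: "0 < d" "d \<le> 1" using bd by (auto simp: band_def)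
  let ?far = "\<lambda>x. b x * indicator {x. d < \<bar>x\<bar>} x"
  have fari: "integrable lborel ?far" by (rule integrable_away[OF d(1)]) auto
  define \<Lambda> where "\<Lambda> = (\<integral>x. ?far x \<partial>lborel)"
  have \<Lambda>0: "0 \<le> \<Lambda>" unfolding \<Lambda>_def using b_nonneg by (intro integral_nonneg_AE) auto
  \<comment> \<open>the level above which the density of the jumps beyond \<open>d\<close> is put into \<open>rem\<close>\<close>
  obtain B :: nat where B: "(\<integral>x. b x * indicator {x. d < \<bar>x\<bar> \<and> real B < b x} x \<partial>lborel) \<le> 1 / 4"
  proof -
    have "(\<lambda>n. \<integral>x. b x * indicator {x. d < \<bar>x\<bar> \<and> real n < b x} x \<partial>lborel) \<longlonglongrightarrow> (\<integral>x. 0 \<partial>(lborel::real measure))"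
    proof (rule integral_dominated_convergence[OF _ _ fari])
      show "AE x in lborel. (\<lambda>n. b x * indicator {x. d < \<bar>x\<bar> \<and> real n < b x} x) \<longlonglongrightarrow> 0"
      proof (rule AE_I2)
        fix x
        obtain N where N: "b x < real N" using reals_Archimedean2 by blast
        have "eventually (\<lambda>n. b x * indicator {x. d < \<bar>x\<bar> \<and> real n < b x} x = 0) sequentially"
          using eventually_ge_at_top[of N] by eventually_elim (use N in auto)
        then show "(\<lambda>n. b x * indicator {x. d < \<bar>x\<bar> \<and> real n < b x} x) \<longlonglongrightarrow> 0"
          by (rule tendsto_eventually)
      qed
      show "AE x in lborel. norm (b x * indicator {x. d < \<bar>x\<bar> \<and> real n < b x} x) \<le> ?far x" for n
        using b_nonneg by (auto simp: indicator_def)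
    qed measurable
    then have "(\<lambda>n. \<integral>x. b x * indicator {x. d < \<bar>x\<bar> \<and> real n < b x} x \<partial>lborel) \<longlonglongrightarrow> 0" by simp
    from order_tendstoD(2)[OF this, of "1 / 4"]
    obtain n where "(\<integral>x. b x * indicator {x. d < \<bar>x\<bar> \<and> real n < b x} x \<partial>lborel) < 1 / 4"
      unfolding eventually_sequentially by auto
    then show thesis by (intro that[of n] less_imp_le)
  qed
  define rem where "rem x = b x * indicator {x. d < \<bar>x\<bar> \<and> real B < b x} x" for x
  have remi: "integrable lborel rem" unfolding rem_def[abs_def]
    by (rule integrable_away[OF d(1)]) auto
  have rem_nn: "0 \<le> rem x" for x using b_nonneg by (simp add: rem_def)
  have "(\<integral>x. rem x \<partial>lborel) \<le> 1 / 4" using B by (simp add: rem_def)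
  then have rem4: "norm (fourier rem u) \<le> 1 / 4" for u
    using norm_fourier_le[OF remi rem_nn, of u] by linarith
  define c1 where "c1 = exp (- 2) * (2 - 2 * cos 1) ^ M * exp (- 2 * (\<alpha> + \<epsilon>) * (ln 2 + 4))"
  have c1: "0 < c1"
  proof -
    have "cos 1 < cos (0::real)" using pi_gt3 by (intro cos_monotone_0_pi) auto
    then show ?thesis unfolding c1_def by (intro mult_pos_pos zero_less_power) auto
  qed
  define G1 :: real where "G1 = (\<integral>v. exp (- v\<^sup>2 / 2) * (1 + v ^ (2 * M))\<^sup>2 \<partial>lborel)"
  have G1i: "integrable lborel (\<lambda>v::real. exp (- v\<^sup>2 / 2) * (1 + v ^ (2 * M))\<^sup>2)"
  proof -
    have "exp (- v\<^sup>2 / 2) * (1 + v ^ (2 * M))\<^sup>2 = exp (- v\<^sup>2 / 2) * v ^ 0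
        + 2 * (exp (- v\<^sup>2 / 2) * v ^ (2 * M)) + exp (- v\<^sup>2 / 2) * v ^ (4 * M)" for v :: real
      by (simp add: power2_eq_square algebra_simps power_add[symmetric])
    then show ?thesis
      by (simp only: Bochner_Integration.integrable_add integrable_mult_right integrable_gaussian_power)
  qed
  have G1: "0 \<le> G1" unfolding G1_def by (intro integral_nonneg_AE) auto
  define C3 where "C3 = \<alpha> + \<epsilon> + real B"
  define C4 where "C4 = (\<alpha> + \<epsilon>) / \<epsilon> + \<Lambda>"
  have C34: "0 \<le> C3" "0 \<le> C4" using \<alpha>_pos e \<Lambda>0 by (auto simp: C3_def C4_def)
  define C where "C = exp (10 * \<alpha> + \<Lambda>) * (G1 + 2 * pi * C4 * C3)"
  show thesis
  proof (rule that[of "c1 / 2" C \<Lambda>])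
    show "0 < c1 / 2" using c1 by simp
    show "0 \<le> C" using G1 C34 by (simp add: C_def)
    fix h \<rho> :: real assume h: "0 < h" and \<rho>: "h \<le> \<rho>" "\<rho> \<le> d"
    have \<rho>0: "0 < \<rho>" and \<rho>1: "\<rho> \<le> 1" using h \<rho> d by auto
    define K where "K = \<rho> / h"
    have K: "1 \<le> K" using h \<rho> by (simp add: K_def)
    \<comment> \<open>the weight in \<open>2pq \<le> \<theta>p\<^sup>2 + q\<^sup>2/\<theta>\<close> that balances the two terms, as the mean square of \<open>z\<close> is of order \<open>1 / K\<close>\<close>
    define \<theta> where "\<theta> = K powr (- 1 / 2)"
    have \<theta>: "0 < \<theta>" using K by (simp add: \<theta>_def)
    define D where "D = exp (10 * \<alpha> + \<Lambda>) * \<rho> powr (- \<epsilon>) * K powr (- 2 * (\<alpha> - \<epsilon>))"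
    have D0: "0 \<le> D" by (simp add: D_def)
    have lnd: "0 \<le> ln (d / \<rho>)" "ln (d / \<rho>) \<le> - ln \<rho>" using d \<rho>0 \<rho> by (auto simp: ln_div)
    have r\<epsilon>: "1 \<le> \<rho> powr (- \<epsilon>)" "- ln \<rho> \<le> \<rho> powr (- \<epsilon>) / \<epsilon>"
    proof -
      have l: "0 \<le> - ln \<rho>" using \<rho>0 \<rho>1 by simp
      have "1 + \<epsilon> * - ln \<rho> \<le> exp (\<epsilon> * - ln \<rho>)" by (rule exp_ge_add_one_self)
      also have "exp (\<epsilon> * - ln \<rho>) = \<rho> powr (- \<epsilon>)" using \<rho>0 by (simp add: powr_def)
      finally have *: "1 + \<epsilon> * - ln \<rho> \<le> \<rho> powr (- \<epsilon>)" .
      moreover have "0 \<le> \<epsilon> * - ln \<rho>" using l e by (intro mult_nonneg_nonneg) auto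
      ultimately show "1 \<le> \<rho> powr (- \<epsilon>)" by linarith
      have "\<epsilon> * - ln \<rho> \<le> \<rho> powr (- \<epsilon>)" using * by linarith
      then show "- ln \<rho> \<le> \<rho> powr (- \<epsilon>) / \<epsilon>" using e by (simp add: field_simps)
    qed
    let ?shell = "\<lambda>x. b x * indicator {x. \<rho> < \<bar>x\<bar> \<and> \<bar>x\<bar> \<le> d} x"
    have shi: "integrable lborel ?shell" by (rule integrable_away[OF \<rho>0]) auto
    define farb where "farb x = b x * indicator {x. d < \<bar>x\<bar> \<and> b x \<le> real B} x" for x
    have farbi: "integrable lborel farb" unfolding farb_def[abs_def] by (rule integrable_away[OF d(1)]) auto
    have farb_nn: "0 \<le> farb x" for x using b_nonneg by (simp add: farb_def)
    define mid where "mid x = ?shell x + farb x" for x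
    have midi: "integrable lborel mid" unfolding mid_def[abs_def]
      by (rule Bochner_Integration.integrable_add[OF shi farbi])
    have [measurable]: "rem \<in> borel_measurable borel" "mid \<in> borel_measurable borel"
      using remi midi by auto
    have mid_nn: "0 \<le> mid x" for x using b_nonneg farb_nn by (simp add: mid_def)
    have farb_le: "(\<integral>x. farb x \<partial>lborel) \<le> \<Lambda>" unfolding \<Lambda>_def
      by (rule integral_mono[OF farbi fari]) (use b_nonneg in \<open>auto simp: farb_def indicator_def\<close>)
    have far_split: "(\<integral>x. farb x \<partial>lborel) + (\<integral>x. rem x \<partial>lborel) = \<Lambda>"
    proof -
      have "(\<integral>x. farb x \<partial>lborel) + (\<integral>x. rem x \<partial>lborel) = (\<integral>x. farb x + rem x \<partial>lborel)"
        using farbi remi by simp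
      also have "\<dots> = \<Lambda>" unfolding \<Lambda>_def
        by (intro Bochner_Integration.integral_cong refl) (auto simp: farb_def rem_def indicator_def)
      finally show ?thesis .
    qed
    have sh_le: "(\<integral>x. ?shell x \<partial>lborel) \<le> (\<alpha> + \<epsilon>) * ln (d / \<rho>)"
      using shell_mass[OF bd \<rho>0 \<rho>(2)] by (simp add: abs_le_iff distrib_right)
    have sh_le2: "(\<integral>x. ?shell x \<partial>lborel) \<le> (\<alpha> + \<epsilon>) * - ln \<rho>"
      by (rule order_trans[OF sh_le]) (use lnd \<alpha>_pos e in \<open>intro mult_left_mono, auto\<close>)
    define l where "l = (\<integral>x. mid x \<partial>lborel) + (\<integral>x. rem x \<partial>lborel)"
    have mid_int: "(\<integral>x. mid x \<partial>lborel) = (\<integral>x. ?shell x \<partial>lborel) + (\<integral>x. farb x \<partial>lborel)"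
      unfolding mid_def using shi farbi by (rule Bochner_Integration.integral_add)
    have l_le: "l \<le> (\<alpha> + \<epsilon>) * - ln \<rho> + \<Lambda>"
      unfolding l_def mid_int using sh_le2 far_split by linarith
    have mid_le: "(\<integral>x. mid x \<partial>lborel) \<le> C4 * \<rho> powr (- \<epsilon>)"
    proof -
      have "(\<alpha> + \<epsilon>) * - ln \<rho> \<le> (\<alpha> + \<epsilon>) * (\<rho> powr (- \<epsilon>) / \<epsilon>)"
        using r\<epsilon>(2) \<alpha>_pos e by (intro mult_left_mono) auto
      moreover have "\<Lambda> * 1 \<le> \<Lambda> * \<rho> powr (- \<epsilon>)" using r\<epsilon>(1) \<Lambda>0 by (rule mult_left_mono)
      ultimately show ?thesis unfolding mid_int C4_def using sh_le2 farb_le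
        by (simp add: distrib_right)
    qed
    have mid_B: "AE x in lborel. mid x \<le> C3 / \<rho>"
      using AE_shell_bound[OF bd \<rho>0]
    proof eventually_elim
      case (elim x)
      have B\<rho>: "real B \<le> real B / \<rho>" using \<rho>0 \<rho>1 by (simp add: le_divide_eq mult_left_le)
      have 1: "(\<alpha> + \<epsilon>) / \<rho> \<le> C3 / \<rho>" "real B / \<rho> \<le> C3 / \<rho>"
        using \<rho>0 \<alpha>_pos e by (auto simp: C3_def intro!: divide_right_mono)
      have 2: "0 \<le> C3 / \<rho>" using C34 \<rho>0 by simp
      show ?case
        using elim B\<rho> 1 2 by (auto simp: mid_def farb_def indicator_def)
    qed
    let ?z = "\<lambda>v. fourier mid (v / h)" and ?w = "\<lambda>v. fourier rem (v / h)"
    have lev: "levy_exp b u = levy_exp (small \<rho>) u + (fourier mid u + fourier rem u) - of_real l" for u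
    proof -
      have "levy_exp b u = levy_exp (small \<rho>) u + levy_exp (\<lambda>x. mid x + rem x) u"
        by (rule levy_exp_add[OF measurable_small small_integrable _
              integrable_min_absI[OF Bochner_Integration.integrable_add[OF midi remi]]])
          (use \<rho> in \<open>auto simp: small_def mid_def farb_def rem_def indicator_def\<close>)
      also have "levy_exp (\<lambda>x. mid x + rem x) u = levy_exp mid u + levy_exp rem u"
        by (rule levy_exp_add[OF _ integrable_min_absI[OF midi] _ integrable_min_absI[OF remi]]) auto
      finally show ?thesis
        by (simp add: levy_exp_integrable_eq[OF midi] levy_exp_integrable_eq[OF remi] l_def)
    qed
    let ?W = "weight M h \<rho>"
    let ?X = "CLINT v|lborel. of_real (?W v) * exp (?z v + ?w v)"
    \<comment> \<open>the conjugate cancels the phase of the small jumps\<close>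
    have integrand: "of_real (exp (- v\<^sup>2 / 2)) * (of_real ((2 - 2 * cos v) ^ M) *
            (cnj (exp (levy_exp (small \<rho>) (v / h))) * exp (levy_exp b (v / h))))
        = of_real (exp (- l)) * (of_real (?W v) * exp (?z v + ?w v))" for v
    proof -
      let ?A = "levy_exp (small \<rho>) (v / h)"
      have "cnj (exp ?A) * exp ?A = of_real (exp (2 * Re ?A))"
        using complex_norm_square[of "exp ?A"]
        by (simp add: mult.commute exp_double power2_eq_square[symmetric] of_real_power)
      moreover have "exp (levy_exp b (v / h)) = exp ?A * exp (?z v + ?w v) * of_real (exp (- l))"
        unfolding lev by (simp add: exp_add exp_diff exp_minus divide_inverse exp_of_real[symmetric])
      ultimately have "cnj (exp ?A) * exp (levy_exp b (v / h))
          = of_real (exp (2 * Re ?A)) * exp (?z v + ?w v) * of_real (exp (- l))"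
        by (simp only: mult.assoc[symmetric])
      then show ?thesis by (simp add: weight_def mult_ac)
    qed
    have tot: "(versine_integral M (\<lambda>v. cnj (exp (levy_exp (small \<rho>) (v / h))) * exp (levy_exp b (v / h))))
        = of_real (exp (- l)) * ?X"
      unfolding integrand by (rule integral_mult_right_zero)
    have Xi: "integrable lborel (\<lambda>v. of_real (?W v) * exp (?z v + ?w v))"
    proof (rule Bochner_Integration.integrable_bound)
      show "integrable lborel (\<lambda>v. ?W v * exp ((\<integral>x. mid x \<partial>lborel) + 1 / 4))"
        by (rule integrable_mult_left[OF integrable_weight])
      show "AE v in lborel. norm (of_real (?W v) * exp (?z v + ?w v))
          \<le> norm (?W v * exp ((\<integral>x. mid x \<partial>lborel) + 1 / 4))"
      proof (rule AE_I2)
        fix v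
        have "Re (?z v) + Re (?w v) \<le> (\<integral>x. mid x \<partial>lborel) + 1 / 4"
          using complex_Re_le_cmod[of "?z v"] complex_Re_le_cmod[of "?w v"]
            norm_fourier_le[OF midi mid_nn, of "v / h"] rem4[of "v / h"] by linarith
        then show "norm (of_real (?W v) * exp (?z v + ?w v))
          \<le> norm (?W v * exp ((\<integral>x. mid x \<partial>lborel) + 1 / 4))"
          using weight_bounds(1)[of M h \<rho> v] by (simp add: norm_mult abs_mult mult_left_mono)
      qed
    qed measurable
    note L2 = gaussian_fourier_L2[OF midi mid_nn mid_B divide_nonneg_pos[OF C34(1) \<rho>0] h]
    let ?E = "\<lambda>v. D * (\<theta> * (exp (- v\<^sup>2 / 2) * (1 + v ^ (2 * M))\<^sup>2)
        + 1 / \<theta> * (exp (- v\<^sup>2 / 2) * (norm (?z v))\<^sup>2))"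
    have pt: "norm (of_real (?W v) * exp (?z v + ?w v) - of_real (?W v)) \<le> ?W v / 2 + ?E v"
      if v: "v \<noteq> 0" for v
    proof -
      have W0: "0 \<le> ?W v" by (rule weight_bounds)
      have Rz: "Re (?z v) \<le> \<alpha> * (max 0 (- ln (\<bar>v / h\<bar> * \<rho>)) + 6) + \<epsilon> * ln (d / \<rho>) + \<Lambda>"
      proof -
        have c: "cos (v / h * x) = cos (\<bar>v / h\<bar> * x)" for x
          by (cases "0 \<le> v / h") (simp_all only: abs_of_nonneg abs_of_neg not_le mult_minus_left cos_minus)
        have u: "0 < \<bar>v / h\<bar>" using v h by simp
        have cb: "integrable lborel (\<lambda>x. cos (\<bar>v / h\<bar> * x) * f x)" if f: "integrable lborel f" for f :: "real \<Rightarrow> real"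
          by (rule Bochner_Integration.integrable_bound[OF f])
            (use borel_measurable_integrable[OF f] in \<open>auto simp: abs_mult intro!: AE_I2 mult_left_le_one_le\<close>)
        have "Re (?z v) = (\<integral>x. cos (\<bar>v / h\<bar> * x) * mid x \<partial>lborel)"
          unfolding Re_fourier[OF midi] c ..
        also have "\<dots> = (\<integral>x. cos (\<bar>v / h\<bar> * x) * ?shell x \<partial>lborel) + (\<integral>x. cos (\<bar>v / h\<bar> * x) * farb x \<partial>lborel)"
          unfolding mid_def distrib_left by (rule Bochner_Integration.integral_add[OF cb[OF shi] cb[OF farbi]])
        also have "(\<integral>x. cos (\<bar>v / h\<bar> * x) * farb x \<partial>lborel) \<le> (\<integral>x. farb x \<partial>lborel)"
        proof (rule integral_mono[OF cb[OF farbi] farbi])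
          fix x
          have "cos (\<bar>v / h\<bar> * x) * farb x \<le> 1 * farb x" by (rule mult_right_mono[OF cos_le_one farb_nn])
          then show "cos (\<bar>v / h\<bar> * x) * farb x \<le> farb x" by simp
        qed
        also note farb_le
        finally show ?thesis using shell_cos[OF bd \<rho>0 \<rho>(2) u] by simp
      qed
      have Wm: "?W v * max 1 (exp (Re (?z v))) \<le> D * (exp (- v\<^sup>2 / 2) * (1 + v ^ (2 * M)))"
      proof -
        have "(2 - 2 * cos v) ^ M * exp (2 * Re (levy_exp (small \<rho>) (v / h))) * max 1 (exp (Re (?z v)))
            \<le> D * (1 + v ^ (2 * M))"
          unfolding D_def K_def by (rule versine_weight_le[OF bd ea M h \<rho>0 \<rho>(2) v \<Lambda>0 Rz])
        from mult_left_mono[OF this, of "exp (- v\<^sup>2 / 2)"] show ?thesis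
          by (simp add: weight_def mult_ac)
      qed
      have e4: "exp (1 / 4 :: real) \<le> 2"
        using exp_bound[of "1 / 4 :: real"] by (simp add: power2_eq_square)
      have Rw: "exp (Re (?w v)) \<le> 2"
      proof -
        have "Re (?w v) \<le> 1 / 4" using complex_Re_le_cmod[of "?w v"] rem4[of "v / h"] by linarith
        then have "exp (Re (?w v)) \<le> exp (1 / 4)" by simp
        then show ?thesis using e4 by linarith
      qed
      have w1: "norm (exp (?w v) - 1) \<le> 1 / 2"
      proof -
        have "norm (exp (?w v) - 1) \<le> norm (?w v) * max 1 (exp (Re (?w v)))" by (rule norm_exp_minus_1_le)
        also have "\<dots> \<le> 1 / 4 * 2" by (rule mult_mono) (use rem4 Rw in \<open>auto simp: le_max_iff_disj\<close>)
        finally show ?thesis by simp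
      qed
      have split: "exp (?z v + ?w v) - 1 = (exp (?w v) - 1) + exp (?w v) * (exp (?z v) - 1)"
        by (simp add: exp_add right_diff_distrib mult.commute)
      have "norm (exp (?z v + ?w v) - 1) \<le> norm (exp (?w v) - 1) + norm (exp (?w v)) * norm (exp (?z v) - 1)"
        unfolding split norm_mult[symmetric] by (rule norm_triangle_ineq)
      also have "\<dots> \<le> 1 / 2 + 2 * (norm (?z v) * max 1 (exp (Re (?z v))))"
        by (intro add_mono w1 mult_mono norm_exp_minus_1_le) (use Rw in auto)
      finally have "?W v * norm (exp (?z v + ?w v) - 1)
          \<le> ?W v * (1 / 2 + 2 * (norm (?z v) * max 1 (exp (Re (?z v)))))"
        by (rule mult_left_mono[OF _ W0])
      also have "\<dots> = ?W v / 2 + 2 * norm (?z v) * (?W v * max 1 (exp (Re (?z v))))"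
        by (simp add: algebra_simps)
      also have "\<dots> \<le> ?W v / 2 + 2 * norm (?z v) * (D * (exp (- v\<^sup>2 / 2) * (1 + v ^ (2 * M))))"
        by (intro add_left_mono mult_left_mono[OF Wm]) auto
      also have "\<dots> = ?W v / 2 + D * exp (- v\<^sup>2 / 2) * (2 * (1 + v ^ (2 * M)) * norm (?z v))"
        by (simp add: algebra_simps)
      also have "\<dots> \<le> ?W v / 2 + D * exp (- v\<^sup>2 / 2) * (\<theta> * (1 + v ^ (2 * M))\<^sup>2 + 1 / \<theta> * (norm (?z v))\<^sup>2)"
      proof (intro add_left_mono mult_left_mono)
        let ?p = "1 + v ^ (2 * M)" and ?n = "norm (?z v)"
        have "0 \<le> (\<theta> * ?p - ?n)\<^sup>2 / \<theta>" using \<theta> by simp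
        also have "(\<theta> * ?p - ?n)\<^sup>2 / \<theta> = \<theta> * ?p\<^sup>2 + 1 / \<theta> * ?n\<^sup>2 - 2 * ?p * ?n"
          using \<theta> by (simp add: power2_eq_square field_simps)
        finally show "2 * ?p * ?n \<le> \<theta> * ?p\<^sup>2 + 1 / \<theta> * ?n\<^sup>2" by simp
      qed (use D0 in auto)
      also have "\<dots> = ?W v / 2 + ?E v" by (simp add: algebra_simps)
      finally have "?W v * norm (exp (?z v + ?w v) - 1) \<le> ?W v / 2 + ?E v" .
      moreover have "of_real (?W v) * exp (?z v + ?w v) - of_real (?W v)
          = of_real (?W v) * (exp (?z v + ?w v) - 1)" by (simp add: right_diff_distrib)
      ultimately show ?thesis using W0 by (simp add: norm_mult)
    qed
    have Ei: "integrable lborel ?E"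
      by (intro integrable_mult_right Bochner_Integration.integrable_add G1i L2(1))
    have Eint: "(\<integral>v. ?E v \<partial>lborel) \<le> C * (\<rho> powr (- 2 * \<epsilon>) * K powr (- 2 * (\<alpha> - \<epsilon>) - 1 / 2))"
    proof -
      have "(\<integral>v. ?E v \<partial>lborel) = D * (\<theta> * G1 + 1 / \<theta> * (\<integral>v. exp (- v\<^sup>2 / 2) * (norm (?z v))\<^sup>2 \<partial>lborel))"
        unfolding G1_def
        by (simp only: integral_mult_right_zero Bochner_Integration.integral_add integrable_mult_right G1i L2(1))
      also have "\<dots> \<le> D * (\<theta> * \<rho> powr (- \<epsilon>) * G1 + \<theta> * \<rho> powr (- \<epsilon>) * (2 * pi * C4 * C3))"
      proof (intro mult_left_mono[OF _ D0] add_mono)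
        show "\<theta> * G1 \<le> \<theta> * \<rho> powr (- \<epsilon>) * G1"
          using mult_right_mono[OF r\<epsilon>(1), of "\<theta> * G1"] \<theta> G1 by (simp add: mult_ac)
        have "(\<integral>v. exp (- v\<^sup>2 / 2) * (norm (?z v))\<^sup>2 \<partial>lborel) \<le> 2 * pi * (\<integral>x. mid x \<partial>lborel) * (C3 / \<rho>) * h"
          by (rule L2(2))
        also have "\<dots> \<le> 2 * pi * (C4 * \<rho> powr (- \<epsilon>)) * (C3 / \<rho>) * h"
          using mid_le C34 \<rho>0 h by (intro mult_right_mono mult_left_mono) auto
        also have "\<dots> = (2 * pi * C4 * C3) * \<rho> powr (- \<epsilon>) / K"
          by (simp add: K_def)
        finally have "1 / \<theta> * (\<integral>v. exp (- v\<^sup>2 / 2) * (norm (?z v))\<^sup>2 \<partial>lborel)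
            \<le> 1 / \<theta> * ((2 * pi * C4 * C3) * \<rho> powr (- \<epsilon>) / K)"
          using \<theta> by (intro mult_left_mono) auto
        also have "\<dots> = \<theta> * \<rho> powr (- \<epsilon>) * (2 * pi * C4 * C3)"
        proof -
          have "\<theta> * \<theta> = K powr (- 1)" unfolding \<theta>_def powr_add[symmetric] by simp
          then have "\<theta> * \<theta> * K = 1" using K by (simp add: powr_minus)
          then have "1 / \<theta> / K = \<theta>" using \<theta> K by (simp add: field_simps)
          moreover have "1 / \<theta> * (a * r / K) = 1 / \<theta> / K * r * a" for a r :: real by simp
          ultimately show ?thesis by (simp only:)
        qed
        finally show "1 / \<theta> * (\<integral>v. exp (- v\<^sup>2 / 2) * (norm (?z v))\<^sup>2 \<partial>lborel)
            \<le> \<theta> * \<rho> powr (- \<epsilon>) * (2 * pi * C4 * C3)" .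
      qed
      also have "\<dots> = exp (10 * \<alpha> + \<Lambda>) * (G1 + 2 * pi * C4 * C3)
          * ((\<rho> powr (- \<epsilon>) * \<rho> powr (- \<epsilon>)) * (K powr (- 2 * (\<alpha> - \<epsilon>)) * \<theta>))"
        unfolding D_def by (simp only: algebra_simps)
      also have "\<rho> powr (- \<epsilon>) * \<rho> powr (- \<epsilon>) = \<rho> powr (- 2 * \<epsilon>)"
        by (simp add: powr_add[symmetric])
      also have "K powr (- 2 * (\<alpha> - \<epsilon>)) * \<theta> = K powr (- 2 * (\<alpha> - \<epsilon>) - 1 / 2)"
        by (simp add: \<theta>_def powr_add[symmetric])
      finally show ?thesis by (simp only: C_def)
    qed
    have "norm (?X - of_real (\<integral>v. ?W v \<partial>lborel))
        = norm (CLINT v|lborel. of_real (?W v) * exp (?z v + ?w v) - of_real (?W v))"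
      using Xi integrable_weight[of M h \<rho>] by simp
    also have "\<dots> \<le> (\<integral>v. norm (of_real (?W v) * exp (?z v + ?w v) - of_real (?W v)) \<partial>lborel)"
      by (rule integral_norm_bound)
    also have "\<dots> \<le> (\<integral>v. ?W v / 2 + ?E v \<partial>lborel)"
    proof (rule integral_mono_AE)
      show "integrable lborel (\<lambda>v. norm (of_real (?W v) * exp (?z v + ?w v) - complex_of_real (?W v)))"
        using Xi integrable_weight[of M h \<rho>] by (intro integrable_norm Bochner_Integration.integrable_diff) auto
      show "integrable lborel (\<lambda>v. ?W v / 2 + ?E v)"
        using Ei integrable_weight[of M h \<rho>] by (intro Bochner_Integration.integrable_add) auto
      show "AE v in lborel. norm (of_real (?W v) * exp (?z v + ?w v) - complex_of_real (?W v)) \<le> ?W v / 2 + ?E v"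
        using AE_lborel_singleton[of 0] by eventually_elim (rule pt)
    qed
    also have "\<dots> = (\<integral>v. ?W v \<partial>lborel) / 2 + (\<integral>v. ?E v \<partial>lborel)"
      by (subst Bochner_Integration.integral_add[OF _ Ei]) (use integrable_weight[of M h \<rho>] in auto)
    finally have Xd: "norm (?X - of_real (\<integral>v. ?W v \<partial>lborel)) \<le> (\<integral>v. ?W v \<partial>lborel) / 2 + (\<integral>v. ?E v \<partial>lborel)" .
    have W0: "0 \<le> (\<integral>v. ?W v \<partial>lborel)" by (intro integral_nonneg_AE) (simp add: weight_bounds)
    have "norm (complex_of_real (\<integral>v. ?W v \<partial>lborel)) \<le> norm ?X + norm (?X - of_real (\<integral>v. ?W v \<partial>lborel))"
      using norm_triangle_sub[of "complex_of_real (\<integral>v. ?W v \<partial>lborel)" ?X]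
      unfolding norm_minus_commute[of ?X] .
    then have X1: "(\<integral>v. ?W v \<partial>lborel) / 2 - (\<integral>v. ?E v \<partial>lborel) \<le> norm ?X"
      using Xd W0 by simp
    let ?br = "c1 / 2 * K powr (- 2 * (\<alpha> + \<epsilon>)) - C * (\<rho> powr (- 2 * \<epsilon>) * K powr (- 2 * (\<alpha> - \<epsilon>) - 1 / 2))"
    have X2: "?br \<le> norm ?X"
      using X1 Eint integral_weight_ge[OF bd h \<rho>, of M] unfolding K_def c1_def by simp
    have "exp (- \<Lambda>) * \<rho> powr (\<alpha> + \<epsilon>) \<le> exp (- l)"
    proof -
      have "exp (- \<Lambda>) * \<rho> powr (\<alpha> + \<epsilon>) = exp (- ((\<alpha> + \<epsilon>) * - ln \<rho> + \<Lambda>))"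
        using \<rho>0 by (simp add: powr_def exp_add[symmetric])
      also have "\<dots> \<le> exp (- l)" using l_le by simp
      finally show ?thesis .
    qed
    then have "exp (- \<Lambda>) * \<rho> powr (\<alpha> + \<epsilon>) * norm ?X \<le> exp (- l) * norm ?X"
      by (rule mult_right_mono) simp
    moreover have "exp (- \<Lambda>) * \<rho> powr (\<alpha> + \<epsilon>) * ?br \<le> exp (- \<Lambda>) * \<rho> powr (\<alpha> + \<epsilon>) * norm ?X"
      by (rule mult_left_mono[OF X2]) simp
    ultimately show "exp (- \<Lambda>) * \<rho> powr (\<alpha> + \<epsilon>) * (c1 / 2 * (\<rho> / h) powr (- 2 * (\<alpha> + \<epsilon>))
          - C * (\<rho> powr (- 2 * \<epsilon>) * (\<rho> / h) powr (- 2 * (\<alpha> - \<epsilon>) - 1 / 2)))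
        \<le> norm (versine_integral M (\<lambda>v. cnj (exp (levy_exp (small \<rho>) (v / h))) * exp (levy_exp b (v / h))))"
      unfolding tot K_def[symmetric] norm_mult norm_of_real abs_exp_cancel by (rule order_trans[rotated])
  qed
qed

end

section \<open>Smoothness bounds the order of the jump density\<close>

context jump_density
begin

text \<open>If \<open>\<alpha> < n + 1\<close>, upper and lower bound of the tested characteristic function are in conflict as \<open>h\<close> tends to 0,
  for a radius \<open>\<rho>\<close> slightly larger than \<open>h\<close>. With \<open>\<rho> / h\<close> a negative power of \<open>h\<close>, every loss of order
  \<open>h\<close> to the power \<open>-\<epsilon>\<close> in the estimates is absorbed by the gain from the mean square of \<open>z\<close>.\<close>

lemma C_class_density_order_le:
  assumes bands: "\<And>\<epsilon>. 0 < \<epsilon> \<Longrightarrow> \<exists>d. band \<epsilon> d"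
    and \<mu>: "real_distribution \<mu>" and \<mu>g: "\<mu> = density lborel (\<lambda>x. ennreal (g x))"
    and gm: "g \<in> borel_measurable borel" and g0: "\<And>x. 0 \<le> g x" and C: "C_class n g"
    and ch: "\<And>u. char \<mu> u = iexp (u * c) * exp (levy_exp b u)"
  shows "real (Suc n) \<le> \<alpha>"
proof (rule ccontr)
  assume "\<not> real (Suc n) \<le> \<alpha>"
  then have gap: "0 < real (Suc n) - \<alpha>" by simp
  define gp where "gp = real (Suc n) - \<alpha>"
  \<comment> \<open>\<open>\<kappa>\<close> is small enough for \<open>(1 + \<kappa>)(\<alpha> + \<epsilon>) < n + 1\<close>, and \<open>\<epsilon>\<close> is so small compared with \<open>\<kappa>\<close> that the error term of the lower bound is smaller than its main term by the factor \<open>h powr (\<kappa> / 10)\<close>.\<close>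
  define \<kappa> where "\<kappa> = min (1 / 2) (gp / (4 * (\<alpha> + 1)))"
  define \<epsilon> where "\<epsilon> = min (min (\<kappa> / 10) (\<alpha> / 2)) (min 1 (gp / 4))"
  have gp: "0 < gp" using gap by (simp add: gp_def)
  have \<kappa>: "0 < \<kappa>" "\<kappa> \<le> 1 / 2" "\<kappa> * (\<alpha> + 1) \<le> gp / 4"
  proof -
    have "0 < gp / (4 * (\<alpha> + 1))" using gp \<alpha>_pos by simp
    then show "0 < \<kappa>" "\<kappa> \<le> 1 / 2" unfolding \<kappa>_def by linarith+
    have "\<kappa> * (\<alpha> + 1) \<le> gp / (4 * (\<alpha> + 1)) * (\<alpha> + 1)"
      using \<alpha>_pos by (intro mult_right_mono) (auto simp: \<kappa>_def min.cobounded2)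
    also have "\<dots> = gp / 4" using \<alpha>_pos by (simp add: field_simps)
    finally show "\<kappa> * (\<alpha> + 1) \<le> gp / 4" .
  qed
  have \<epsilon>: "0 < \<epsilon>" "\<epsilon> \<le> \<kappa> / 10" "2 * \<epsilon> \<le> \<alpha>" "\<epsilon> \<le> 1" "\<epsilon> \<le> gp / 4"
    unfolding \<epsilon>_def using \<kappa> \<alpha>_pos gp by linarith+
  obtain d where bd: "band \<epsilon> d" using bands[OF \<epsilon>(1)] by blast
  have d: "0 < d" "d \<le> 1" using bd by (auto simp: band_def)
  have M: "\<alpha> \<le> real (Suc n)" using gap by simp
  obtain c0 C7 \<Lambda> where lower: "0 < c0" "0 \<le> C7"
    "\<And>h \<rho>. 0 < h \<Longrightarrow> h \<le> \<rho> \<Longrightarrow> \<rho> \<le> d \<Longrightarrow>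
      exp (- \<Lambda>) * \<rho> powr (\<alpha> + \<epsilon>) * (c0 * (\<rho> / h) powr (- 2 * (\<alpha> + \<epsilon>))
          - C7 * (\<rho> powr (- 2 * \<epsilon>) * (\<rho> / h) powr (- 2 * (\<alpha> - \<epsilon>) - 1 / 2)))
        \<le> norm (versine_integral (Suc n) (\<lambda>v. cnj (exp (levy_exp (small \<rho>) (v / h))) * exp (levy_exp b (v / h))))"
    by (rule versine_lower_bound[OF bd \<epsilon>(3) M]) (rule that)
  obtain K0 where K0: "0 \<le> K0"
    "\<And>h Q. 0 < h \<Longrightarrow> real (Suc n) * h \<le> 1 \<Longrightarrow> real_distribution Q \<Longrightarrow>
    norm (versine_integral (Suc n) (\<lambda>v. iexp (- (v / h * c)) * cnj (char Q (v / h)) * char \<mu> (v / h)))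
      \<le> K0 * h ^ Suc n + 4 ^ Suc n * sqrt (2 * pi) * (exp (- 1 / (8 * h\<^sup>2)) + measure Q {x. 1 / 2 < \<bar>x\<bar>})"
    by (rule versine_char_upper_bound[OF \<mu> \<mu>g gm g0 C, of c]) (rule that)
  define K1 where "K1 = K0 + 4 ^ Suc n * sqrt (2 * pi) * (fact (Suc n) * 8 ^ Suc n
      + exp (2 * (\<alpha> + \<epsilon>)) * (fact (2 * Suc n) * 4 ^ Suc n))"
  have upper: "norm (versine_integral (Suc n) (\<lambda>v. cnj (exp (levy_exp (small \<rho>) (v / h))) * exp (levy_exp b (v / h)))) \<le> K1 * h ^ Suc n"
    if h: "0 < h" "real (Suc n) * h \<le> 1" and \<rho>: "0 < \<rho>" "\<rho> \<le> d" "\<rho>\<^sup>2 \<le> h" for h \<rho>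
  proof -
    obtain Q where Q: "real_distribution Q"
      "\<And>u. char Q u = exp (levy_exp (small \<rho>) u)"
      "\<And>t. measure Q {x. t < \<bar>x\<bar>} \<le> exp (2 / \<rho> * (\<integral>x. \<bar>x\<bar> * small \<rho> x \<partial>lborel) - t / \<rho>)"
    proof (rule small_jump_law_exists[OF measurable_small small_nonneg small_first_moment(1)[OF bd \<rho>(1,2)] \<rho>(1)])
      show "small \<rho> x = 0" if "\<rho> < \<bar>x\<bar>" for x using that by (simp add: small_def)
    qed blast
    have integrand: "iexp (- (v / h * c)) * cnj (char Q (v / h)) * char \<mu> (v / h)
        = cnj (exp (levy_exp (small \<rho>) (v / h))) * exp (levy_exp b (v / h))" for v
    proof -
      have "iexp (- (v / h * c)) * iexp (v / h * c) = 1"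
        by (simp add: exp_add[symmetric])
      moreover have "char Q (v / h) = exp (levy_exp (small \<rho>) (v / h))" by (rule Q(2))
      moreover have "p * q * (p' * r) = q * r" if "p * p' = 1" for p p' q r :: complex
      proof -
        have "p * q * (p' * r) = (p * p') * (q * r)" by (simp only: mult_ac)
        then show ?thesis using that by simp
      qed
      ultimately show ?thesis unfolding ch by simp
    qed
    have h1: "h \<le> 1"
    proof -
      have "1 * h \<le> real (Suc n) * h" using h by (intro mult_right_mono) auto
      then show ?thesis using h by linarith
    qed
    have e1: "exp (- 1 / (8 * h\<^sup>2)) \<le> fact (Suc n) * 8 ^ Suc n * h ^ Suc n"
    proof -
      have "exp (- (1 / (8 * h\<^sup>2))) \<le> fact (Suc n) * (1 / (1 / (8 * h\<^sup>2))) ^ Suc n"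
        using h by (intro exp_minus_le_power) simp
      also have "\<dots> = fact (Suc n) * (8 * h\<^sup>2) ^ Suc n" by simp
      also have "\<dots> \<le> fact (Suc n) * (8 * h) ^ Suc n"
        using h h1 by (intro mult_left_mono power_mono) (auto simp: power2_eq_square mult_left_le)
      also have "\<dots> = fact (Suc n) * 8 ^ Suc n * h ^ Suc n" by (simp only: power_mult_distrib mult.assoc)
      finally show ?thesis by simp
    qed
    have e2: "measure Q {x. 1 / 2 < \<bar>x\<bar>} \<le> exp (2 * (\<alpha> + \<epsilon>)) * (fact (2 * Suc n) * 4 ^ Suc n) * h ^ Suc n"
    proof -
      have "2 / \<rho> * (\<integral>x. \<bar>x\<bar> * small \<rho> x \<partial>lborel) \<le> 2 / \<rho> * ((\<alpha> + \<epsilon>) * \<rho>)"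
        using small_first_moment(2)[OF bd \<rho>(1,2)] \<rho> by (intro mult_left_mono) auto
      also have "\<dots> = 2 * (\<alpha> + \<epsilon>)" using \<rho> by simp
      finally have "measure Q {x. 1 / 2 < \<bar>x\<bar>} \<le> exp (2 * (\<alpha> + \<epsilon>) - 1 / 2 / \<rho>)"
        by (intro order_trans[OF Q(3)[of "1 / 2"]]) simp
      also have "\<dots> = exp (2 * (\<alpha> + \<epsilon>)) * exp (- (1 / (2 * \<rho>)))" by (simp add: exp_add[symmetric])
      also have "\<dots> \<le> exp (2 * (\<alpha> + \<epsilon>)) * (fact (2 * Suc n) * (1 / (1 / (2 * \<rho>))) ^ (2 * Suc n))"
        using \<rho> by (intro mult_left_mono exp_minus_le_power) auto
      also have "(1 / (1 / (2 * \<rho>))) ^ (2 * Suc n) = 4 ^ Suc n * (\<rho>\<^sup>2) ^ Suc n"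
        unfolding power_mult by (simp add: power_mult_distrib)
      also have "exp (2 * (\<alpha> + \<epsilon>)) * (fact (2 * Suc n) * (4 ^ Suc n * (\<rho>\<^sup>2) ^ Suc n))
          \<le> exp (2 * (\<alpha> + \<epsilon>)) * (fact (2 * Suc n) * (4 ^ Suc n * h ^ Suc n))"
        using \<rho> by (intro mult_left_mono power_mono) auto
      finally show ?thesis by (simp only: mult.assoc)
    qed
    have "norm (versine_integral (Suc n) (\<lambda>v. cnj (exp (levy_exp (small \<rho>) (v / h))) * exp (levy_exp b (v / h))))
        \<le> K0 * h ^ Suc n + 4 ^ Suc n * sqrt (2 * pi) * (exp (- 1 / (8 * h\<^sup>2)) + measure Q {x. 1 / 2 < \<bar>x\<bar>})"
      using K0(2)[OF h Q(1)] unfolding integrand .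
    also have "\<dots> \<le> K0 * h ^ Suc n + 4 ^ Suc n * sqrt (2 * pi) * (fact (Suc n) * 8 ^ Suc n * h ^ Suc n
        + exp (2 * (\<alpha> + \<epsilon>)) * (fact (2 * Suc n) * 4 ^ Suc n) * h ^ Suc n)"
      by (intro add_left_mono mult_left_mono add_mono e1 e2) auto
    also have "\<dots> = K1 * h ^ Suc n" unfolding K1_def by (simp only: distrib_right distrib_left mult.assoc)
    finally show ?thesis .
  qed
  define A where "A = (1 + \<kappa>) * (\<alpha> + \<epsilon>)"
  have A: "A < real (Suc n)"
  proof -
    have "A = \<alpha> + \<epsilon> + \<kappa> * (\<alpha> + \<epsilon>)" by (simp add: A_def algebra_simps)
    also have "\<kappa> * (\<alpha> + \<epsilon>) \<le> \<kappa> * (\<alpha> + 1)" using \<kappa> \<epsilon> by (intro mult_left_mono) auto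
    finally show ?thesis using \<kappa>(3) \<epsilon>(5) gp by (simp add: gp_def)
  qed
  have key: "exp (- \<Lambda>) * (c0 - C7 * h powr (\<kappa> / 10)) \<le> K1 * h powr (real (Suc n) - A)"
    if h: "0 < h" "h \<le> 1" "real (Suc n) * h \<le> 1" "h powr (1 / 2) \<le> d" for h
  proof -
    define \<rho> where "\<rho> = h powr (1 - \<kappa>)"
    have \<rho>0: "0 < \<rho>" using h by (simp add: \<rho>_def)
    have mono: "h powr a \<le> h powr a'" if "a' \<le> a" for a a'
      using that h by (intro powr_mono') auto
    have h\<rho>: "h \<le> \<rho>" using mono[of "1 - \<kappa>" 1] \<kappa> h by (simp add: \<rho>_def)
    have \<rho>d: "\<rho> \<le> d" using mono[of "1 / 2" "1 - \<kappa>"] \<kappa> h(4) by (simp add: \<rho>_def)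
    have \<rho>2: "\<rho>\<^sup>2 \<le> h"
    proof -
      have "\<rho>\<^sup>2 = h powr (2 * (1 - \<kappa>))" by (simp add: \<rho>_def power2_eq_square powr_add[symmetric])
      also have "\<dots> \<le> h powr 1" using \<kappa> by (intro mono) auto
      finally show ?thesis using h by simp
    qed
    have K: "\<rho> / h = h powr (- \<kappa>)" using powr_diff[of h "1 - \<kappa>" 1] h by (simp add: \<rho>_def)
    have 1: "\<rho> powr (\<alpha> + \<epsilon>) * (\<rho> / h) powr (- 2 * (\<alpha> + \<epsilon>)) = h powr A"
    proof -
      have "(1 - \<kappa>) * (\<alpha> + \<epsilon>) + - \<kappa> * (- 2 * (\<alpha> + \<epsilon>)) = A"
        by (simp add: A_def algebra_simps)
      then show ?thesis unfolding K unfolding \<rho>_def powr_powr powr_add[symmetric] by (rule arg_cong)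
    qed
    have 2: "\<rho> powr (- 2 * \<epsilon>) * (\<rho> / h) powr (- 2 * (\<alpha> - \<epsilon>) - 1 / 2)
        \<le> h powr (\<kappa> / 10) * (\<rho> / h) powr (- 2 * (\<alpha> + \<epsilon>))"
    proof -
      have "\<rho> powr (- 2 * \<epsilon>) * (\<rho> / h) powr (- 2 * (\<alpha> - \<epsilon>) - 1 / 2)
          = h powr ((1 - \<kappa>) * (- 2 * \<epsilon>) + - \<kappa> * (- 2 * (\<alpha> - \<epsilon>) - 1 / 2))"
        unfolding K unfolding \<rho>_def powr_powr powr_add[symmetric] ..
      also have "\<dots> \<le> h powr (\<kappa> / 10 + - \<kappa> * (- 2 * (\<alpha> + \<epsilon>)))"
      proof (rule mono)
        have "\<kappa> * \<epsilon> \<le> 1 / 2 * \<epsilon>" using \<kappa> \<epsilon> by (intro mult_right_mono) auto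
        moreover have "(1 - \<kappa>) * (- 2 * \<epsilon>) + - \<kappa> * (- 2 * (\<alpha> - \<epsilon>) - 1 / 2)
            - (\<kappa> / 10 + - \<kappa> * (- 2 * (\<alpha> + \<epsilon>))) = \<kappa> / 2 - \<kappa> / 10 - 2 * \<epsilon> - 2 * (\<kappa> * \<epsilon>)"
          by (simp add: algebra_simps)
        ultimately show "\<kappa> / 10 + - \<kappa> * (- 2 * (\<alpha> + \<epsilon>)) \<le> (1 - \<kappa>) * (- 2 * \<epsilon>) + - \<kappa> * (- 2 * (\<alpha> - \<epsilon>) - 1 / 2)"
          using \<epsilon>(2) \<epsilon>(1) by linarith
      qed
      also have "\<dots> = h powr (\<kappa> / 10) * (\<rho> / h) powr (- 2 * (\<alpha> + \<epsilon>))"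
        unfolding K by (simp only: powr_powr powr_add)
      finally show ?thesis .
    qed
    have "exp (- \<Lambda>) * (c0 - C7 * h powr (\<kappa> / 10)) * h powr A
        = exp (- \<Lambda>) * \<rho> powr (\<alpha> + \<epsilon>) * (c0 * (\<rho> / h) powr (- 2 * (\<alpha> + \<epsilon>))
          - C7 * (h powr (\<kappa> / 10) * (\<rho> / h) powr (- 2 * (\<alpha> + \<epsilon>))))"
      unfolding 1[symmetric] by (simp only: algebra_simps)
    also have "\<dots> \<le> exp (- \<Lambda>) * \<rho> powr (\<alpha> + \<epsilon>) * (c0 * (\<rho> / h) powr (- 2 * (\<alpha> + \<epsilon>))
          - C7 * (\<rho> powr (- 2 * \<epsilon>) * (\<rho> / h) powr (- 2 * (\<alpha> - \<epsilon>) - 1 / 2)))"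
      by (intro mult_left_mono diff_left_mono 2 lower(2)) auto
    also have "\<dots> \<le> K1 * h ^ Suc n"
      by (rule order_trans[OF lower(3)[OF h(1) h\<rho> \<rho>d] upper[OF h(1,3) \<rho>0 \<rho>d \<rho>2]])
    also have "h ^ Suc n = h powr (real (Suc n) - A) * h powr A"
      using h by (simp only: powr_add[symmetric] powr_realpow[symmetric]) simp
    finally show ?thesis using h by (simp add: mult.assoc[symmetric])
  qed
  have id0: "((\<lambda>h::real. h) \<longlongrightarrow> 0) (at_right 0)" by (rule tendsto_ident_at)
  have pos: "eventually (\<lambda>h::real. 0 < h) (at_right 0)" by (rule eventually_at_right_less)
  then have pos': "eventually (\<lambda>h::real. 0 \<le> h) (at_right 0)" by eventually_elim simp
  have pt: "((\<lambda>h::real. h powr a) \<longlongrightarrow> 0) (at_right 0)" if "0 < a" for a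
    by (rule tendsto_zero_powrI[OF id0 tendsto_const pos' that])
  have "((\<lambda>h. exp (- \<Lambda>) * (c0 - C7 * h powr (\<kappa> / 10))) \<longlongrightarrow> exp (- \<Lambda>) * (c0 - C7 * 0)) (at_right 0)"
    using \<kappa> by (intro tendsto_intros pt) auto
  moreover have "((\<lambda>h. K1 * h powr (real (Suc n) - A)) \<longlongrightarrow> K1 * 0) (at_right 0)"
    using A by (intro tendsto_intros pt) auto
  moreover have "eventually (\<lambda>h. exp (- \<Lambda>) * (c0 - C7 * h powr (\<kappa> / 10)) \<le> K1 * h powr (real (Suc n) - A)) (at_right 0)"
  proof -
    have "eventually (\<lambda>h::real. h < 1) (at_right 0)" "eventually (\<lambda>h::real. h < 1 / real (Suc n)) (at_right 0)"
      using order_tendstoD(2)[OF id0] by auto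
    moreover have "eventually (\<lambda>h::real. h powr (1 / 2) < d) (at_right 0)"
      using order_tendstoD(2)[OF pt[of "1 / 2"] d(1)] by simp
    ultimately show ?thesis using pos
    proof eventually_elim
      case (elim h)
      then have "real (Suc n) * h \<le> 1" by (simp add: field_simps)
      with elim show ?case by (intro key) auto
    qed
  qed
  ultimately have "exp (- \<Lambda>) * (c0 - C7 * 0) \<le> K1 * 0"
    by (intro tendsto_le[OF trivial_limit_at_right_real]) auto
  then show False using lower(1) by (simp add: mult_le_0_iff)
qed

lemma integrable_power_mult_char:
  assumes bands: "\<And>\<epsilon>. 0 < \<epsilon> \<Longrightarrow> \<exists>d. band \<epsilon> d"
    and \<mu>: "real_distribution \<mu>" and le: "\<And>u. norm (char \<mu> u) \<le> norm (exp (levy_exp b u))"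
    and n: "real n < \<alpha> - 1" and i: "i \<le> n"
  shows "integrable lborel (\<lambda>u. \<bar>u\<bar> ^ i * norm (char \<mu> u))"
proof -
  interpret real_distribution \<mu> by (rule \<mu>)
  define \<epsilon> where "\<epsilon> = (\<alpha> - 1 - real n) / 2"
  have \<epsilon>: "0 < \<epsilon>" "\<epsilon> \<le> \<alpha>" using n by (auto simp: \<epsilon>_def field_simps)
  obtain d where bd: "band \<epsilon> d" using bands[OF \<epsilon>(1)] by blast
  have d: "0 < d" using bd by (simp add: band_def)
  show ?thesis
  proof (rule integrable_even_power_decay[OF char_measurable cmod_char_le_1])
    show "real i + 1 < \<alpha> - \<epsilon>" using n i by (simp add: \<epsilon>_def field_simps)
    fix u :: real assume u: "u \<noteq> 0"
    have "norm (char \<mu> u) \<le> exp (- ((\<alpha> - \<epsilon>) * (ln (\<bar>u\<bar> * d) - 2)))"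
      using le[of u] norm_exp_levy_exp_le[OF bd \<epsilon>(2) u] by linarith
    also have "\<dots> = exp (- ((\<alpha> - \<epsilon>) * (ln d - 2))) * \<bar>u\<bar> powr (- (\<alpha> - \<epsilon>))"
      using u d by (simp add: ln_mult powr_def exp_add[symmetric] algebra_simps)
    finally show "norm (char \<mu> u) \<le> exp (- ((\<alpha> - \<epsilon>) * (ln d - 2))) * \<bar>u\<bar> powr (- (\<alpha> - \<epsilon>))" .
  qed
qed

end

section \<open>From the characteristic triplet to a jump density\<close>

text \<open>Absolute continuity of \<open>\<bar>x\<bar> \<nu>(dx)\<close> passes to \<open>\<nu>\<close> because \<open>\<nu>\<close> does not charge 0, and integrability of
  \<open>min 1 (x\<^sup>2)\<close> makes the Radon-Nikodym derivative finite almost everywhere.\<close>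

lemma levy_measure_density:
  assumes L: "levy_measure \<nu>" and ac: "x_measure_ac \<nu>"
  obtains b :: "real \<Rightarrow> real" where "b \<in> borel_measurable borel" "\<And>x. 0 \<le> b x"
    "\<nu> = density lborel (\<lambda>x. ennreal (b x))" "integrable lborel (\<lambda>x. min 1 (x\<^sup>2) * b x)"
proof -
  have s[measurable_cong]: "sets \<nu> = sets borel" and z: "emeasure \<nu> {0} = 0"
    and fin: "(\<integral>\<^sup>+ x. ennreal (min 1 (x\<^sup>2)) \<partial>\<nu>) < \<infinity>"
    using L by (auto simp: levy_measure_def)
  have "absolutely_continuous lborel \<nu>"
    unfolding absolutely_continuous_def
  proof
    fix A :: "real set" assume A: "A \<in> null_sets lborel"
    then have "A \<in> null_sets (density \<nu> (\<lambda>x. ennreal \<bar>x\<bar>))"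
      using ac by (auto simp: x_measure_ac_def absolutely_continuous_def)
    then have "A \<in> sets \<nu>" "AE x in \<nu>. x \<in> A \<longrightarrow> ennreal \<bar>x\<bar> = 0"
      by (simp_all add: null_sets_density_iff)
    moreover have "{0} \<in> null_sets \<nu>" using z s by auto
    then have "AE x in \<nu>. x \<noteq> 0" by (rule AE_I'[of "{0}"]) auto
    ultimately have "AE x in \<nu>. x \<notin> A" by (auto elim: eventually_elim2)
    then show "A \<in> null_sets \<nu>" using \<open>A \<in> sets \<nu>\<close> AE_iff_null_sets by blast
  qed
  then obtain f where f[measurable]: "f \<in> borel_measurable borel" and \<nu>f: "density lborel f = \<nu>"
    using sigma_finite_measure.Radon_Nikodym[OF lborel.sigma_finite_measure_axioms, of \<nu>] s by auto
  have "(\<integral>\<^sup>+ x. f x * ennreal (min 1 (x\<^sup>2)) \<partial>lborel) < \<infinity>"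
    using fin unfolding \<nu>f[symmetric] by (subst (asm) nn_integral_density) auto
  then have fin': "(\<integral>\<^sup>+ x. f x * ennreal (min 1 (x\<^sup>2)) \<partial>lborel) \<noteq> \<infinity>" by simp
  have "AE x in lborel. f x * ennreal (min 1 (x\<^sup>2)) \<noteq> \<infinity>"
    by (rule nn_integral_PInf_AE[OF _ fin']) measurable
  then have ffin: "AE x in lborel. f x \<noteq> \<infinity>"
    using AE_lborel_singleton[of 0]
  proof eventually_elim
    case (elim x)
    then have "0 < x\<^sup>2" by simp
    then have "0 < min 1 (x\<^sup>2)" by simp
    then have "ennreal (min 1 (x\<^sup>2)) \<noteq> 0" unfolding ennreal_eq_0_iff by linarith
    with elim(1) show ?case by (auto simp: ennreal_mult_eq_top_iff)
  qed
  define b where "b x = enn2real (f x)" for x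
  have bf: "AE x in lborel. ennreal (b x) = f x"
    using ffin by eventually_elim (simp add: b_def ennreal_enn2real_if)
  show thesis
  proof (rule that[of b])
    show bm[measurable]: "b \<in> borel_measurable borel" unfolding b_def[abs_def] by measurable
    show b0: "0 \<le> b x" for x by (simp add: b_def)
    show "\<nu> = density lborel (\<lambda>x. ennreal (b x))"
      unfolding \<nu>f[symmetric] by (rule density_cong) (use bf in \<open>auto elim: eventually_mono\<close>)
    have "(\<integral>\<^sup>+ x. ennreal (min 1 (x\<^sup>2) * b x) \<partial>lborel) = (\<integral>\<^sup>+ x. f x * ennreal (min 1 (x\<^sup>2)) \<partial>lborel)"
      by (rule nn_integral_cong_AE)
        (use bf in eventually_elim, simp add: ennreal_mult b0 mult.commute)
    then show "integrable lborel (\<lambda>x. min 1 (x\<^sup>2) * b x)"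
      using fin' b0 by (intro integrableI_nonneg) (auto simp: top.not_eq_extremum)
  qed
qed

lemma sym_jump_measure_density:
  assumes b[measurable]: "b \<in> borel_measurable borel" and b0: "\<And>x. 0 \<le> b x"
    and \<nu>: "\<nu> = density lborel (\<lambda>x. ennreal (b x))"
  shows "sym_jump_measure \<nu> = density (restrict_space lborel {0..}) (\<lambda>x. ennreal (b x + b (- x)))"
proof (rule measure_eqI)
  have "sets (restrict_space borel {0::real..}) \<subseteq> Pow {0..}"
    using sets.space_closed[of "restrict_space borel {0::real..}"] by (simp add: space_restrict_space)
  then have se: "sets (sym_jump_measure \<nu>) = sets (restrict_space borel {0..})"
    unfolding sym_jump_measure_def
    using sets.sigma_sets_eq[of "restrict_space borel {0::real..}"] by (simp add: space_restrict_space)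
  then show "sets (sym_jump_measure \<nu>) = sets (density (restrict_space lborel {0..}) (\<lambda>x. ennreal (b x + b (- x))))"
    by (simp add: sets_restrict_space)
  fix A assume "A \<in> sets (sym_jump_measure \<nu>)"
  then have A[measurable]: "A \<in> sets borel" and A0: "A \<subseteq> {0..}"
    unfolding se by (auto simp: sets_restrict_space_iff)
  have neg: "uminus ` A = uminus -` A" by (auto simp: image_iff) (metis add.inverse_inverse)
  have [measurable]: "uminus ` A \<in> sets borel"
    unfolding neg using measurable_sets[of "uminus :: real \<Rightarrow> real" borel borel A] by simp
  have "emeasure (sym_jump_measure \<nu>) A = emeasure \<nu> A + emeasure \<nu> (uminus ` A)"
    by (rule emeasure_sym_jump_measure) (use A A0 in \<open>auto simp: \<nu>\<close>)
  also have "emeasure \<nu> (uminus ` A) = (\<integral>\<^sup>+x. ennreal (b x) * indicator (uminus ` A) x \<partial>lborel)"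
    unfolding \<nu> by (rule emeasure_density) auto
  also have "\<dots> = (\<integral>\<^sup>+x. ennreal (b (- x)) * indicator A x \<partial>lborel)"
    using nn_integral_real_affine[of "\<lambda>x. ennreal (b x) * indicator (uminus ` A) x" "-1" 0]
    by (simp add: neg indicator_def)
  also have "emeasure \<nu> A = (\<integral>\<^sup>+x. ennreal (b x) * indicator A x \<partial>lborel)"
    unfolding \<nu> by (rule emeasure_density) auto
  also have "(\<integral>\<^sup>+x. ennreal (b x) * indicator A x \<partial>lborel) + (\<integral>\<^sup>+x. ennreal (b (- x)) * indicator A x \<partial>lborel)
      = (\<integral>\<^sup>+x. ennreal (b x) * indicator A x + ennreal (b (- x)) * indicator A x \<partial>lborel)"
    by (rule nn_integral_add[symmetric]) auto
  also have "\<dots> = (\<integral>\<^sup>+x. ennreal (b x + b (- x)) * indicator A x * indicator {0..} x \<partial>lborel)"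
    by (rule nn_integral_cong) (use A0 b0 in \<open>auto simp: indicator_def\<close>)
  also have "\<dots> = (\<integral>\<^sup>+x. ennreal (b x + b (- x)) * indicator A x \<partial>restrict_space lborel {0..})"
    by (subst nn_integral_restrict_space) auto
  also have "\<dots> = emeasure (density (restrict_space lborel {0..}) (\<lambda>x. ennreal (b x + b (- x)))) A"
    by (rule emeasure_density[symmetric])
      (use A A0 in \<open>auto simp: sets_restrict_space_iff intro!: measurable_restrict_space1\<close>)
  finally show "emeasure (sym_jump_measure \<nu>) A = \<dots>" .
qed

lemma x_density_on_sym_jump_measure:
  assumes b[measurable]: "b \<in> borel_measurable borel" and b0: "\<And>x. 0 \<le> b x"
    and \<nu>: "\<nu> = density lborel (\<lambda>x. ennreal (b x))"
    and k: "x_density_on {0<..\<delta>} (sym_jump_measure \<nu>) k"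
  shows "AE x in lborel. 0 < x \<longrightarrow> x \<le> \<delta> \<longrightarrow> x * (b x + b (- x)) = k x"
proof -
  have km[measurable]: "k \<in> borel_measurable borel" and k0: "AE x in lborel. x \<in> {0<..\<delta>} \<longrightarrow> 0 \<le> k x"
    and kA: "\<And>A. A \<in> sets borel \<Longrightarrow> A \<subseteq> {0<..\<delta>} \<Longrightarrow>
        (\<integral>\<^sup>+ x\<in>A. ennreal x \<partial>sym_jump_measure \<nu>) = (\<integral>\<^sup>+ x\<in>A. ennreal (k x) \<partial>lborel)"
    using k by (auto simp: x_density_on_def)
  let ?I = "{0<..\<delta>}"
  let ?f = "\<lambda>x. ennreal (x * (b x + b (- x))) * indicator ?I x" and ?g = "\<lambda>x. ennreal (k x) * indicator ?I x"
  have "density lborel ?f = density lborel ?g"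
  proof (rule measure_eqI)
    fix B assume "B \<in> sets (density lborel ?f)"
    then have B[measurable]: "B \<in> sets borel" by simp
    let ?A = "B \<inter> ?I"
    have "emeasure (density lborel ?f) B = (\<integral>\<^sup>+x. ?f x * indicator B x \<partial>lborel)"
      by (rule emeasure_density) auto
    also have "\<dots> = (\<integral>\<^sup>+x. ennreal (b x + b (- x)) * (ennreal x * indicator ?A x) * indicator {0..} x \<partial>lborel)"
      by (rule nn_integral_cong) (use b0 in \<open>auto simp: indicator_def ennreal_mult mult_ac\<close>)
    also have "\<dots> = (\<integral>\<^sup>+x. ennreal (b x + b (- x)) * (ennreal x * indicator ?A x) \<partial>restrict_space lborel {0..})"
      by (subst nn_integral_restrict_space) auto
    also have "\<dots> = (\<integral>\<^sup>+x. ennreal x * indicator ?A x \<partial>sym_jump_measure \<nu>)"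
      unfolding sym_jump_measure_density[OF b b0 \<nu>]
      by (rule nn_integral_density[symmetric]) (auto intro!: measurable_restrict_space1)
    also have "\<dots> = (\<integral>\<^sup>+x. ennreal (k x) * indicator ?A x \<partial>lborel)"
      by (rule kA) auto
    also have "\<dots> = (\<integral>\<^sup>+x. ?g x * indicator B x \<partial>lborel)"
      by (rule nn_integral_cong) (auto simp: indicator_def)
    also have "\<dots> = emeasure (density lborel ?g) B"
      by (rule emeasure_density[symmetric]) auto
    finally show "emeasure (density lborel ?f) B = emeasure (density lborel ?g) B" .
  qed simp
  then have "AE x in lborel. ?f x = ?g x"
    by (subst (asm) sigma_finite_measure.density_unique_iff[OF lborel.sigma_finite_measure_axioms]) auto
  with k0 show ?thesis
  proof eventually_elim
    case (elim x)
    show ?case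
    proof (intro impI)
      assume x: "0 < x" "x \<le> \<delta>"
      have "0 \<le> x * (b x + b (- x))" using x b0 by (intro mult_nonneg_nonneg add_nonneg_nonneg) auto
      then show "x * (b x + b (- x)) = k x" using elim x by simp
    qed
  qed
qed

text \<open>As \<open>x (b(x) + b(-x))\<close> is bounded near 0, even \<open>min 1 \<bar>x\<bar>\<close> is integrable, not only \<open>min 1 (x\<^sup>2)\<close>.\<close>

lemma jump_density_of_triplet:
  assumes L: "levy_measure \<nu>" and ac: "x_measure_ac \<nu>" and \<delta>: "0 < \<delta>"
    and k: "x_density_on {0<..\<delta>} (sym_jump_measure \<nu>) k"
    and lim: "(k \<longlongrightarrow> \<alpha>) (at_right 0)" and \<alpha>: "0 < \<alpha>"
  obtains b where "jump_density b \<alpha>" "\<nu> = density lborel (\<lambda>x. ennreal (b x))"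
    "\<And>\<epsilon>. 0 < \<epsilon> \<Longrightarrow> \<exists>d. jump_density.band b \<alpha> \<epsilon> d"
proof -
  obtain b where b[measurable]: "b \<in> borel_measurable borel" and b0: "\<And>x. 0 \<le> b x"
    and \<nu>: "\<nu> = density lborel (\<lambda>x. ennreal (b x))" and bi: "integrable lborel (\<lambda>x. min 1 (x\<^sup>2) * b x)"
    by (rule levy_measure_density[OF L ac]) (rule that)
  note AEk = x_density_on_sym_jump_measure[OF b b0 \<nu> k]
  have near: "\<exists>d. 0 < d \<and> d \<le> 1 \<and>
      (AE x in lborel. 0 < x \<longrightarrow> x \<le> d \<longrightarrow> \<bar>x * (b x + b (- x)) - \<alpha>\<bar> \<le> \<epsilon>)" if \<epsilon>: "0 < \<epsilon>" for \<epsilon>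
  proof -
    have "eventually (\<lambda>x. dist (k x) \<alpha> < \<epsilon>) (at_right 0)"
      using lim \<epsilon> by (simp add: tendsto_iff)
    then obtain e where e: "0 < e" "\<And>x. 0 < x \<Longrightarrow> x < e \<Longrightarrow> \<bar>k x - \<alpha>\<bar> < \<epsilon>"
      by (auto simp: eventually_at_right_field dist_real_def)
    define d where "d = min (min 1 \<delta>) (e / 2)"
    have d: "0 < d" "d \<le> 1" "d \<le> \<delta>" "d < e" using e \<delta> by (auto simp: d_def min_def)
    have "AE x in lborel. 0 < x \<longrightarrow> x \<le> d \<longrightarrow> \<bar>x * (b x + b (- x)) - \<alpha>\<bar> \<le> \<epsilon>"
      using AEk
    proof eventually_elim
      case (elim x)
      then show ?case using e(2)[of x] d by auto
    qed
    then show ?thesis using d by blast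
  qed
  have int: "integrable lborel (\<lambda>x. min 1 \<bar>x\<bar> * b x)"
  proof -
    obtain d where d: "0 < d" "d \<le> 1" and
      A: "AE x in lborel. 0 < x \<longrightarrow> x \<le> d \<longrightarrow> \<bar>x * (b x + b (- x)) - \<alpha>\<bar> \<le> 1"
      using near[of 1] by auto
    let ?w = "\<lambda>x. (\<alpha> + 1) * indicator {-d..d} x + 1 / d\<^sup>2 * (min 1 (x\<^sup>2) * b x)"
    show ?thesis
    proof (rule Bochner_Integration.integrable_bound)
      show "integrable lborel ?w"
        by (intro Bochner_Integration.integrable_add integrable_mult_right bi) (use d in auto)
      show "AE x in lborel. norm (min 1 \<bar>x\<bar> * b x) \<le> norm (?w x)"
        using A AE_reflect[OF A]
      proof eventually_elim
        case (elim x)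
        have w0: "0 \<le> (\<alpha> + 1) * indicator {-d..d} x" "0 \<le> 1 / d\<^sup>2 * (min 1 (x\<^sup>2) * b x)"
          using \<alpha> b0[of x] by (auto simp: indicator_def)
        have m0: "0 \<le> min 1 \<bar>x\<bar> * b x" using b0[of x] by simp
        have "min 1 \<bar>x\<bar> * b x \<le> ?w x"
        proof (cases "\<bar>x\<bar> \<le> d")
          case True
          have "\<bar>x\<bar> * (b x + b (- x)) \<le> \<alpha> + 1"
            using elim True \<alpha> by (cases "0 < x"; cases "x < 0") (auto simp: abs_le_iff add.commute)
          moreover have "min 1 \<bar>x\<bar> * b x \<le> \<bar>x\<bar> * (b x + b (- x))"
            using b0[of x] b0[of "- x"] by (intro mult_mono) auto
          moreover have "indicator {-d..d} x = (1::real)" using True by (auto simp: abs_le_iff)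
          ultimately show ?thesis using w0(2) by simp
        next
          case False
          have "min 1 \<bar>x\<bar> \<le> 1 / d\<^sup>2 * min 1 (x\<^sup>2)"
          proof -
            have "d\<^sup>2 \<le> \<bar>x\<bar>\<^sup>2" using False d by (intro power_mono) auto
            then have "d\<^sup>2 \<le> min 1 (x\<^sup>2)" using d by (simp add: power_le_one)
            then have "1 \<le> 1 / d\<^sup>2 * min 1 (x\<^sup>2)" using d by (simp add: field_simps)
            then show ?thesis by linarith
          qed
          from mult_right_mono[OF this b0[of x]] show ?thesis using w0(1) by (simp add: mult.assoc)
        qed
        then show "norm (min 1 \<bar>x\<bar> * b x) \<le> norm (?w x)" using m0 by simp
      qed
    qed measurable
  qed
  have J: "jump_density b \<alpha>" using b b0 int \<alpha> by unfold_locales auto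
  show thesis
    by (rule that[OF J \<nu>]) (use near in \<open>auto simp: jump_density.band_def[OF J]\<close>)
qed

section \<open>Existence and regularity of the Lebesgue density\<close>

text \<open>An affine image of the standard normal law, which is a Dirac measure if \<open>\<sigma>2 = 0\<close>.\<close>

lemma gaussian_factor:
  assumes s: "0 \<le> \<sigma>2"
  obtains G where "real_distribution G"
    "\<And>u. char G u = iexp (u * c) * of_real (exp (- (\<sigma>2 / 2 * u\<^sup>2)))"
proof -
  let ?N = "std_normal_distribution" and ?T = "\<lambda>x. sqrt \<sigma>2 * x + c"
  interpret N: real_distribution ?N by (rule real_dist_normal_dist)
  show thesis
  proof (rule that[of "distr ?N borel ?T"])
    show "real_distribution (distr ?N borel ?T)" by (rule N.real_distribution_distr) simp
    fix u :: real
    have "char (distr ?N borel ?T) u = (\<integral>x. iexp (u * ?T x) \<partial>?N)"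
      unfolding char_def by (rule integral_distr) auto
    also have "\<dots> = (\<integral>x. iexp (u * c) * iexp ((u * sqrt \<sigma>2) * x) \<partial>?N)"
      by (intro Bochner_Integration.integral_cong refl) (simp add: exp_add[symmetric] algebra_simps)
    also have "\<dots> = iexp (u * c) * char ?N (u * sqrt \<sigma>2)" by (simp add: char_def)
    also have "\<dots> = iexp (u * c) * of_real (exp (- (\<sigma>2 / 2 * u\<^sup>2)))"
      using s by (simp add: char_std_normal_distribution power_mult_distrib mult.commute)
    finally show "char (distr ?N borel ?T) u = iexp (u * c) * of_real (exp (- (\<sigma>2 / 2 * u\<^sup>2)))" .
  qed
qed

text \<open>The compensating term is integrable by itself and is absorbed into the drift.\<close>

lemma char_triplet_eq:
  assumes J: "jump_density b \<alpha>" and \<nu>: "\<nu> = density lborel (\<lambda>x. ennreal (b x))"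
    and T: "has_triplet \<mu> \<sigma>2 \<gamma> \<nu>"
  obtains c where "\<And>u. char \<mu> u = iexp (u * c) * of_real (exp (- (\<sigma>2 / 2 * u\<^sup>2))) * exp (levy_exp b u)"
proof -
  interpret jump_density b \<alpha> by (rule J)
  define m where "m = (\<integral>x. x * indicator {-1..1} x * b x \<partial>lborel)"
  have mi: "integrable lborel (\<lambda>x. x * indicator {-1..1} x * b x)"
  proof (rule Bochner_Integration.integrable_bound[OF b_integrable])
    show "AE x in lborel. norm (x * indicator {-1..1} x * b x) \<le> norm (min 1 \<bar>x\<bar> * b x)"
    proof (rule AE_I2)
      fix x :: real
      have "min 1 \<bar>x\<bar> = \<bar>x\<bar>" if "x \<in> {-1..1}"
      proof -
        have "\<bar>x\<bar> \<le> 1" using that by auto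
        then show ?thesis by simp
      qed
      then show "norm (x * indicator {-1..1} x * b x) \<le> norm (min 1 \<bar>x\<bar> * b x)"
        by (cases "x \<in> {-1..1}") (simp_all add: abs_mult)
    qed
  qed measurable
  have lev: "(CLINT x|\<nu>. iexp (u * x) - 1 - \<i> * complex_of_real (u * x * indicator {-1..1} x))
      = levy_exp b u - \<i> * of_real (u * m)" for u
  proof -
    have "(CLINT x|\<nu>. iexp (u * x) - 1 - \<i> * complex_of_real (u * x * indicator {-1..1} x))
      = (CLINT x|lborel. b x *\<^sub>R (iexp (u * x) - 1 - \<i> * complex_of_real (u * x * indicator {-1..1} x)))"
      unfolding \<nu> using b_nonneg by (intro integral_density) auto
    also have "\<dots> = (CLINT x|lborel. complex_of_real (b x) * (iexp (u * x) - 1)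
        - \<i> * of_real u * of_real (x * indicator {-1..1} x * b x))"
      by (intro Bochner_Integration.integral_cong refl)
        (simp add: scaleR_conv_of_real right_diff_distrib mult_ac)
    also have "\<dots> = levy_exp b u - (CLINT x|lborel. \<i> * of_real u * of_real (x * indicator {-1..1} x * b x))"
      unfolding levy_exp_def
      by (rule Bochner_Integration.integral_diff[OF integrable_levy_exp[OF b_measurable b_integrable]])
        (intro integrable_mult_right integrable_of_real mi)
    also have "(CLINT x|lborel. \<i> * of_real u * complex_of_real (x * indicator {-1..1} x * b x))
        = \<i> * of_real u * complex_of_real m"
      unfolding m_def by (simp only: integral_mult_right_zero integral_complex_of_real)
    finally show ?thesis by simp
  qed
  show thesis
  proof (rule that[of "\<gamma> - m"])
    fix u
    have "char \<mu> u = exp (- complex_of_real (\<sigma>2 / 2 * u\<^sup>2) + \<i> * complex_of_real (\<gamma> * u)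
        + (levy_exp b u - \<i> * of_real (u * m)))"
      using T unfolding has_triplet_def lev by blast
    also have "- complex_of_real (\<sigma>2 / 2 * u\<^sup>2) + \<i> * complex_of_real (\<gamma> * u) + (levy_exp b u - \<i> * of_real (u * m))
        = \<i> * of_real (u * (\<gamma> - m)) + of_real (- (\<sigma>2 / 2 * u\<^sup>2)) + levy_exp b u"
      by (simp add: algebra_simps)
    finally show "char \<mu> u = iexp (u * (\<gamma> - m)) * of_real (exp (- (\<sigma>2 / 2 * u\<^sup>2))) * exp (levy_exp b u)"
      by (simp only: exp_add exp_of_real)
  qed
qed

lemma lebesgue_density_exists:
  assumes \<mu>: "real_distribution \<mu>" and null: "\<And>A. A \<in> null_sets lborel \<Longrightarrow> emeasure \<mu> A = 0"
  shows "\<exists>f. lebesgue_density \<mu> f"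
proof -
  interpret real_distribution \<mu> by (rule \<mu>)
  have "absolutely_continuous lborel \<mu>"
    unfolding absolutely_continuous_def by (auto intro!: null_setsI null)
  then obtain f where f[measurable]: "f \<in> borel_measurable borel" and \<mu>f: "density lborel f = \<mu>"
    using sigma_finite_measure.Radon_Nikodym[OF lborel.sigma_finite_measure_axioms, of \<mu>] by auto
  have "(\<integral>\<^sup>+ x. f x \<partial>lborel) = emeasure \<mu> (space \<mu>)"
    unfolding \<mu>f[symmetric] by (simp add: emeasure_density)
  then have fin: "(\<integral>\<^sup>+ x. f x \<partial>lborel) \<noteq> \<infinity>" using emeasure_space_1 by simp
  have "AE x in lborel. f x \<noteq> \<infinity>"
    by (rule nn_integral_PInf_AE[OF _ fin]) measurable
  then have "AE x in lborel. ennreal (enn2real (f x)) = f x"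
    by eventually_elim (simp add: ennreal_enn2real_if)
  then have "\<mu> = density lborel (\<lambda>x. ennreal (enn2real (f x)))"
    unfolding \<mu>f[symmetric] by (intro density_cong) (auto elim: eventually_mono)
  then have "lebesgue_density \<mu> (\<lambda>x. enn2real (f x))"
    by (auto simp: lebesgue_density_def)
  then show ?thesis by blast
qed

lemma continuous_AE_nonneg:
  fixes g :: "real \<Rightarrow> real"
  assumes c: "continuous_on UNIV g" and AE: "AE x in lborel. 0 \<le> g x"
  shows "0 \<le> g x"
proof (rule ccontr)
  assume "\<not> 0 \<le> g x"
  then have ne: "{x. g x < 0} \<noteq> {}" by (auto simp: not_le)
  have op: "open {x. g x < 0}" using c by (intro open_Collect_less continuous_on_const)
  then have "{x. g x < 0} \<in> sets borel" by auto
  then have "{x. g x < 0} \<in> null_sets lborel"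
    using AE by (subst (asm) AE_iff_null) (auto simp: not_le)
  then have "negligible {x. g x < 0}"
    by (simp add: negligible_iff_null_sets null_sets_completionI)
  then show False using open_not_negligible[OF op ne] by simp
qed

lemma C_class_continuous:
  assumes "C_class n g"
  shows "continuous_on UNIV g"
proof (cases n)
  case 0
  then show ?thesis using assms by (simp add: C_class_def)
next
  case (Suc k)
  then have "isCont g x" for x
    using C_class_SucD(1)[of k g x] assms by (auto intro: DERIV_isCont)
  then show ?thesis by (simp add: continuous_at_imp_continuous_on)
qed

theorem corollary6:
  fixes \<mu> \<nu> :: "real measure" and \<sigma>2 \<gamma> \<delta> \<alpha> :: real and k :: "real \<Rightarrow> real"
  assumes "infinitely_divisible \<mu>"
    and "has_triplet \<mu> \<sigma>2 \<gamma> \<nu>"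
    and "0 < \<delta>" and "\<delta> < 1"
    and "x_density_on {0<..\<delta>} (sym_jump_measure \<nu>) k"
    and "\<And>\<epsilon>. 0 < \<epsilon> \<Longrightarrow> \<epsilon> < \<delta> \<Longrightarrow> k \<in> BV \<epsilon> \<delta>"
    and "\<exists>L::real. ((\<lambda>\<epsilon>. TV_pos k \<epsilon> \<delta>) \<longlongrightarrow> L) (at_right 0)"
    and "k \<in> BV 0 \<delta>"
    and "x_measure_ac \<nu>"
    and "(k \<longlongrightarrow> \<alpha>) (at_right 0)" and "\<alpha> > 0" and "\<alpha> \<notin> \<nat>"
  shows "(\<exists>f. lebesgue_density \<mu> f) \<and>
    (\<forall>f. lebesgue_density \<mu> f \<longrightarrow> (\<forall>n::nat.
       (real n < \<alpha> - 1 \<longrightarrow> ae_C_class n f) \<and>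
       (\<sigma>2 = 0 \<longrightarrow> (ae_C_class n f \<longleftrightarrow> real n < \<alpha> - 1))))"
proof -
  have \<mu>: "real_distribution \<mu>" using assms(1) by (simp add: infinitely_divisible_def)
  have s: "0 \<le> \<sigma>2" and L: "levy_measure \<nu>" using assms(2) by (auto simp: has_triplet_def)
  obtain b where J: "jump_density b \<alpha>" and \<nu>: "\<nu> = density lborel (\<lambda>x. ennreal (b x))"
    and bands: "\<And>\<epsilon>. 0 < \<epsilon> \<Longrightarrow> \<exists>d. jump_density.band b \<alpha> \<epsilon> d"
    by (rule jump_density_of_triplet[OF L assms(9,3,5,10,11)]) (rule that)
  interpret jump_density b \<alpha> by (rule J)
  obtain c where ch: "\<And>u. char \<mu> u = iexp (u * c) * of_real (exp (- (\<sigma>2 / 2 * u\<^sup>2))) * exp (levy_exp b u)"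
    by (rule char_triplet_eq[OF J \<nu> assms(2)]) (rule that)
  interpret M: real_distribution \<mu> by (rule \<mu>)
  have ex: "\<exists>f. lebesgue_density \<mu> f"
  proof (rule lebesgue_density_exists[OF \<mu>])
    fix A :: "real set" assume A: "A \<in> null_sets lborel"
    obtain G where G: "real_distribution G"
      "\<And>u. char G u = iexp (u * c) * of_real (exp (- (\<sigma>2 / 2 * u\<^sup>2)))"
      by (rule gaussian_factor[OF s]) (rule that)
    obtain d where bd: "band (\<alpha> / 2) d" using bands[of "\<alpha> / 2"] \<alpha>_pos by auto
    show "emeasure \<mu> A = 0"
      by (rule emeasure_null_of_jump_factor[OF \<mu> G(1) _ bd _ A]) (use ch G(2) \<alpha>_pos in auto)
  qed
  have smooth: "ae_C_class n f" if f: "lebesgue_density \<mu> f" and n: "real n < \<alpha> - 1" for f n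
  proof -
    have le: "norm (char \<mu> u) \<le> norm (exp (levy_exp b u))" for u
    proof -
      have "norm (char \<mu> u) = exp (- (\<sigma>2 / 2 * u\<^sup>2)) * norm (exp (levy_exp b u))"
        unfolding ch norm_mult norm_of_real by simp
      also have "\<dots> \<le> 1 * norm (exp (levy_exp b u))"
        using s by (intro mult_right_mono) auto
      finally show ?thesis by simp
    qed
    note int = integrable_power_mult_char[OF bands \<mu> le n]
    have "C_class n (fourier_deriv (char \<mu>) 0)"
      by (rule C_class_fourier_deriv[OF M.char_measurable int])
    moreover have "AE x in lborel. f x = fourier_deriv (char \<mu>) 0 x"
      by (rule density_eq_fourier[OF f \<mu>]) (use int[of 0] in simp)
    ultimately show ?thesis unfolding ae_C_class_def by blast
  qed
  have rough: "real n < \<alpha> - 1" if f: "lebesgue_density \<mu> f" and s0: "\<sigma>2 = 0" and C: "ae_C_class n f" for f n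
  proof -
    obtain g where g: "C_class n g" and fg: "AE x in lborel. f x = g x"
      using C by (auto simp: ae_C_class_def)
    have fm[measurable]: "f \<in> borel_measurable borel" and f0: "AE x in lborel. 0 \<le> f x"
      and \<mu>f: "\<mu> = density lborel (\<lambda>x. ennreal (f x))"
      using f by (auto simp: lebesgue_density_def)
    have gc: "continuous_on UNIV g" by (rule C_class_continuous[OF g])
    have gm[measurable]: "g \<in> borel_measurable borel" by (rule borel_measurable_continuous_onI[OF gc])
    have "AE x in lborel. 0 \<le> g x" using f0 fg by eventually_elim simp
    then have g0: "0 \<le> g x" for x by (rule continuous_AE_nonneg[OF gc])
    have \<mu>g: "\<mu> = density lborel (\<lambda>x. ennreal (g x))"
      unfolding \<mu>f by (rule density_cong) (use fg in \<open>auto elim: eventually_mono\<close>)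
    have "real (Suc n) \<le> \<alpha>"
      by (rule C_class_density_order_le[OF bands \<mu> \<mu>g gm g0 g, of c]) (use ch s0 in auto)
    moreover have "real (Suc n) \<noteq> \<alpha>" using assms(12) by (metis of_nat_in_Nats)
    ultimately show ?thesis by simp
  qed
  show ?thesis using ex smooth rough by blast
qed

end
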